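(* For every integer $n$ with $2\le n\le 7$ there exist real numbers $r,\mu$ (depending only on $n$) with $r(n-1)2\sqrt2+\mu=1$ such that the following holds. Whenever qubit states $\{\rho^{(j)}_{a|x}\}$ ($j\in\{1,\dots,n\}$, $a,x\in\{0,1\}$) and a POVM $\{\mathcal M_s\}_{s\in\{0,1\}^n}$ on $(\mathbb C^2)^{\otimes n}$ satisfy $\mathcal S\ge 1-\epsilon$, there is a local channel $\Lambda=\bigotimes_{j=1}^n\Lambda^{(j)}$ witnessing the following lower bound on the average fidelity: $$\mathcal F(\{\mathcal M_s\}_s)\ \ge\ \big(r(n-1)2\sqrt2+\mu\big)-r(n-1)2\sqrt2\,\epsilon .$$ For $n=2$ one can take $r=(4+5\sqrt2)/16$ and $\mu=-(1+2\sqrt2)/4$, so that $$\mathcal F(\{\mathcal M_s\}_s)\ \ge\ 1-\frac{4+5\sqrt2}{4\sqrt2}\,\epsilon .$$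
   Context: There are $n$ senders and one receiver. Sender $j$, on input $(a_j,x_j)\in\{0,1\}^2$, sends a qubit state (density operator on $\mathbb C^2$) $\rho^{(j)}_{a_j|x_j}$. The receiver has no input and performs on the $n$ received qubits (tensor factors ordered $1,\dots,n$) a POVM $\{\mathcal M_s\}_s$ (positive semidefinite operators with $\sum_s\mathcal M_s=\mathbb 1$) whose outcomes are $n$-bit strings $s=s_ns_{n-1}\cdots s_1$. Define $\mathcal A^{(j)}_{x}=\rho^{(j)}_{0|x}-\rho^{(j)}_{1|x}$ and, for each $s$, $$\mathcal W_s=(n-1)(-1)^{s_1}\big(\mathcal A^{(1)}_0+\mathcal A^{(1)}_1\big)\otimes\bigotimes_{j=2}^n\mathcal A^{(j)}_0+\sum_{j=2}^n(-1)^{s_j}\big(\mathcal A^{(1)}_0-\mathcal A^{(1)}_1\big)\otimes\mathcal A^{(j)}_1,$$ where in the second sum $\mathcal A^{(1)}$ acts on qubit $1$, $\mathcal A^{(j)}_1$ acts on qubit $j$, and the identity acts on all other qubits. The success metric is $$\mathcal S=\frac1{2^n(n-1)2\sqrt2}\sum_{s\in\{0,1\}^n}\operatorname{Tr}(\mathcal M_s\mathcal W_s).$$ The ideal (GHZ) measurement is given by $$|\xi_s\rangle=\tfrac1{\sqrt2}\big(|0\,s_2\cdots s_n\rangle+(-1)^{s_1}|1\,\overline{s_2}\cdots\overline{s_n}\rangle\big),\qquad \overline{s_j}=1-s_j.$$ The average fidelity of $\{\mathcal M_s\}_s$ with the ideal measurement is $$\mathcal F(\{\mathcal M_s\}_s)=\max_{\Lambda}\frac1{2^n}\sum_sF(|\xi_s\rangle\langle\xi_s|,\Lambda[\mathcal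 M_s]),\qquad F(|\xi_s\rangle\langle\xi_s|,\Lambda[\mathcal M_s])=\operatorname{Tr}\big(\mathcal M_s\,\Lambda^\dagger[|\xi_s\rangle\langle\xi_s|]\big),$$ where the maximum is over local quantum channels $\Lambda=\bigotimes_{j=1}^n\Lambda^{(j)}$ with each $\Lambda^{(j)}$ a (completely positive, trace preserving) qubit-to-qubit channel, and $\Lambda^\dagger$ is the dual (Hilbert–Schmidt adjoint) map of $\Lambda$. A local channel $\Lambda$ "witnesses" a lower bound on $\mathcal F$ if the quantity being maximized already satisfies that bound at $\Lambda$. *)

theory Defs
  imports Complex_Main "HOL-Library.FuncSet" "Jordan_Normal_Form.Schur_Decomposition"
begin

section \<open>Operators on finite-dimensional Hilbert spaces\<close>

definition mtrace :: "complex mat \<Rightarrow> complex" where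
  "mtrace A = (\<Sum>i<dim_row A. A $$ (i, i))"

definition msum :: "nat \<Rightarrow> ('i \<Rightarrow> complex mat) \<Rightarrow> 'i set \<Rightarrow> complex mat" where
  "msum d f I = mat d d (\<lambda>p. \<Sum>i\<in>I. f i $$ p)"

definition mat_unit :: "nat \<Rightarrow> nat \<Rightarrow> nat \<Rightarrow> complex mat" where
  "mat_unit d i k = mat d d (\<lambda>p. if p = (i, k) then 1 else 0)"

text \<open>The order on \<^typ>\<open>complex\<close> is the one in which \<open>0 \<le> z\<close> says that \<open>z\<close> is real and nonnegative;
  over the complex numbers this makes positive semidefinite matrices Hermitian.\<close>

definition psd :: "nat \<Rightarrow> complex mat \<Rightarrow> bool" where
  "psd d A \<longleftrightarrow> A \<in> carrier_mat d d \<and> (\<forall>v\<in>carrier_vec d. 0 \<le> (A *\<^sub>v v) \<bullet>c v)"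

definition density :: "nat \<Rightarrow> complex mat \<Rightarrow> bool" where
  "density d A \<longleftrightarrow> psd d A \<and> mtrace A = 1"

definition projector :: "complex vec \<Rightarrow> complex mat" where
  "projector v = mat (dim_vec v) (dim_vec v) (\<lambda>(i, k). v $ i * cnj (v $ k))"


section \<open>Quantum channels\<close>

definition linear_map :: "nat \<Rightarrow> (complex mat \<Rightarrow> complex mat) \<Rightarrow> bool" where
  "linear_map d L \<longleftrightarrow>
     (\<forall>X\<in>carrier_mat d d. L X \<in> carrier_mat d d) \<and>
     (\<forall>X\<in>carrier_mat d d. \<forall>Y\<in>carrier_mat d d. L (X + Y) = L X + L Y) \<and>
     (\<forall>c. \<forall>X\<in>carrier_mat d d. L (c \<cdot>\<^sub>m X) = c \<cdot>\<^sub>m L X)"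

text \<open>A matrix of size \<open>m * d\<close> is read as an \<open>m \<times> m\<close> array of blocks of size \<open>d\<close>;
  \<open>ampliation m d L\<close> is the map \<open>id\<^sub>m \<otimes> L\<close>, which applies \<open>L\<close> to every block.\<close>

definition block :: "nat \<Rightarrow> complex mat \<Rightarrow> nat \<Rightarrow> nat \<Rightarrow> complex mat" where
  "block d X p q = mat d d (\<lambda>(a, b). X $$ (p * d + a, q * d + b))"

definition ampliation ::
    "nat \<Rightarrow> nat \<Rightarrow> (complex mat \<Rightarrow> complex mat) \<Rightarrow> complex mat \<Rightarrow> complex mat" where
  "ampliation m d L X =
     mat (m * d) (m * d) (\<lambda>(i, k). L (block d X (i div d) (k div d)) $$ (i mod d, k mod d))"

definition completely_positive :: "nat \<Rightarrow> (complex mat \<Rightarrow> complex mat) \<Rightarrow> bool" where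
  "completely_positive d L \<longleftrightarrow> (\<forall>m X. psd (m * d) X \<longrightarrow> psd (m * d) (ampliation m d L X))"

definition channel :: "nat \<Rightarrow> (complex mat \<Rightarrow> complex mat) \<Rightarrow> bool" where
  "channel d L \<longleftrightarrow> linear_map d L \<and> completely_positive d L \<and>
     (\<forall>X\<in>carrier_mat d d. mtrace (L X) = mtrace X)"

text \<open>The Hilbert--Schmidt adjoint, given by its matrix entries
  \<open>\<langle>E\<^sub>i\<^sub>k, L\<^sup>\<dagger>(Y)\<rangle> = \<langle>L(E\<^sub>i\<^sub>k), Y\<rangle>\<close>, where \<open>\<langle>A, B\<rangle> = Tr(A\<^sup>\<dagger> B)\<close>; see \<open>hs_adjoint_adjoint\<close>.\<close>

definition hs_adjoint ::
    "nat \<Rightarrow> (complex mat \<Rightarrow> complex mat) \<Rightarrow> complex mat \<Rightarrow> complex mat" where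
  "hs_adjoint d L Y = mat d d (\<lambda>(i, k). mtrace (mat_adjoint (L (mat_unit d i k)) * Y))"


section \<open>Qubit registers\<close>

text \<open>Qubits are numbered \<open>1, \<dots>, n\<close> and tensor factors are ordered the same way, so the basis
  vector \<open>|b\<^sub>1 \<dots> b\<^sub>n\<rangle>\<close> has index \<open>b\<^sub>1 2\<^bsup>n-1\<^esup> + \<dots> + b\<^sub>n\<close>.
  \<open>digit n i j\<close> recovers \<open>b\<^sub>j\<close> from the index \<open>i\<close>.\<close>

definition digit :: "nat \<Rightarrow> nat \<Rightarrow> nat \<Rightarrow> nat" where
  "digit n i j = i div 2 ^ (n - j) mod 2"

definition ket :: "nat \<Rightarrow> (nat \<Rightarrow> nat) \<Rightarrow> complex vec" where
  "ket n b = unit_vec (2 ^ n) (\<Sum>j\<in>{1..n}. b j * 2 ^ (n - j))"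

text \<open>\<open>tensor n A\<close> is \<open>A 1 \<otimes> \<dots> \<otimes> A n\<close> for \<open>2 \<times> 2\<close> matrices \<open>A j\<close>.\<close>

definition tensor :: "nat \<Rightarrow> (nat \<Rightarrow> complex mat) \<Rightarrow> complex mat" where
  "tensor n A = mat (2 ^ n) (2 ^ n) (\<lambda>(i, k). \<Prod>j\<in>{1..n}. A j $$ (digit n i j, digit n k j))"

text \<open>\<open>tensor_map n L\<close> is \<open>L 1 \<otimes> \<dots> \<otimes> L n\<close>: the linear map sending the matrix unit
  \<open>E\<^sub>i\<^sub>k\<close>, which is the tensor product of the single-qubit matrix units
  \<open>mat_unit 2 (digit n i j) (digit n k j)\<close>, to the tensor product of their images; see
  \<open>tensor_map_tensor\<close>.\<close>

definition tensor_map ::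
    "nat \<Rightarrow> (nat \<Rightarrow> complex mat \<Rightarrow> complex mat) \<Rightarrow> complex mat \<Rightarrow> complex mat" where
  "tensor_map n L X =
     msum (2 ^ n) (\<lambda>(i, k). X $$ (i, k) \<cdot>\<^sub>m
         tensor n (\<lambda>j. L j (mat_unit 2 (digit n i j) (digit n k j))))
       ({..<2 ^ n} \<times> {..<2 ^ n})"

definition bitstrings :: "nat \<Rightarrow> (nat \<Rightarrow> nat) set" where
  "bitstrings n = {1..n} \<rightarrow>\<^sub>E {0, 1}"


section \<open>The prepare-and-measure scenario\<close>

text \<open>\<open>\<rho> j a x\<close> is the state sent by sender \<open>j\<close> on input \<open>(a, x)\<close>, and \<open>M s\<close> is the
  element of the receiver's measurement for the outcome with bits \<open>s 1, \<dots>, s n\<close>.\<close>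

definition qubit_states :: "nat \<Rightarrow> (nat \<Rightarrow> nat \<Rightarrow> nat \<Rightarrow> complex mat) \<Rightarrow> bool" where
  "qubit_states n \<rho> \<longleftrightarrow> (\<forall>j\<in>{1..n}. \<forall>a\<in>{0, 1}. \<forall>x\<in>{0, 1}. density 2 (\<rho> j a x))"

definition povm :: "nat \<Rightarrow> ((nat \<Rightarrow> nat) \<Rightarrow> complex mat) \<Rightarrow> bool" where
  "povm n M \<longleftrightarrow> (\<forall>s\<in>bitstrings n. psd (2 ^ n) (M s)) \<and> msum (2 ^ n) M (bitstrings n) = 1\<^sub>m (2 ^ n)"

definition obs :: "(nat \<Rightarrow> nat \<Rightarrow> nat \<Rightarrow> complex mat) \<Rightarrow> nat \<Rightarrow> nat \<Rightarrow> complex mat" where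
  "obs \<rho> j x = \<rho> j 0 x - \<rho> j 1 x"

definition W ::
    "nat \<Rightarrow> (nat \<Rightarrow> nat \<Rightarrow> nat \<Rightarrow> complex mat) \<Rightarrow> (nat \<Rightarrow> nat) \<Rightarrow> complex mat" where
  "W n \<rho> s =
     (of_nat (n - 1) * (- 1) ^ s 1) \<cdot>\<^sub>m
       tensor n (\<lambda>k. if k = 1 then obs \<rho> 1 0 + obs \<rho> 1 1 else obs \<rho> k 0)
     + msum (2 ^ n)
         (\<lambda>j. (- 1) ^ s j \<cdot>\<^sub>m
            tensor n (\<lambda>k. if k = 1 then obs \<rho> 1 0 - obs \<rho> 1 1
                          else if k = j then obs \<rho> j 1 else 1\<^sub>m 2))
         {2..n}"

definition success ::
    "nat \<Rightarrow> (nat \<Rightarrow> nat \<Rightarrow> nat \<Rightarrow> complex mat) \<Rightarrow> ((nat \<Rightarrow> nat) \<Rightarrow> complex mat) \<Rightarrow> real" where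
  "success n \<rho> M =
     1 / (2 ^ n * (real n - 1) * 2 * sqrt 2) * (\<Sum>s\<in>bitstrings n. Re (mtrace (M s * W n \<rho> s)))"

definition ghz :: "nat \<Rightarrow> (nat \<Rightarrow> nat) \<Rightarrow> complex vec" where
  "ghz n s = complex_of_real (1 / sqrt 2) \<cdot>\<^sub>v
     (ket n (s(1 := 0)) + (- 1) ^ s 1 \<cdot>\<^sub>v ket n ((\<lambda>j. 1 - s j)(1 := 1)))"

definition local_channel :: "nat \<Rightarrow> (nat \<Rightarrow> complex mat \<Rightarrow> complex mat) \<Rightarrow> bool" where
  "local_channel n L \<longleftrightarrow> (\<forall>j\<in>{1..n}. channel 2 (L j))"

text \<open>The average of \<open>F(|\<xi>\<^sub>s\<rangle>\<langle>\<xi>\<^sub>s|, \<Lambda>[M\<^sub>s]) = Tr(M\<^sub>s \<Lambda>\<^sup>\<dagger>[|\<xi>\<^sub>s\<rangle>\<langle>\<xi>\<^sub>s|])\<close> over all \<open>s\<close>, for the local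
  channel \<open>\<Lambda> = L 1 \<otimes> \<dots> \<otimes> L n\<close>.\<close>

definition fidelity_at ::
    "nat \<Rightarrow> ((nat \<Rightarrow> nat) \<Rightarrow> complex mat) \<Rightarrow> (nat \<Rightarrow> complex mat \<Rightarrow> complex mat) \<Rightarrow> real" where
  "fidelity_at n M L = 1 / 2 ^ n *
     (\<Sum>s\<in>bitstrings n. Re (mtrace (M s * hs_adjoint (2 ^ n) (tensor_map n L) (projector (ghz n s)))))"

text \<open>The maximum over the (compact) set of local channels is written as a supremum.\<close>

definition avg_fidelity :: "nat \<Rightarrow> ((nat \<Rightarrow> nat) \<Rightarrow> complex mat) \<Rightarrow> real" where
  "avg_fidelity n M = (SUP L\<in>{L. local_channel n L}. fidelity_at n M L)"

section \<open>Consistency of the explicit formulas\<close>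

lemma digit_lt [simp]: "digit n i j < 2"
  by (simp add: digit_def)

lemma tensor_carrier [simp]: "tensor n A \<in> carrier_mat (2 ^ n) (2 ^ n)"
  by (simp add: tensor_def)

lemma msum_carrier [simp]: "msum d f I \<in> carrier_mat d d"
  by (simp add: msum_def)

lemma mat_unit_carrier [simp]: "mat_unit d i k \<in> carrier_mat d d"
  by (simp add: mat_unit_def)

lemma linear_map_msum:
  assumes L: "linear_map d L" and "finite I" and "\<And>i. i \<in> I \<Longrightarrow> f i \<in> carrier_mat d d"
  shows "L (msum d f I) = msum d (\<lambda>i. L (f i)) I"
  using assms(2,3)
proof (induction I)
  case empty
  have z: "msum d g {} = 0\<^sub>m d d" for g :: "'a \<Rightarrow> complex mat"
    by (rule eq_matI) (simp_all add: msum_def)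
  have "0\<^sub>m d d = (0::complex) \<cdot>\<^sub>m 0\<^sub>m d d" by (rule eq_matI) simp_all
  then have "L (0\<^sub>m d d) = 0 \<cdot>\<^sub>m L (0\<^sub>m d d)"
    using L unfolding linear_map_def by (metis zero_carrier_mat)
  moreover have "L (0\<^sub>m d d) \<in> carrier_mat d d"
    using L unfolding linear_map_def by simp
  ultimately have "L (0\<^sub>m d d) = 0\<^sub>m d d"
    by (intro eq_matI) (metis index_smult_mat(1) index_zero_mat carrier_matD mult_zero_left, auto)
  then show ?case by (simp add: z)
next
  case (insert i I)
  have step: "msum d g (insert i I) = g i + msum d g I" if "g i \<in> carrier_mat d d"
    for g :: "'a \<Rightarrow> complex mat"
    using that insert.hyps by (intro eq_matI) (auto simp: msum_def)
  have fi: "f i \<in> carrier_mat d d" using insert.prems by simp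
  moreover have "L (f i) \<in> carrier_mat d d" using L fi unfolding linear_map_def by simp
  moreover have "L (f i + msum d f I) = L (f i) + L (msum d f I)"
    using L fi unfolding linear_map_def by simp
  ultimately show ?case using step[of f] step[of "\<lambda>i. L (f i)"] insert by simp
qed

lemma mat_unit_decomposition:
  assumes "X \<in> carrier_mat d d"
  shows "X = msum d (\<lambda>(i, k). X $$ (i, k) \<cdot>\<^sub>m mat_unit d i k) ({..<d} \<times> {..<d})"
proof (rule eq_matI, goal_cases)
  case (1 a b)
  then have ab: "a < d" "b < d" by (simp_all add: msum_def)
  have "(\<Sum>p\<in>{..<d} \<times> {..<d}. (case p of (i, k) \<Rightarrow> X $$ (i, k) \<cdot>\<^sub>m mat_unit d i k) $$ (a, b))
      = (\<Sum>p\<in>{..<d} \<times> {..<d}. if p = (a, b) then X $$ p else 0)"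
    using ab by (intro sum.cong) (auto simp: mat_unit_def)
  also have "\<dots> = X $$ (a, b)" using ab by (simp add: sum.delta)
  finally show ?case using ab by (simp add: msum_def)
qed (use assms in \<open>auto simp: msum_def\<close>)

lemma linear_map_entry:
  assumes L: "linear_map d L" and X: "X \<in> carrier_mat d d" and ab: "a < d" "b < d"
  shows "L X $$ (a, b) = (\<Sum>i<d. \<Sum>k<d. X $$ (i, k) * L (mat_unit d i k) $$ (a, b))"
proof -
  let ?f = "\<lambda>(i, k). X $$ (i, k) \<cdot>\<^sub>m mat_unit d i k"
  have "L X = L (msum d ?f ({..<d} \<times> {..<d}))"
    using mat_unit_decomposition[OF X] by simp
  also have "\<dots> = msum d (\<lambda>p. L (?f p)) ({..<d} \<times> {..<d})"
    by (rule linear_map_msum[OF L]) (auto split: prod.splits)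
  finally have "L X $$ (a, b) = (\<Sum>p\<in>{..<d} \<times> {..<d}. L (?f p) $$ (a, b))"
    using ab by (simp add: msum_def)
  also have "\<dots> = (\<Sum>p\<in>{..<d} \<times> {..<d}.
      case p of (i, k) \<Rightarrow> X $$ (i, k) * L (mat_unit d i k) $$ (a, b))"
  proof (rule sum.cong)
    fix p :: "nat \<times> nat"
    obtain i k where p: "p = (i, k)" by force
    have "L (mat_unit d i k) \<in> carrier_mat d d"
      and "L (X $$ (i, k) \<cdot>\<^sub>m mat_unit d i k) = X $$ (i, k) \<cdot>\<^sub>m L (mat_unit d i k)"
      using L unfolding linear_map_def by simp_all
    then show "L (?f p) $$ (a, b)
        = (case p of (i, k) \<Rightarrow> X $$ (i, k) * L (mat_unit d i k) $$ (a, b))"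
      using ab p by simp
  qed simp
  finally show ?thesis by (simp add: sum.cartesian_product)
qed

lemma mat_adjoint_entry:
  assumes "A \<in> carrier_mat d d" "i < d" "k < d"
  shows "mat_adjoint A $$ (i, k) = cnj (A $$ (k, i))"
  using assms by (simp add: mat_adjoint_def mat_of_rows_def)

lemma mtrace_adjoint_mult:
  assumes A: "A \<in> carrier_mat d d" and B: "B \<in> carrier_mat d d"
  shows "mtrace (mat_adjoint A * B) = (\<Sum>i<d. \<Sum>k<d. cnj (A $$ (i, k)) * B $$ (i, k))"
proof -
  have A': "mat_adjoint A \<in> carrier_mat d d"
    using A by (auto simp: mat_adjoint_def)
  have "mtrace (mat_adjoint A * B) = (\<Sum>k<d. \<Sum>i<d. cnj (A $$ (i, k)) * B $$ (i, k))"
    using A A' B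
    by (auto simp: mtrace_def scalar_prod_def mat_adjoint_entry atLeast0LessThan
        simp del: mat_adjoint_def intro!: sum.cong)
  also have "\<dots> = (\<Sum>i<d. \<Sum>k<d. cnj (A $$ (i, k)) * B $$ (i, k))"
    by (rule sum.swap)
  finally show ?thesis .
qed

lemma hs_adjoint_adjoint:
  assumes L: "linear_map d L" and X: "X \<in> carrier_mat d d" and Y: "Y \<in> carrier_mat d d"
  shows "mtrace (mat_adjoint (L X) * Y) = mtrace (mat_adjoint X * hs_adjoint d L Y)"
proof -
  have LE: "L (mat_unit d i k) \<in> carrier_mat d d" for i k
    using L unfolding linear_map_def by simp
  have LX: "L X \<in> carrier_mat d d" using L X unfolding linear_map_def by simp
  have H: "hs_adjoint d L Y \<in> carrier_mat d d" by (simp add: hs_adjoint_def)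
  let ?t = "\<lambda>a b i k. cnj (X $$ (i, k)) * (cnj (L (mat_unit d i k) $$ (a, b)) * Y $$ (a, b))"
  have pairs: "(\<Sum>a<d. \<Sum>b<d. g a b) = (\<Sum>p\<in>{..<d} \<times> {..<d}. g (fst p) (snd p))"
    for g :: "nat \<Rightarrow> nat \<Rightarrow> complex"
    by (simp add: sum.cartesian_product case_prod_beta)
  have "mtrace (mat_adjoint (L X) * Y) = (\<Sum>a<d. \<Sum>b<d. \<Sum>i<d. \<Sum>k<d. ?t a b i k)"
    by (simp add: mtrace_adjoint_mult[OF LX Y] linear_map_entry[OF L X] sum_distrib_right
        mult.assoc)
  also have "\<dots> = (\<Sum>p\<in>{..<d} \<times> {..<d}. \<Sum>q\<in>{..<d} \<times> {..<d}. ?t (fst p) (snd p) (fst q) (snd q))"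
    by (simp only: pairs)
  also have "\<dots> = (\<Sum>q\<in>{..<d} \<times> {..<d}. \<Sum>p\<in>{..<d} \<times> {..<d}. ?t (fst p) (snd p) (fst q) (snd q))"
    by (rule sum.swap)
  also have "\<dots> = (\<Sum>i<d. \<Sum>k<d. \<Sum>a<d. \<Sum>b<d. ?t a b i k)"
    by (simp only: pairs)
  also have "\<dots> = mtrace (mat_adjoint X * hs_adjoint d L Y)"
    unfolding mtrace_adjoint_mult[OF X H]
    by (simp add: hs_adjoint_def mtrace_adjoint_mult[OF LE Y] sum_distrib_left)
  finally show ?thesis .
qed

lemma sum_prod_digit:
  fixes f :: "nat \<Rightarrow> nat \<Rightarrow> complex"
  shows "(\<Sum>i<2 ^ n. \<Prod>j\<in>{1..n}. f j (digit n i j)) = (\<Prod>j\<in>{1..n}. \<Sum>a<2. f j a)"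
proof (induction n)
  case (Suc n)
  have dig: "digit (Suc n) (2 * i + a) j = digit n i j" if "j \<le> n" "a < 2" for i a j
    using that by (simp add: digit_def Suc_diff_le div_mult2_eq)
  have dig': "digit (Suc n) (2 * i + a) (Suc n) = a" if "a < 2" for i a
    using that by (simp add: digit_def)
  let ?g = "\<lambda>i. \<Prod>j\<in>{1..Suc n}. f j (digit (Suc n) i j)"
  have split: "(\<Sum>i<2 * m. g i) = (\<Sum>i<m. g (2 * i) + g (2 * i + 1))"
    for m and g :: "nat \<Rightarrow> complex"
    by (induction m) (simp_all add: algebra_simps)
  have g: "?g (2 * i + a) = (\<Prod>j\<in>{1..n}. f j (digit n i j)) * f (Suc n) a" if "a < 2" for i a
  proof -
    have "(\<Prod>j\<in>{1..n}. f j (digit (Suc n) (2 * i + a) j)) = (\<Prod>j\<in>{1..n}. f j (digit n i j))"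
      using that by (intro prod.cong) (simp_all add: dig)
    then show ?thesis using that by (simp add: dig')
  qed
  have "(\<Sum>i<2 ^ Suc n. ?g i) = (\<Sum>i<2 ^ n. ?g (2 * i + 0) + ?g (2 * i + 1))"
    using split[of ?g "2 ^ n"] by simp
  also have "\<dots> = (\<Sum>i<2 ^ n. (\<Prod>j\<in>{1..n}. f j (digit n i j)) * (\<Sum>a<2. f (Suc n) a))"
    by (simp only: g) (simp add: numeral_2_eq_2 algebra_simps)
  also have "\<dots> = (\<Prod>j\<in>{1..n}. \<Sum>a<2. f j a) * (\<Sum>a<2. f (Suc n) a)"
    by (simp only: Suc.IH flip: sum_distrib_right)
  finally show ?case by simp
qed simp

lemma tensor_map_tensor:
  assumes L: "\<And>j. j \<in> {1..n} \<Longrightarrow> linear_map 2 (L j)"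
    and A: "\<And>j. j \<in> {1..n} \<Longrightarrow> A j \<in> carrier_mat 2 2"
  shows "tensor_map n L (tensor n A) = tensor n (\<lambda>j. L j (A j))"
proof (rule eq_matI, goal_cases)
  case (1 p q)
  then have pq: "p < 2 ^ n" "q < 2 ^ n" by (simp_all add: tensor_def)
  let ?h = "\<lambda>j a b. A j $$ (a, b) * L j (mat_unit 2 a b) $$ (digit n p j, digit n q j)"
  have "tensor_map n L (tensor n A) $$ (p, q)
      = (\<Sum>i<2 ^ n. \<Sum>k<2 ^ n. \<Prod>j\<in>{1..n}. ?h j (digit n i j) (digit n k j))"
    using pq unfolding sum.cartesian_product
    by (auto simp: tensor_map_def msum_def tensor_def prod.distrib intro!: sum.cong)
  also have "\<dots> = (\<Sum>i<2 ^ n. \<Prod>j\<in>{1..n}. \<Sum>b<2. ?h j (digit n i j) b)"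
    by (intro sum.cong refl) (subst sum_prod_digit[symmetric], rule refl)
  also have "\<dots> = (\<Prod>j\<in>{1..n}. \<Sum>a<2. \<Sum>b<2. ?h j a b)"
    by (rule sum_prod_digit)
  also have "\<dots> = (\<Prod>j\<in>{1..n}. L j (A j) $$ (digit n p j, digit n q j))"
    by (intro prod.cong refl linear_map_entry[symmetric] L A digit_lt)
  also have "\<dots> = tensor n (\<lambda>j. L j (A j)) $$ (p, q)"
    using pq by (simp add: tensor_def)
  finally show ?case .
qed (simp_all add: tensor_map_def tensor_def msum_def)

end

theory Submission
  imports Defs "HOL-Analysis.Euclidean_Space"
begin

text \<open>By multilinearity of the success metric all states may be taken with observables
  \<open>u \<cdot> \<sigma>\<close> for unit Bloch vectors \<open>u\<close>; then \<open>\<A>\<^sub>0 \<plusminus> \<A>\<^sub>1\<close> of the first sender are orthogonal, and every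
  channel used is a product of unitary rotations into frames read off from these vectors.
  For general \<open>n\<close>, near-optimal success forces the stabilizers of the GHZ basis to have expectation
  \<open>1 - O(\<epsilon>)\<close> in the rotated frame (the anticommutation of \<open>X \<otimes> \<cdots> \<otimes> X\<close> with \<open>Z\<^sub>1 X\<^sub>j\<close> controls the
  nonorthogonality of the observables of sender \<open>j\<close>), and a union bound over the stabilizers gives
  a linear bound. For \<open>n = 2\<close> the correlation matrix is brought to principal axes by a rotation
  that acts only on the second qubit and hence commutes with the sign changes on the first one.
  The four choices of signs of the principal axes give frames whose fidelities form a probability
  distribution, and mixing two of them proves the bound with the stated constant.\<close>

text \<open>For general \<open>n\<close> the equation between \<open>r\<close> and
  \<open>\<mu>\<close> is the only constraint on them, so every bound
  \<open>1 - C * \<epsilon>\<close> with \<open>C\<close> depending on \<open>n\<close> alone will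
  do. The quadratic growth of \<open>C = 40 * (n - 1)^2\<close> has two sources: the success metric
  controls only a sum of \<open>n - 1\<close> terms, so a single term may lose
  \<open>(n - 1) * \<epsilon>\<close>, and the union bound then adds up \<open>n - 1\<close> such
  losses. The obstacle is that the two observables of sender \<open>j\<close> need not be orthogonal
  and hence single out no Pauli frame. Gram-Schmidt supplies one for general \<open>n\<close>; for
  two senders a singular value decomposition of the pair of weighted directions supplies one that
  treats both observables on an equal footing. No mixed channel is built there: the mixing weights
  enter a numerical inequality, and the better of the two frames is the witness. No spectral theory
  enters either. Each operator inequality is an identity whose slack is a sum of explicit
  \<open>Q * mat_adjoint Q\<close>, on which a measurement has nonnegative expectation.\<close>

section \<open>Matrix entries, traces and positivity\<close>

lemma mat_adjoint_carrier [simp]: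
  "A \<in> carrier_mat d d \<Longrightarrow> mat_adjoint A \<in> carrier_mat d d"
  by (auto simp: mat_adjoint_def)

lemma mult_entry:
  assumes "A \<in> carrier_mat d d" "B \<in> carrier_mat d d" "i < d" "k < d"
  shows "(A * B) $$ (i, k) = (\<Sum>l<d. A $$ (i, l) * B $$ (l, k))"
  using assms by (auto simp: scalar_prod_def atLeast0LessThan)

lemma add_entry:
  assumes "A \<in> carrier_mat d d" "B \<in> carrier_mat d d" "i < d" "k < d"
  shows "(A + B) $$ (i, k) = A $$ (i, k) + B $$ (i, k)"
  using assms by auto

lemma smult_entry:
  assumes "A \<in> carrier_mat d d" "i < d" "k < d"
  shows "(c \<cdot>\<^sub>m A) $$ (i, k) = c * A $$ (i, k)"
  using assms by auto

lemma mtrace_mult: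
  assumes "A \<in> carrier_mat d d" "B \<in> carrier_mat d d"
  shows "mtrace (A * B) = (\<Sum>i<d. \<Sum>k<d. A $$ (i, k) * B $$ (k, i))"
proof -
  have "dim_row (A * B) = d" using assms by auto
  then show ?thesis
    unfolding mtrace_def using assms by (simp add: mult_entry[OF assms] del: index_mult_mat(1))
qed

lemma mtrace_mult_comm:
  assumes "A \<in> carrier_mat d d" "B \<in> carrier_mat d d"
  shows "mtrace (A * B) = mtrace (B * A)"
  unfolding mtrace_mult[OF assms] mtrace_mult[OF assms(2,1)]
  by (subst sum.swap) (simp add: mult.commute)

lemma mat_adjoint_adjoint:
  assumes "(A :: complex mat) \<in> carrier_mat d d"
  shows "mat_adjoint (mat_adjoint A) = A"
proof (rule eq_matI)
  fix i k assume "i < dim_row A" "k < dim_col A"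
  then show "mat_adjoint (mat_adjoint A) $$ (i, k) = A $$ (i, k)"
    using assms mat_adjoint_carrier[OF assms]
    by (simp add: mat_adjoint_entry[where d = d])
qed (use assms in \<open>auto simp: mat_adjoint_def\<close>)

lemma mat_adjoint_mult:
  assumes "(A :: complex mat) \<in> carrier_mat d d" "B \<in> carrier_mat d d"
  shows "mat_adjoint (A * B) = mat_adjoint B * mat_adjoint A"
proof (rule eq_matI)
  fix i k assume "i < dim_row (mat_adjoint B * mat_adjoint A)" "k < dim_col (mat_adjoint B * mat_adjoint A)"
  then have "i < d" "k < d" using assms by (auto simp: mat_adjoint_def)
  then show "mat_adjoint (A * B) $$ (i, k) = (mat_adjoint B * mat_adjoint A) $$ (i, k)"
    using assms mat_adjoint_carrier[OF assms(1)] mat_adjoint_carrier[OF assms(2)]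
      mult_carrier_mat[OF assms]
    by (simp add: mat_adjoint_entry[where d = d] mult_entry[where d = d] mult.commute
        del: index_mult_mat)
qed (use assms in \<open>auto simp: mat_adjoint_def\<close>)

lemma quadratic_form_entry:
  assumes "A \<in> carrier_mat d d" "v \<in> carrier_vec d"
  shows "(A *\<^sub>v v) \<bullet>c v = (\<Sum>i<d. \<Sum>k<d. A $$ (i, k) * v $ k * cnj (v $ i))"
  using assms by (auto simp: scalar_prod_def atLeast0LessThan sum_distrib_right)

text \<open>The quadratic form of \<open>Q * A * mat_adjoint Q\<close> at \<open>v\<close> is that
  of \<open>A\<close> at \<open>mat_adjoint Q *\<^sub>v v\<close>.\<close>

lemma psd_cong_mult:
  assumes A: "psd d A" and Q: "Q \<in> carrier_mat d d"
  shows "psd d (Q * A * mat_adjoint Q)"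
proof -
  have Ac: "A \<in> carrier_mat d d" using A by (simp add: psd_def)
  have "0 \<le> ((Q * A * mat_adjoint Q) *\<^sub>v v) \<bullet>c v" if v: "v \<in> carrier_vec d" for v
  proof -
    define w where "w = mat_adjoint Q *\<^sub>v v"
    have Q': "mat_adjoint Q \<in> carrier_mat d d" using Q by simp
    have w: "w \<in> carrier_vec d" using v Q' by (auto simp: w_def)
    have "(Q * A * mat_adjoint Q) *\<^sub>v v = Q *\<^sub>v (A *\<^sub>v w)"
      using Ac Q Q' v by (simp add: w_def assoc_mult_mat_vec[where n\<^sub>1 = d and n\<^sub>2 = d and n\<^sub>3 = d] assoc_mult_mat[of Q d d A d _ d]) 
    moreover have "(Q *\<^sub>v u) \<bullet>c v = u \<bullet>c w" if "u \<in> carrier_vec d" for u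
    proof -
      have "(Q *\<^sub>v u) \<bullet>c v = (\<Sum>i<d. \<Sum>k<d. Q $$ (i, k) * u $ k * cnj (v $ i))"
        using Q v that by (auto simp: scalar_prod_def atLeast0LessThan sum_distrib_right)
      also have "\<dots> = (\<Sum>k<d. \<Sum>i<d. Q $$ (i, k) * u $ k * cnj (v $ i))"
        by (rule sum.swap)
      also have "\<dots> = (\<Sum>k<d. u $ k * cnj (\<Sum>i<d. cnj (Q $$ (i, k)) * v $ i))"
        by (simp add: sum_distrib_left mult_ac)
      also have "\<dots> = (\<Sum>k<d. u $ k * cnj (w $ k))"
      proof (intro sum.cong refl)
        fix k assume "k \<in> {..<d}"
        then have "w $ k = (\<Sum>i<d. cnj (Q $$ (i, k)) * v $ i)"
          using carrier_matD[OF Q'] v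
          by (simp add: w_def scalar_prod_def atLeast0LessThan mat_adjoint_entry[OF Q])
        then show "u $ k * cnj (\<Sum>i<d. cnj (Q $$ (i, k)) * v $ i) = u $ k * cnj (w $ k)"
          by simp
      qed
      also have "\<dots> = u \<bullet>c w"
        using w that by (auto simp: scalar_prod_def atLeast0LessThan)
      finally show ?thesis .
    qed
    ultimately show ?thesis using A w Ac by (simp add: psd_def)
  qed
  moreover have "Q * A * mat_adjoint Q \<in> carrier_mat d d"
    by (intro mult_carrier_mat[where n = d] mat_adjoint_carrier Ac Q)
  ultimately show ?thesis by (simp add: psd_def)
qed

lemma psd_diag:
  assumes "psd d A" "i < d"
  shows "0 \<le> A $$ (i, i)"
proof -
  have "0 \<le> (A *\<^sub>v unit_vec d i) \<bullet>c unit_vec d i"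
    using assms by (simp add: psd_def)
  also have "\<dots> = (\<Sum>j<d. \<Sum>k<d. if j = i \<and> k = i then A $$ (i, i) else 0)"
    using assms by (subst quadratic_form_entry[where d = d]) (auto simp: psd_def intro!: sum.cong)
  also have "\<dots> = (\<Sum>j<d. if j = i then A $$ (i, i) else 0)"
    using assms by (intro sum.cong) auto
  also have "\<dots> = A $$ (i, i)"
    using assms by simp
  finally show ?thesis .
qed

text \<open>Cyclicity turns the trace into that of \<open>mat_adjoint Q * A * Q\<close>, whose
  diagonal entries are nonnegative. Positivity of the measurement operators reaches expectations
  through this fact.\<close>

lemma mtrace_psd_square:
  assumes "psd d A" "Q \<in> carrier_mat d d"
  shows "0 \<le> Re (mtrace (A * (Q * mat_adjoint Q)))"
proof -
  have Ac: "A \<in> carrier_mat d d" using assms by (simp add: psd_def)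
  have Q': "mat_adjoint Q \<in> carrier_mat d d" using assms by simp
  have "psd d (mat_adjoint Q * A * mat_adjoint (mat_adjoint Q))"
    using assms by (intro psd_cong_mult) auto
  then have p: "psd d (mat_adjoint Q * A * Q)"
    using mat_adjoint_adjoint[OF assms(2)] by simp
  have "mtrace (A * (Q * mat_adjoint Q)) = mtrace ((A * Q) * mat_adjoint Q)"
    using Ac assms Q' by (simp add: assoc_mult_mat[of _ d d _ d _ d])
  also have "\<dots> = mtrace (mat_adjoint Q * (A * Q))"
    using Ac assms Q' by (intro mtrace_mult_comm) auto
  also have "\<dots> = mtrace (mat_adjoint Q * A * Q)"
    using Ac assms Q' by (simp add: assoc_mult_mat[of _ d d _ d _ d])
  also have "\<dots> = (\<Sum>i<d. (mat_adjoint Q * A * Q) $$ (i, i))"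
    using assms(2) by (simp add: mtrace_def mat_adjoint_def)
  finally show ?thesis
    using psd_diag[OF p] by (auto simp: less_eq_complex_def intro!: sum_nonneg)
qed

section \<open>Expectations in the receiver's measurement\<close>

text \<open>A state on families of operators indexed by outcomes: linear, nonnegative on squares
  and, by the factor \<open>1 / 2 ^ n\<close>, equal to 1 on the identity. The argument depends on
  the outcome because the signs of the GHZ stabilizers do.\<close>

definition expect :: "nat \<Rightarrow> ((nat \<Rightarrow> nat) \<Rightarrow> complex mat) \<Rightarrow> ((nat \<Rightarrow> nat) \<Rightarrow> complex mat) \<Rightarrow> real" where
  "expect n M Y = 1 / 2 ^ n * (\<Sum>s\<in>bitstrings n. Re (mtrace (M s * Y s)))"

lemma povmD: "povm n M \<Longrightarrow> s \<in> bitstrings n \<Longrightarrow> psd (2 ^ n) (M s)"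
  "povm n M \<Longrightarrow> s \<in> bitstrings n \<Longrightarrow> M s \<in> carrier_mat (2 ^ n) (2 ^ n)"
  by (simp_all add: povm_def psd_def)

lemma expect_cong:
  assumes "\<And>s. s \<in> bitstrings n \<Longrightarrow> Y s = Z s"
  shows "expect n M Y = expect n M Z"
  using assms by (simp add: expect_def)

lemma expect_entries:
  assumes "povm n M" "\<And>s. s \<in> bitstrings n \<Longrightarrow> Y s \<in> carrier_mat (2 ^ n) (2 ^ n)"
  shows "expect n M Y = 1 / 2 ^ n * (\<Sum>s\<in>bitstrings n. \<Sum>i<2 ^ n. \<Sum>k<2 ^ n. Re (M s $$ (i, k) * Y s $$ (k, i)))"
  using assms by (simp add: expect_def mtrace_mult[where d = "2 ^ n"] povmD)

lemma expect_add:
  assumes M: "povm n M" and Y: "\<And>s. s \<in> bitstrings n \<Longrightarrow> Y s \<in> carrier_mat (2 ^ n) (2 ^ n)"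
    and Z: "\<And>s. s \<in> bitstrings n \<Longrightarrow> Z s \<in> carrier_mat (2 ^ n) (2 ^ n)"
  shows "expect n M (\<lambda>s. Y s + Z s) = expect n M Y + expect n M Z"
proof -
  have "expect n M (\<lambda>s. Y s + Z s) = 1 / 2 ^ n * (\<Sum>s\<in>bitstrings n. \<Sum>i<2 ^ n. \<Sum>k<2 ^ n. Re (M s $$ (i, k) * Y s $$ (k, i)) + Re (M s $$ (i, k) * Z s $$ (k, i)))"
    using Y Z by (subst expect_entries[OF M])
      (auto intro!: sum.cong simp: add_entry[OF Y Z] algebra_simps)
  then show ?thesis
    by (simp add: expect_entries[OF M Y] expect_entries[OF M Z] sum.distrib distrib_left)
qed

lemma expect_smult:
  assumes M: "povm n M" and Y: "\<And>s. s \<in> bitstrings n \<Longrightarrow> Y s \<in> carrier_mat (2 ^ n) (2 ^ n)"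
  shows "expect n M (\<lambda>s. complex_of_real c \<cdot>\<^sub>m Y s) = c * expect n M Y"
proof -
  have "expect n M (\<lambda>s. complex_of_real c \<cdot>\<^sub>m Y s) = 1 / 2 ^ n * (\<Sum>s\<in>bitstrings n. \<Sum>i<2 ^ n. \<Sum>k<2 ^ n. c * Re (M s $$ (i, k) * Y s $$ (k, i)))"
    using Y by (subst expect_entries[OF M])
      (auto intro!: sum.cong simp: smult_entry[OF Y] algebra_simps)
  then show ?thesis
    by (simp add: expect_entries[OF M Y] sum_distrib_left mult_ac)
qed

lemma expect_one:
  assumes M: "povm n M"
  shows "expect n M (\<lambda>s. 1\<^sub>m (2 ^ n)) = 1"
proof -
  have eq: "(\<Sum>s\<in>bitstrings n. M s $$ (i, i)) = 1" if "i < 2 ^ n" for i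
  proof -
    have "(msum (2 ^ n) M (bitstrings n)) $$ (i, i) = (1\<^sub>m (2 ^ n) :: complex mat) $$ (i, i)"
      using M by (simp add: povm_def)
    then show ?thesis using that by (simp add: msum_def)
  qed
  have "(\<Sum>s\<in>bitstrings n. Re (mtrace (M s * 1\<^sub>m (2 ^ n)))) = (\<Sum>s\<in>bitstrings n. \<Sum>i<2 ^ n. Re (M s $$ (i, i)))"
  proof (intro sum.cong refl)
    fix s assume "s \<in> bitstrings n"
    then have "M s \<in> carrier_mat (2 ^ n) (2 ^ n)" by (rule povmD[OF M])
    then show "Re (mtrace (M s * 1\<^sub>m (2 ^ n))) = (\<Sum>i<2 ^ n. Re (M s $$ (i, i)))"
      by (auto simp: mtrace_def)
  qed
  also have "\<dots> = (\<Sum>i<2 ^ n. \<Sum>s\<in>bitstrings n. Re (M s $$ (i, i)))"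
    by (rule sum.swap)
  also have "\<dots> = (\<Sum>i<2 ^ n. Re (\<Sum>s\<in>bitstrings n. M s $$ (i, i)))"
    by simp
  also have "\<dots> = 2 ^ n" using eq by simp
  finally show ?thesis by (simp add: expect_def)
qed

lemma expect_square:
  assumes "povm n M" "\<And>s. s \<in> bitstrings n \<Longrightarrow> Q s \<in> carrier_mat (2 ^ n) (2 ^ n)"
  shows "0 \<le> expect n M (\<lambda>s. Q s * mat_adjoint (Q s))"
  unfolding expect_def using assms
  by (intro mult_nonneg_nonneg sum_nonneg mtrace_psd_square[where d = "2 ^ n"]) (auto simp: povm_def)

text \<open>\<open>Q = 1 - Y\<close> is Hermitian with \<open>Q * Q = 2 Q\<close>, so nonnegativity
  of the expectation of its square reads \<open>0 \<le> 2 * (1 - expect n M Y)\<close>.\<close>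

lemma expect_involution_le_1:
  assumes M: "povm n M" and Y: "\<And>s. s \<in> bitstrings n \<Longrightarrow> Y s \<in> carrier_mat (2 ^ n) (2 ^ n)"
    and herm: "\<And>s. s \<in> bitstrings n \<Longrightarrow> mat_adjoint (Y s) = Y s"
    and inv: "\<And>s. s \<in> bitstrings n \<Longrightarrow> Y s * Y s = 1\<^sub>m (2 ^ n)"
  shows "expect n M Y \<le> 1"
proof -
  let ?d = "2 ^ n :: nat"
  define Q where "Q s = 1\<^sub>m ?d + (- 1) \<cdot>\<^sub>m Y s" for s
  have Q: "Q s \<in> carrier_mat ?d ?d" if "s \<in> bitstrings n" for s
    using Y[OF that] by (simp add: Q_def)
  have "mat_adjoint (Q s) = Q s" if s: "s \<in> bitstrings n" for s
  proof (rule eq_matI, goal_cases)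
    case (1 i k)
    have ik: "i < ?d" "k < ?d" using 1 Y[OF s] by (auto simp: Q_def)
    have "cnj (Y s $$ (k, i)) = Y s $$ (i, k)"
      using mat_adjoint_entry[OF Y[OF s] ik] herm[OF s] by simp
    then show ?case
      using ik Y[OF s] by (simp only: mat_adjoint_entry[OF Q[OF s] ik]) (auto simp: Q_def)
  qed (use Q[OF s] in \<open>auto simp: mat_adjoint_def\<close>)
  moreover have "Q s * Q s = complex_of_real 2 \<cdot>\<^sub>m Q s" if s: "s \<in> bitstrings n" for s
  proof -
    note Ys = Y[OF s]
    have Qs: "Q s \<in> carrier_mat ?d ?d" using Q[OF s] .
    have "Q s * Q s = 1\<^sub>m ?d * Q s + ((- 1) \<cdot>\<^sub>m Y s) * Q s"
      using Ys Qs by (subst (1) Q_def) (rule add_mult_distrib_mat[where nr = ?d and n = ?d and nc = ?d], auto)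
    also have "((- 1) \<cdot>\<^sub>m Y s) * Q s = (- 1) \<cdot>\<^sub>m (Y s * Q s)"
      using Ys Qs by (intro mult_smult_assoc_mat) auto
    also have "Y s * Q s = Y s * 1\<^sub>m ?d + Y s * ((- 1) \<cdot>\<^sub>m Y s)"
      using Ys unfolding Q_def by (intro mult_add_distrib_mat) auto
    also have "Y s * ((- 1) \<cdot>\<^sub>m Y s) = (- 1) \<cdot>\<^sub>m 1\<^sub>m ?d"
      using Ys by (simp add: mult_smult_distrib[where nr = ?d and n = ?d and nc = ?d] inv[OF s])
    finally show ?thesis
      using Ys Qs by (intro eq_matI) (auto simp: Q_def algebra_simps)
  qed
  ultimately have "expect n M (\<lambda>s. Q s * mat_adjoint (Q s)) = expect n M (\<lambda>s. complex_of_real 2 \<cdot>\<^sub>m Q s)"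
    by (intro expect_cong) simp
  also have "\<dots> = 2 * expect n M Q"
    using Q by (rule expect_smult[OF M])
  also have "expect n M Q = 1 + expect n M (\<lambda>s. complex_of_real (- 1) \<cdot>\<^sub>m Y s)"
    unfolding Q_def using Y M by (subst expect_add) (auto simp: expect_one)
  also have "expect n M (\<lambda>s. complex_of_real (- 1) \<cdot>\<^sub>m Y s) = - 1 * expect n M Y"
    using Y by (rule expect_smult[OF M])
  finally show ?thesis using expect_square[of n M Q, OF M Q] by simp
qed

text \<open>The cross terms in the square of \<open>c Y + s Z\<close> cancel, so this combination is
  itself a Hermitian involution. The outcome is the uncertainty relation for anticommuting
  observables: the two expectations cannot both be close to 1.\<close>

lemma expect_anticommuting:
  assumes M: "povm n M" and c: "c^2 + s^2 = (1::real)"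
    and Y: "\<And>b. b \<in> bitstrings n \<Longrightarrow> Y b \<in> carrier_mat (2 ^ n) (2 ^ n)"
    and Z: "\<And>b. b \<in> bitstrings n \<Longrightarrow> Z b \<in> carrier_mat (2 ^ n) (2 ^ n)"
    and hY: "\<And>b. b \<in> bitstrings n \<Longrightarrow> mat_adjoint (Y b) = Y b"
    and hZ: "\<And>b. b \<in> bitstrings n \<Longrightarrow> mat_adjoint (Z b) = Z b"
    and iY: "\<And>b. b \<in> bitstrings n \<Longrightarrow> Y b * Y b = 1\<^sub>m (2 ^ n)"
    and iZ: "\<And>b. b \<in> bitstrings n \<Longrightarrow> Z b * Z b = 1\<^sub>m (2 ^ n)"
    and ac: "\<And>b. b \<in> bitstrings n \<Longrightarrow> Z b * Y b = (- 1) \<cdot>\<^sub>m (Y b * Z b)"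
  shows "c * expect n M Y + s * expect n M Z \<le> 1"
proof -
  let ?d = "2 ^ n :: nat"
  define R where "R b = complex_of_real c \<cdot>\<^sub>m Y b + complex_of_real s \<cdot>\<^sub>m Z b" for b
  have "expect n M R \<le> 1"
  proof (rule expect_involution_le_1[OF M])
    fix b assume b: "b \<in> bitstrings n"
    note Yb = Y[OF b] and Zb = Z[OF b]
    show R: "R b \<in> carrier_mat ?d ?d" using Yb Zb by (simp add: R_def)
    show "mat_adjoint (R b) = R b"
    proof (rule eq_matI, goal_cases)
      case (1 i k)
      have ik: "i < ?d" "k < ?d" using 1 R by auto
      have "cnj (Y b $$ (k, i)) = Y b $$ (i, k)" "cnj (Z b $$ (k, i)) = Z b $$ (i, k)"
        using mat_adjoint_entry[OF Yb ik] hY[OF b] mat_adjoint_entry[OF Zb ik] hZ[OF b] by simp_all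
      then show ?case
        using ik Yb Zb by (simp only: mat_adjoint_entry[OF R ik]) (simp add: R_def)
    qed (use R in \<open>auto simp: mat_adjoint_def\<close>)
    have YZ: "Y b * Z b \<in> carrier_mat ?d ?d" using Yb Zb by simp
    have "R b * R b = complex_of_real c \<cdot>\<^sub>m Y b * R b + complex_of_real s \<cdot>\<^sub>m Z b * R b"
      using Yb Zb R by (subst (1) R_def) (rule add_mult_distrib_mat[where nr = ?d and n = ?d and nc = ?d], auto)
    also have "complex_of_real c \<cdot>\<^sub>m Y b * R b = complex_of_real c \<cdot>\<^sub>m (Y b * R b)"
      using Yb R by (intro mult_smult_assoc_mat) auto
    also have "complex_of_real s \<cdot>\<^sub>m Z b * R b = complex_of_real s \<cdot>\<^sub>m (Z b * R b)"
      using Zb R by (intro mult_smult_assoc_mat) auto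
    also have "Y b * R b = Y b * (complex_of_real c \<cdot>\<^sub>m Y b) + Y b * (complex_of_real s \<cdot>\<^sub>m Z b)"
      using Yb Zb unfolding R_def by (intro mult_add_distrib_mat) auto
    also have "Z b * R b = Z b * (complex_of_real c \<cdot>\<^sub>m Y b) + Z b * (complex_of_real s \<cdot>\<^sub>m Z b)"
      using Yb Zb unfolding R_def by (intro mult_add_distrib_mat) auto
    also have "Y b * (complex_of_real c \<cdot>\<^sub>m Y b) = complex_of_real c \<cdot>\<^sub>m 1\<^sub>m ?d"
      using Yb by (simp add: mult_smult_distrib[where nr = ?d and n = ?d and nc = ?d] iY[OF b])
    also have "Z b * (complex_of_real s \<cdot>\<^sub>m Z b) = complex_of_real s \<cdot>\<^sub>m 1\<^sub>m ?d"
      using Zb by (simp add: mult_smult_distrib[where nr = ?d and n = ?d and nc = ?d] iZ[OF b])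
    also have "Y b * (complex_of_real s \<cdot>\<^sub>m Z b) = complex_of_real s \<cdot>\<^sub>m (Y b * Z b)"
      using Yb Zb by (intro mult_smult_distrib) auto
    also have "Z b * (complex_of_real c \<cdot>\<^sub>m Y b) = complex_of_real c \<cdot>\<^sub>m ((- 1) \<cdot>\<^sub>m (Y b * Z b))"
      using Yb Zb by (subst ac[OF b, symmetric], intro mult_smult_distrib) auto
    finally have e: "R b * R b = complex_of_real c \<cdot>\<^sub>m (complex_of_real c \<cdot>\<^sub>m 1\<^sub>m ?d + complex_of_real s \<cdot>\<^sub>m (Y b * Z b))
        + complex_of_real s \<cdot>\<^sub>m (complex_of_real c \<cdot>\<^sub>m ((- 1) \<cdot>\<^sub>m (Y b * Z b)) + complex_of_real s \<cdot>\<^sub>m 1\<^sub>m ?d)" .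
    have c': "complex_of_real c * complex_of_real c + complex_of_real s * complex_of_real s = 1"
      using c unfolding of_real_mult[symmetric] of_real_add[symmetric] by (simp add: power2_eq_square)
    have "complex_of_real c \<cdot>\<^sub>m (complex_of_real c \<cdot>\<^sub>m 1\<^sub>m ?d + complex_of_real s \<cdot>\<^sub>m P)
        + complex_of_real s \<cdot>\<^sub>m (complex_of_real c \<cdot>\<^sub>m ((- 1) \<cdot>\<^sub>m P) + complex_of_real s \<cdot>\<^sub>m 1\<^sub>m ?d)
        = 1\<^sub>m ?d" if "P \<in> carrier_mat ?d ?d" for P
      proof (rule eq_matI, goal_cases)
      case (1 i k)
      have "complex_of_real c * (complex_of_real c * x + complex_of_real s * y)
          + complex_of_real s * (complex_of_real c * (- 1 * y) + complex_of_real s * x) = x" for x y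
        using arg_cong[OF c', of "\<lambda>t. t * x"] by (simp add: algebra_simps)
      from this[of "1\<^sub>m ?d $$ (i, k)" "P $$ (i, k)"] show ?case
        using 1 that by simp
    qed (use that in auto)
    then show "R b * R b = 1\<^sub>m ?d"
      unfolding e using YZ .
  qed
  moreover have "expect n M R = c * expect n M Y + s * expect n M Z"
    unfolding R_def using Y Z by (subst expect_add[OF M]) (auto simp: expect_smult[OF M Y] expect_smult[OF M Z])
  ultimately show ?thesis by simp
qed

section \<open>Tensor products\<close>

lemma digit_Suc:
  "j \<le> n \<Longrightarrow> digit (Suc n) i j = digit n (i div 2) j" "digit (Suc n) i (Suc n) = i mod 2"
  by (simp_all add: digit_def Suc_diff_le div_mult2_eq)

lemma sum_digits: "i < 2 ^ n \<Longrightarrow> (\<Sum>j\<in>{1..n}. digit n i j * 2 ^ (n - j)) = i"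
proof (induction n arbitrary: i)
  case (Suc n)
  have "(\<Sum>j\<in>{1..n}. digit (Suc n) i j * 2 ^ (Suc n - j)) = 2 * (\<Sum>j\<in>{1..n}. digit n (i div 2) j * 2 ^ (n - j))"
    unfolding sum_distrib_left by (intro sum.cong) (auto simp: digit_Suc Suc_diff_le)
  also have "\<dots> = 2 * (i div 2)" using Suc by simp
  finally show ?case by (simp add: digit_Suc)
qed simp

lemma sum_binary:
  assumes "\<And>j. j \<in> {1..n} \<Longrightarrow> b j < 2"
  shows "(\<Sum>j\<in>{1..n}. b j * 2 ^ (n - j)) < 2 ^ n \<and>
    (\<forall>j\<in>{1..n}. digit n (\<Sum>j\<in>{1..n}. b j * 2 ^ (n - j)) j = b j)"
  using assms
proof (induction n)
  case (Suc n)
  let ?S = "\<lambda>n. \<Sum>j\<in>{1..n}. b j * 2 ^ (n - j)"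
  have IH: "?S n < 2 ^ n" "\<And>j. j \<in> {1..n} \<Longrightarrow> digit n (?S n) j = b j"
    using Suc by auto
  have b: "b (Suc n) < 2" using Suc.prems by simp
  have "(\<Sum>j\<in>{1..n}. b j * 2 ^ (Suc n - j)) = 2 * ?S n"
    unfolding sum_distrib_left by (intro sum.cong) (auto simp: Suc_diff_le)
  then have S: "?S (Suc n) = 2 * ?S n + b (Suc n)" by simp
  have d: "?S (Suc n) div 2 = ?S n" "?S (Suc n) mod 2 = b (Suc n)"
    unfolding S using b by (simp_all)
  have "?S (Suc n) < 2 ^ Suc n" unfolding S using b IH(1) by simp
  moreover have "digit (Suc n) (?S (Suc n)) j = b j" if "j \<in> {1..Suc n}" for j
  proof (cases "j = Suc n")
    case True then show ?thesis using d by (simp add: digit_Suc)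
  next
    case False
    then have "j \<in> {1..n}" using that by simp
    then show ?thesis using d(1) IH(2) by (simp add: digit_Suc(1))
  qed
  ultimately show ?case by blast
qed simp

lemma digits_inject:
  assumes "i < 2 ^ n" "k < 2 ^ n" "\<And>j. j \<in> {1..n} \<Longrightarrow> digit n i j = digit n k j"
  shows "i = k"
proof -
  have "(\<Sum>j\<in>{1..n}. digit n i j * 2 ^ (n - j)) = (\<Sum>j\<in>{1..n}. digit n k j * 2 ^ (n - j))"
    using assms(3) by (intro sum.cong) auto
  then show ?thesis using sum_digits assms(1,2) by simp
qed

lemma tensor_cong:
  assumes "\<And>j. j \<in> {1..n} \<Longrightarrow> A j = B j"
  shows "tensor n A = tensor n B"
  unfolding tensor_def using assms by (intro cong_mat) auto

lemma tensor_entry: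
  assumes "i < 2 ^ n" "k < 2 ^ n"
  shows "tensor n A $$ (i, k) = (\<Prod>j\<in>{1..n}. A j $$ (digit n i j, digit n k j))"
  using assms by (simp add: tensor_def)

lemma prod_indicator:
  assumes "finite I"
  shows "(\<Prod>j\<in>I. if P j then 1 else 0 :: 'a :: comm_semiring_1) = (if \<forall>j\<in>I. P j then 1 else 0)"
  using assms by (induction I) auto

lemma tensor_one [simp]: "tensor n (\<lambda>j. 1\<^sub>m 2) = 1\<^sub>m (2 ^ n)"
proof (rule eq_matI, goal_cases)
  case (1 i k)
  then have ik: "i < 2 ^ n" "k < 2 ^ n" by auto
  have "tensor n (\<lambda>j. 1\<^sub>m 2) $$ (i, k) = (\<Prod>j\<in>{1..n}. if digit n i j = digit n k j then 1 else 0)"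
    using ik by (simp add: tensor_entry)
  also have "\<dots> = (if i = k then 1 else 0)"
    unfolding prod_indicator[OF finite_atLeastAtMost] using digits_inject[OF ik] by auto
  finally show ?case using ik by simp
qed (auto simp: tensor_def)

text \<open>By \<open>sum_prod_digit\<close> the sum over the intermediate index factorizes over its
  digits.\<close>

lemma tensor_mult:
  assumes "\<And>j. j \<in> {1..n} \<Longrightarrow> A j \<in> carrier_mat 2 2" "\<And>j. j \<in> {1..n} \<Longrightarrow> B j \<in> carrier_mat 2 2"
  shows "tensor n A * tensor n B = tensor n (\<lambda>j. A j * B j)"
proof (rule eq_matI, goal_cases)
  case (1 i k)
  then have ik: "i < 2 ^ n" "k < 2 ^ n" by (auto simp: tensor_def)
  have "(tensor n A * tensor n B) $$ (i, k)
      = (\<Sum>l<2 ^ n. \<Prod>j\<in>{1..n}. A j $$ (digit n i j, digit n l j) * B j $$ (digit n l j, digit n k j))"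
    unfolding mult_entry[OF tensor_carrier tensor_carrier ik]
    using ik by (intro sum.cong) (simp_all add: tensor_entry prod.distrib)
  also have "\<dots> = (\<Prod>j\<in>{1..n}. \<Sum>a<2. A j $$ (digit n i j, a) * B j $$ (a, digit n k j))"
    by (rule sum_prod_digit)
  also have "\<dots> = (\<Prod>j\<in>{1..n}. (A j * B j) $$ (digit n i j, digit n k j))"
    using assms by (intro prod.cong refl mult_entry[symmetric]) auto
  finally show ?case using ik by (simp add: tensor_entry)
qed (auto simp: tensor_def)

lemma tensor_adjoint:
  assumes "\<And>j. j \<in> {1..n} \<Longrightarrow> A j \<in> carrier_mat 2 2"
  shows "mat_adjoint (tensor n A) = tensor n (\<lambda>j. mat_adjoint (A j))"
proof (rule eq_matI, goal_cases)
  case (1 i k)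
  then have ik: "i < 2 ^ n" "k < 2 ^ n" by (auto simp: tensor_def)
  show ?case
    unfolding mat_adjoint_entry[OF tensor_carrier ik] tensor_entry[OF ik] tensor_entry[OF ik(2,1)]
    using assms by (simp add: mat_adjoint_entry[where d = 2])
qed (auto simp: tensor_def mat_adjoint_def)

text \<open>\<open>hs_adjoint\<close> is defined through matrix units of the whole register, whereas
  \<open>tensor_map_tensor\<close> computes on product operators; this identity connects the
  two.\<close>

lemma tensor_mat_unit:
  assumes "i < 2 ^ n" "k < 2 ^ n"
  shows "tensor n (\<lambda>j. mat_unit 2 (digit n i j) (digit n k j)) = mat_unit (2 ^ n) i k"
proof (rule eq_matI, goal_cases)
  case (1 a b)
  then have ab: "a < 2 ^ n" "b < 2 ^ n" by (auto simp: mat_unit_def)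
  have "tensor n (\<lambda>j. mat_unit 2 (digit n i j) (digit n k j)) $$ (a, b)
      = (\<Prod>j\<in>{1..n}. if digit n a j = digit n i j \<and> digit n b j = digit n k j then 1 else 0)"
    using ab by (simp add: tensor_entry mat_unit_def)
  also have "\<dots> = (if a = i \<and> b = k then 1 else 0)"
    unfolding prod_indicator[OF finite_atLeastAtMost]
    using digits_inject[OF ab(1) assms(1)] digits_inject[OF ab(2) assms(2)] by auto
  finally show ?case using ab by (simp add: mat_unit_def)
qed (auto simp: tensor_def mat_unit_def)

section \<open>Unitary channels\<close>

definition conj_by :: "complex mat \<Rightarrow> complex mat \<Rightarrow> complex mat" where
  "conj_by U X = U * X * mat_adjoint U"

lemma conj_by_carrier [simp]:
  "U \<in> carrier_mat d d \<Longrightarrow> X \<in> carrier_mat d d \<Longrightarrow> conj_by U X \<in> carrier_mat d d"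
  unfolding conj_by_def by (intro mult_carrier_mat[where n = d] mat_adjoint_carrier)

lemma conj_by_entry:
  assumes "U \<in> carrier_mat d d" "X \<in> carrier_mat d d" "i < d" "k < d"
  shows "conj_by U X $$ (i, k) = (\<Sum>a<d. \<Sum>b<d. U $$ (i, a) * X $$ (a, b) * cnj (U $$ (k, b)))"
proof -
  have "conj_by U X $$ (i, k) = (\<Sum>b<d. (\<Sum>a<d. U $$ (i, a) * X $$ (a, b)) * cnj (U $$ (k, b)))"
    unfolding conj_by_def
    using assms mult_carrier_mat[OF assms(1,2)] mat_adjoint_carrier[OF assms(1)]
    by (simp add: mult_entry[where d = d] mat_adjoint_entry[where d = d] del: index_mult_mat)
  also have "\<dots> = (\<Sum>b<d. \<Sum>a<d. U $$ (i, a) * X $$ (a, b) * cnj (U $$ (k, b)))"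
    by (simp add: sum_distrib_right)
  finally show ?thesis by (subst sum.swap)
qed

lemma linear_map_conj_by:
  assumes "U \<in> carrier_mat d d"
  shows "linear_map d (conj_by U)"
  unfolding linear_map_def
proof (intro conjI ballI allI)
  fix X Y :: "complex mat" assume X: "X \<in> carrier_mat d d" and Y: "Y \<in> carrier_mat d d"
  show "conj_by U (X + Y) = conj_by U X + conj_by U Y"
  proof (rule eq_matI, goal_cases)
    case (1 i k)
    then have ik: "i < d" "k < d" using conj_by_carrier[OF assms Y] by auto
    show ?case
      using ik X Y assms by (simp add: add_entry[where d = d] conj_by_entry[where d = d] distrib_left distrib_right sum.distrib del: index_add_mat)
  qed (use conj_by_carrier[OF assms X] conj_by_carrier[OF assms Y] conj_by_carrier[OF assms add_carrier_mat[OF Y, of X]] in auto)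
next
  fix c and X :: "complex mat" assume X: "X \<in> carrier_mat d d"
  show "conj_by U (c \<cdot>\<^sub>m X) = c \<cdot>\<^sub>m conj_by U X"
  proof (rule eq_matI, goal_cases)
    case (1 i k)
    then have ik: "i < d" "k < d" using conj_by_carrier[OF assms X] by auto
    show ?case
      using ik X assms by (simp add: smult_entry[where d = d] conj_by_entry[where d = d] sum_distrib_left mult_ac del: index_smult_mat)
  qed (use conj_by_carrier[OF assms X] conj_by_carrier[OF assms smult_carrier_mat[OF X, of c]] in auto)
qed (use assms in simp)

lemma sum_nat_product:
  fixes f :: "nat \<Rightarrow> 'a :: comm_monoid_add"
  shows "(\<Sum>l<m * d. f l) = (\<Sum>p<m. \<Sum>a<d. f (p * d + a))"
proof (induction m)
  case (Suc m)
  have "(\<Sum>l<m * d + e. f l) = (\<Sum>l<m * d. f l) + (\<Sum>a<e. f (m * d + a))" for e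
    by (induction e) (simp_all add: add.assoc)
  from this[of d] show ?case using Suc by (simp add: add.commute)
qed simp

text \<open>In the block convention of \<open>ampliation\<close>, the map
  \<open>id \<otimes> conj_by U\<close> is conjugation by \<open>1 \<otimes> U\<close>, so
  \<open>psd_cong_mult\<close> applies.\<close>

lemma completely_positive_conj_by:
  assumes U: "U \<in> carrier_mat d d"
  shows "completely_positive d (conj_by U)"
  unfolding completely_positive_def
proof (intro allI impI)
  fix m X assume X: "psd (m * d) X"
  let ?D = "m * d"
  have Xc: "X \<in> carrier_mat ?D ?D" using X by (simp add: psd_def)
  \<comment> \<open>\<open>K\<close> is \<open>1 \<otimes> U\<close>, the block-diagonal matrix with
    \<open>m\<close> copies of \<open>U\<close>.\<close>
  define K where "K = mat ?D ?D (\<lambda>(i, k). if i div d = k div d then U $$ (i mod d, k mod d) else 0)"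
  have K: "K \<in> carrier_mat ?D ?D" by (simp add: K_def)
  have "ampliation m d (conj_by U) X = conj_by K X"
  proof (rule eq_matI, goal_cases)
    case (1 i k)
    then have ik: "i < ?D" "k < ?D" using conj_by_carrier[OF K Xc] by auto
    then have d: "0 < d" by (cases d) auto
    have dm: "i mod d < d" "k mod d < d" using d by auto
    have id: "i div d < m" "k div d < m" using ik by (simp_all add: less_mult_imp_div_less)
    have bc: "block d X p q \<in> carrier_mat d d" for p q by (simp add: block_def)
    have Kx: "K $$ (r, p * d + a) = (if r div d = p then U $$ (r mod d, a) else 0)"
      if "r < ?D" "p < m" "a < d" for r p a
    proof -
      have "p * d + a < ?D"
      proof -
        have "p * d + a < Suc p * d" using that by simp
        also have "\<dots> \<le> ?D" using that by (intro mult_le_mono1) simp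
        finally show ?thesis .
      qed
      then show ?thesis using that by (simp add: K_def)
    qed
    have "conj_by K X $$ (i, k) = (\<Sum>p<m. \<Sum>a<d. \<Sum>q<m. \<Sum>b<d.
        K $$ (i, p * d + a) * X $$ (p * d + a, q * d + b) * cnj (K $$ (k, q * d + b)))"
      unfolding conj_by_entry[OF K Xc ik] sum_nat_product ..
    also have "\<dots> = (\<Sum>p<m. \<Sum>a<d. \<Sum>q<m. \<Sum>b<d. if p = i div d \<and> q = k div d then
        U $$ (i mod d, a) * X $$ (p * d + a, q * d + b) * cnj (U $$ (k mod d, b)) else 0)"
      by (intro sum.cong refl) (simp add: Kx ik)
    also have "\<dots> = (\<Sum>p<m. if p = i div d then (\<Sum>a<d. \<Sum>q<m. if q = k div d then (\<Sum>b<d.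
        U $$ (i mod d, a) * X $$ (p * d + a, q * d + b) * cnj (U $$ (k mod d, b))) else 0) else 0)"
      by (intro sum.cong refl) (simp add: if_distrib sum.If_cases)
    also have "\<dots> = (\<Sum>a<d. \<Sum>b<d. U $$ (i mod d, a) * X $$ (i div d * d + a, k div d * d + b) * cnj (U $$ (k mod d, b)))"
      using id by (simp add: sum.delta)
    also have "\<dots> = conj_by U (block d X (i div d) (k div d)) $$ (i mod d, k mod d)"
      unfolding conj_by_entry[OF U bc dm] by (intro sum.cong) (auto simp: block_def)
    finally show ?case using ik by (simp add: ampliation_def)
  qed (use conj_by_carrier[OF K Xc] in \<open>auto simp: ampliation_def\<close>)
  then show "psd ?D (ampliation m d (conj_by U) X)"
    using psd_cong_mult[OF X K] by (simp add: conj_by_def)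
qed

lemma channel_conj_by:
  assumes U: "U \<in> carrier_mat d d" and uni: "mat_adjoint U * U = 1\<^sub>m d"
  shows "channel d (conj_by U)"
proof -
  have "mtrace (conj_by U X) = mtrace X" if X: "X \<in> carrier_mat d d" for X
  proof -
    have "mtrace (conj_by U X) = mtrace (mat_adjoint U * (U * X))"
      unfolding conj_by_def using U X by (intro mtrace_mult_comm[where d = d]) auto
    also have "mat_adjoint U * (U * X) = X"
      using U X uni by (simp add: assoc_mult_mat[of _ d d _ d _ d, symmetric])
    finally show ?thesis .
  qed
  then show ?thesis
    unfolding channel_def using linear_map_conj_by completely_positive_conj_by U by blast
qed

lemma mtrace_conj_by:
  assumes "U \<in> carrier_mat d d" "A \<in> carrier_mat d d" "B \<in> carrier_mat d d"
  shows "mtrace (conj_by U A * B) = mtrace (A * conj_by (mat_adjoint U) B)"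
proof -
  have U': "mat_adjoint U \<in> carrier_mat d d" using assms by simp
  have "mtrace (conj_by U A * B) = mtrace (U * (A * mat_adjoint U * B))"
    unfolding conj_by_def using assms U' by (simp add: assoc_mult_mat[of _ d d _ d _ d])
  also have "\<dots> = mtrace (A * mat_adjoint U * B * U)"
    using assms U' by (intro mtrace_mult_comm[where d = d]) auto
  also have "\<dots> = mtrace (A * conj_by (mat_adjoint U) B)"
    unfolding conj_by_def mat_adjoint_adjoint[OF assms(1)] using assms U'
    by (simp add: assoc_mult_mat[of _ d d _ d _ d] mult_carrier_mat[of _ d d])
  finally show ?thesis .
qed

lemma conj_by_tensor:
  assumes U: "\<And>j. j \<in> {1..n} \<Longrightarrow> U j \<in> carrier_mat 2 2" and A: "\<And>j. j \<in> {1..n} \<Longrightarrow> A j \<in> carrier_mat 2 2"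
  shows "conj_by (tensor n U) (tensor n A) = tensor n (\<lambda>j. conj_by (U j) (A j))"
proof -
  have "tensor n (\<lambda>j. U j * A j) * tensor n (\<lambda>j. mat_adjoint (U j)) = tensor n (\<lambda>j. U j * A j * mat_adjoint (U j))"
    using U A by (intro tensor_mult mult_carrier_mat[where n = 2] mat_adjoint_carrier)
  then show ?thesis
    unfolding conj_by_def using tensor_mult[OF U A] tensor_adjoint[OF U] by simp
qed

text \<open>Entry \<open>(i, k)\<close> of \<open>hs_adjoint\<close> is a trace against the image of
  a matrix unit, and \<open>mtrace_conj_by\<close> moves the conjugation over to the other
  factor.\<close>

lemma hs_adjoint_tensor_conj_by:
  assumes U: "\<And>j. j \<in> {1..n} \<Longrightarrow> U j \<in> carrier_mat 2 2" and Y: "Y \<in> carrier_mat (2 ^ n) (2 ^ n)"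
  shows "hs_adjoint (2 ^ n) (tensor_map n (\<lambda>j. conj_by (U j))) Y = conj_by (mat_adjoint (tensor n U)) Y"
    (is "hs_adjoint ?d ?L Y = conj_by (mat_adjoint ?T) Y")
proof (rule eq_matI, goal_cases)
  case (1 i k)
  have T: "?T \<in> carrier_mat ?d ?d" and T': "mat_adjoint ?T \<in> carrier_mat ?d ?d" by simp_all
  have Z: "conj_by (mat_adjoint ?T) Y \<in> carrier_mat ?d ?d" using T' Y by simp
  have ik: "i < ?d" "k < ?d" using 1 Z by auto
  let ?E = "mat_unit ?d i k"
  have E: "?E \<in> carrier_mat ?d ?d" and E': "mat_adjoint ?E \<in> carrier_mat ?d ?d" by simp_all
  have "?L ?E = ?L (tensor n (\<lambda>j. mat_unit 2 (digit n i j) (digit n k j)))"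
    using tensor_mat_unit[OF ik] by simp
  also have "\<dots> = tensor n (\<lambda>j. conj_by (U j) (mat_unit 2 (digit n i j) (digit n k j)))"
    using U by (intro tensor_map_tensor linear_map_conj_by) auto
  also have "\<dots> = conj_by ?T (tensor n (\<lambda>j. mat_unit 2 (digit n i j) (digit n k j)))"
    using U by (subst conj_by_tensor) simp_all
  finally have LE: "?L ?E = conj_by ?T ?E"
    using tensor_mat_unit[OF ik] by simp
  have "mat_adjoint (conj_by ?T ?E) = conj_by ?T (mat_adjoint ?E)"
    unfolding conj_by_def using T T' E E'
    by (simp add: mat_adjoint_mult[where d = ?d] mult_carrier_mat[where n = ?d] mat_adjoint_adjoint[OF T] assoc_mult_mat[of _ ?d ?d _ ?d _ ?d])
  then have "hs_adjoint ?d ?L Y $$ (i, k) = mtrace (conj_by ?T (mat_adjoint ?E) * Y)"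
    using ik LE by (simp add: hs_adjoint_def)
  also have "\<dots> = mtrace (mat_adjoint ?E * conj_by (mat_adjoint ?T) Y)"
    using E' Y by (intro mtrace_conj_by[OF T])
  also have "\<dots> = (\<Sum>a<?d. \<Sum>b<?d. if a = i \<and> b = k then conj_by (mat_adjoint ?T) Y $$ (i, k) else 0)"
    unfolding mtrace_adjoint_mult[OF E Z] by (intro sum.cong refl) (auto simp: mat_unit_def)
  also have "\<dots> = (\<Sum>a<?d. if a = i then conj_by (mat_adjoint ?T) Y $$ (i, k) else 0)"
    using ik by (intro sum.cong) auto
  also have "\<dots> = conj_by (mat_adjoint ?T) Y $$ (i, k)" using ik by simp
  finally show ?case .
qed (use Y in \<open>simp_all add: hs_adjoint_def conj_by_def mat_adjoint_def tensor_def\<close>)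

lemma ghz_dim [simp]: "dim_vec (ghz n s) = 2 ^ n"
  by (simp add: ghz_def ket_def)

lemma projector_carrier: "dim_vec v = d \<Longrightarrow> projector v \<in> carrier_mat d d"
  by (simp add: projector_def)

text \<open>Instead of rotating the target projectors backwards, the rotation is applied to the
  measurement. The fidelities of all product rotations thus become expectations of the same fixed
  GHZ projectors.\<close>

lemma fidelity_at_conj_by:
  assumes M: "povm n M" and U: "\<And>j. j \<in> {1..n} \<Longrightarrow> U j \<in> carrier_mat 2 2"
  shows "fidelity_at n M (\<lambda>j. conj_by (U j)) = expect n (\<lambda>s. conj_by (tensor n U) (M s)) (\<lambda>s. projector (ghz n s))"
proof -
  let ?d = "2 ^ n :: nat"
  have P: "projector (ghz n s) \<in> carrier_mat ?d ?d" for s by (simp add: projector_carrier)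
  have "hs_adjoint ?d (tensor_map n (\<lambda>j. conj_by (U j))) (projector (ghz n s))
      = conj_by (mat_adjoint (tensor n U)) (projector (ghz n s))" for s
    using U P by (rule hs_adjoint_tensor_conj_by)
  then show ?thesis
    unfolding fidelity_at_def expect_def
    by (simp add: mtrace_conj_by[OF tensor_carrier povmD(2)[OF M] P])
qed

lemma povm_conj_by:
  assumes M: "povm n M" and T: "T \<in> carrier_mat (2 ^ n) (2 ^ n)" and u: "T * mat_adjoint T = 1\<^sub>m (2 ^ n)"
  shows "povm n (\<lambda>s. conj_by T (M s))"
proof -
  let ?d = "2 ^ n :: nat"
  have fin: "finite (bitstrings n)" by (auto simp: bitstrings_def intro!: finite_PiE)
  have "msum ?d (\<lambda>s. conj_by T (M s)) (bitstrings n) = conj_by T (msum ?d M (bitstrings n))"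
    using linear_map_msum[OF linear_map_conj_by[OF T] fin povmD(2)[OF M]] by simp
  also have "\<dots> = 1\<^sub>m ?d"
    using M T u by (simp add: povm_def conj_by_def)
  finally show ?thesis
    using psd_cong_mult[OF _ T] povmD[OF M] by (simp add: povm_def conj_by_def)
qed

section \<open>Bloch vectors\<close>

type_synonym bloch = "real \<times> real \<times> real"

text \<open>This is \<open>x X + y Y + z Z\<close> for the Pauli matrices. Nested pairs serve as
  Bloch vectors since their norm and inner product are the Euclidean ones.\<close>

fun sig :: "bloch \<Rightarrow> complex mat" where
  "sig (x, y, z) = mat 2 2 (\<lambda>(i, k). if i = k then (if i = 0 then of_real z else - of_real z)
     else if i = 0 then Complex x (- y) else Complex x y)"

lemma mat2_eqI:
  assumes "A \<in> carrier_mat 2 2" "B \<in> carrier_mat 2 2"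
    "A $$ (0, 0) = B $$ (0, 0)" "A $$ (0, Suc 0) = B $$ (0, Suc 0)" "A $$ (Suc 0, 0) = B $$ (Suc 0, 0)"
    "A $$ (Suc 0, Suc 0) = B $$ (Suc 0, Suc 0)"
  shows "A = B"
proof (rule eq_matI)
  fix i k assume "i < dim_row B" "k < dim_col B"
  then have "i = 0 \<or> i = 1" "k = 0 \<or> k = 1" using assms(2) by auto
  then show "A $$ (i, k) = B $$ (i, k)" using assms(3-) by auto
qed (use assms in auto)

lemma mult_entry_2:
  assumes "A \<in> carrier_mat 2 2" "B \<in> carrier_mat 2 2" "i < 2" "k < 2"
  shows "(A * B) $$ (i, k) = A $$ (i, 0) * B $$ (0, k) + A $$ (i, Suc 0) * B $$ (Suc 0, k)"
  using mult_entry[OF assms] by (simp add: numeral_2_eq_2)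

lemma sig_carrier [simp]: "sig v \<in> carrier_mat 2 2"
  by (cases v rule: sig.cases) simp

lemma sig_dim: "dim_row (sig v) = 2" "dim_col (sig v) = 2"
  by (simp_all only: carrier_matD[OF sig_carrier])

lemma sig_linear: "sig (a *\<^sub>R u + b *\<^sub>R v) = complex_of_real a \<cdot>\<^sub>m sig u + complex_of_real b \<cdot>\<^sub>m sig v"
  by (cases u rule: sig.cases; cases v rule: sig.cases)
    (auto intro!: mat2_eqI simp: complex_eq_iff)

lemma sig_scale: "sig (a *\<^sub>R u) = complex_of_real a \<cdot>\<^sub>m sig u"
  by (cases u rule: sig.cases) (auto intro!: mat2_eqI simp: complex_eq_iff)

lemma sig_entry:
  "sig (x, y, z) $$ (0, 0) = of_real z" "sig (x, y, z) $$ (0, Suc 0) = Complex x (- y)"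
  "sig (x, y, z) $$ (Suc 0, 0) = Complex x y" "sig (x, y, z) $$ (Suc 0, Suc 0) = - of_real z"
  by simp_all

declare sig.simps [simp del]

lemma mat_adjoint_sig: "mat_adjoint (sig v) = sig v"
proof -
  obtain x y z where v: "v = (x, y, z)" by (cases v rule: sig.cases)
  show ?thesis
    by (rule mat2_eqI) (simp_all add: mat_adjoint_entry[OF sig_carrier] v sig_entry complex_eq_iff)
qed

lemma sig_square:
  assumes "norm v = 1"
  shows "sig v * sig v = 1\<^sub>m 2"
proof -
  obtain x y z where v: "v = (x, y, z)" by (cases v rule: sig.cases)
  have n: "x * x + (y * y + z * z) = 1" using assms v by (simp add: norm_eq_1)
  show ?thesis
    by (rule mat2_eqI)
      (use n in \<open>simp_all add: mult_carrier_mat[where n = 2] mult_entry_2[OF sig_carrier sig_carrier] v sig_entry complex_eq_iff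
        algebra_simps del: index_mult_mat\<close>)
qed

lemma sig_anticommute:
  assumes "inner u v = 0"
  shows "sig u * sig v = (- 1) \<cdot>\<^sub>m (sig v * sig u)"
proof -
  obtain x y z where u: "u = (x, y, z)" by (cases u rule: sig.cases)
  obtain a b c where v: "v = (a, b, c)" by (cases v rule: sig.cases)
  have n: "x * a + (y * b + z * c) = 0" using assms u v by simp
  have c: "sig v * sig u \<in> carrier_mat 2 2" "sig u * sig v \<in> carrier_mat 2 2"
    by (intro mult_carrier_mat[where n = 2] sig_carrier)+
  show ?thesis
    by (rule mat2_eqI)
      (use n c[unfolded u v] in \<open>simp_all add: smult_entry[OF c(1)[unfolded u v]] mult_entry_2[OF sig_carrier sig_carrier] u v sig_entry complex_eq_iff
        algebra_simps del: index_mult_mat index_smult_mat(1)\<close>)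
qed

abbreviation "PX \<equiv> sig (1, 0, 0)"
abbreviation "PZ \<equiv> sig (0, 0, 1)"

text \<open>\<open>(1 + sig z) / 2\<close> is the projector onto the spin state pointing along
  \<open>z\<close>, and \<open>v\<close> is a unit vector spanning its range.\<close>

lemma half_plus_sig_rank_one:
  assumes "norm z = 1"
  shows "\<exists>v :: nat \<Rightarrow> complex. \<forall>i<2. \<forall>k<2. v i * cnj (v k) = ((if i = k then 1 else 0) + sig z $$ (i, k)) / 2"
proof -
  obtain a b c where z: "z = (a, b, c)" by (cases z rule: sig.cases)
  have n: "a^2 + b^2 + c^2 = 1"
    using assms z by (simp add: norm_eq_1 power2_eq_square)
  show ?thesis
  \<comment> \<open>At the south pole the first component of \<open>v\<close> vanishes, so the
    formula of the other case, which makes that component real and positive and divides by it,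
    breaks down.\<close>
  proof (cases "c = -1")
    case True
    then have "a = 0" "b = 0" using n sum_power2_eq_zero_iff[of a b] by auto
    with True show ?thesis
      by (intro exI[of _ "\<lambda>i. if i = 0 then 0 else 1"]) (auto simp: z less_2_cases_iff sig_entry complex_eq_iff)
  next
    case False
    have "c^2 \<le> 1" using n by (smt (verit) zero_le_power2)
    then have c: "1 + c > 0" using False abs_square_le_1[of c] by auto
    define r where "r = sqrt ((1 + c) / 2)"
    have r: "r > 0" "r^2 = (1 + c) / 2" using c by (simp_all add: r_def)
    define v where "v i = (if i = 0 then of_real r else Complex a b / of_real (2 * r))" for i :: nat
    have "v 0 * cnj (v 0) = (1 + of_real c) / 2"
      using r(2) by (simp add: v_def power2_eq_square complex_eq_iff)
    moreover have "v 0 * cnj (v (Suc 0)) = Complex a (- b) / 2" "v (Suc 0) * cnj (v 0) = Complex a b / 2"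
      using r(1) by (simp_all add: v_def complex_eq_iff Complex_divide power2_eq_square field_simps)
    moreover have "v (Suc 0) * cnj (v (Suc 0)) = (1 - of_real c) / 2"
    proof -
      have ab: "a^2 + b^2 = (1 - c) * (1 + c)" using n by (simp add: power2_eq_square algebra_simps)
      have "v (Suc 0) * cnj (v (Suc 0)) = of_real ((a^2 + b^2) / (2 * r)^2)"
        by (simp add: v_def complex_mult_cnj power2_eq_square)
      also have "(a^2 + b^2) / (2 * r)^2 = (1 - c) / 2"
        using c unfolding ab by (simp add: power_mult_distrib r(2) field_simps)
      finally show ?thesis by simp
    qed
    ultimately show ?thesis
      by (intro exI[of _ v]) (auto simp: z sig_entry less_2_cases_iff)
  qed
qed

text \<open>Lifts a rotation of the Bloch sphere to a unitary without angles: the rows of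
  \<open>U\<close> are the conjugates of eigenvectors \<open>v\<close>, \<open>w\<close> of
  \<open>sig z\<close>, so \<open>U\<close> takes these to the computational basis. Two axes are
  prescribed; the third follows from the product of their operators.\<close>

lemma frame_unitary:
  assumes x: "norm x = 1" and z: "norm z = 1" and xz: "inner x z = 0"
  shows "\<exists>U\<in>carrier_mat 2 2. U * mat_adjoint U = 1\<^sub>m 2 \<and> mat_adjoint U * U = 1\<^sub>m 2 \<and>
    conj_by (mat_adjoint U) PX = sig x \<and> conj_by (mat_adjoint U) PZ = sig z"
proof -
  obtain v :: "nat \<Rightarrow> complex" where
    v: "\<And>i k. i < 2 \<Longrightarrow> k < 2 \<Longrightarrow> v i * cnj (v k) = ((if i = k then 1 else 0) + sig z $$ (i, k)) / 2"
    using half_plus_sig_rank_one[OF z] by blast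
  \<comment> \<open>Since \<open>sig x\<close> anticommutes with \<open>sig z\<close>, it maps
    \<open>v\<close> to an eigenvector for the other eigenvalue. Defining \<open>w\<close> this way
    also fixes the relative phase, without which \<open>PX\<close> could go to another direction
    orthogonal to \<open>z\<close>.\<close>
  define w where "w i = sig x $$ (i, 0) * v 0 + sig x $$ (i, Suc 0) * v (Suc 0)" for i
  define U where "U = mat 2 2 (\<lambda>(i, k). if i = 0 then cnj (v k) else cnj (w k))"
  have U: "U \<in> carrier_mat 2 2" and U': "mat_adjoint U \<in> carrier_mat 2 2"
    by (simp_all add: U_def)
  have one_lt: "Suc 0 < 2" by simp
  let ?S = "sig x" and ?Z = "sig z"
  have SZ: "?S * ?Z \<in> carrier_mat 2 2" by (rule mult_carrier_mat[where n = 2]) simp_all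
  have herm: "cnj (?S $$ (k, i)) = ?S $$ (i, k)" if "i < 2" "k < 2" for i k
    using mat_adjoint_entry[OF sig_carrier that, of x] mat_adjoint_sig[of x] by simp
  \<comment> \<open>With \<open>P = (1 + ?Z) / 2\<close>, the three dyads computed here and below
    are \<open>?S * P\<close>, \<open>P * ?S\<close> and \<open>?S * P * ?S\<close>; anticommutation
    and \<open>?S * ?S = 1\<close> simplify them.\<close>
  have wv: "w i * cnj (v k) = (?S $$ (i, k) + (?S * ?Z) $$ (i, k)) / 2" if "i < 2" "k < 2" for i k
  proof -
    have "w i * cnj (v k) = ?S $$ (i, 0) * (v 0 * cnj (v k)) + ?S $$ (i, Suc 0) * (v (Suc 0) * cnj (v k))"
      by (simp add: w_def algebra_simps)
    also have "\<dots> = (?S $$ (i, k) + (?S * ?Z) $$ (i, k)) / 2"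
      unfolding mult_entry_2[OF sig_carrier sig_carrier that] v[of 0 k, OF pos2 that(2)]
        v[of "Suc 0" k, OF one_lt that(2)]
      using that by (auto simp: less_2_cases_iff algebra_simps add_divide_distrib)
    finally show ?thesis .
  qed
  have vw: "v i * cnj (w k) = (?S $$ (i, k) - (?S * ?Z) $$ (i, k)) / 2" if "i < 2" "k < 2" for i k
  proof -
    have "v i * cnj (w k) = cnj (w k * cnj (v i))" by simp
    also have "\<dots> = (cnj (?S $$ (k, i)) + cnj ((?S * ?Z) $$ (k, i))) / 2"
      by (simp only: wv[OF that(2,1)]) simp
    also have "cnj ((?S * ?Z) $$ (k, i)) = mat_adjoint (?S * ?Z) $$ (i, k)"
      by (rule mat_adjoint_entry[OF SZ that, symmetric])
    also have "mat_adjoint (?S * ?Z) = ?Z * ?S"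
      by (simp add: mat_adjoint_mult[OF sig_carrier sig_carrier] mat_adjoint_sig)
    also have "?Z * ?S = (- 1) \<cdot>\<^sub>m (?S * ?Z)"
      using xz by (intro sig_anticommute) (simp add: inner_commute)
    finally show ?thesis
      using that herm[OF that] by (simp add: smult_entry[OF SZ] del: index_mult_mat index_smult_mat)
  qed
  have ww: "w i * cnj (w k) = ((if i = k then 1 else 0) - ?Z $$ (i, k)) / 2" if "i < 2" "k < 2" for i k
  proof -
    have "w i * cnj (w k) = ?S $$ (i, 0) * (v 0 * cnj (w k)) + ?S $$ (i, Suc 0) * (v (Suc 0) * cnj (w k))"
      by (simp add: w_def algebra_simps)
    also have "\<dots> = ((?S * ?S) $$ (i, k) - (?S * (?S * ?Z)) $$ (i, k)) / 2"
      unfolding mult_entry_2[OF sig_carrier sig_carrier that] mult_entry_2[OF sig_carrier SZ that]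
        vw[of 0 k, OF pos2 that(2)] vw[of "Suc 0" k, OF one_lt that(2)]
      by (simp add: algebra_simps add_divide_distrib diff_divide_distrib del: index_mult_mat)
    also have "?S * (?S * ?Z) = ?Z"
      using sig_square[OF x] left_mult_one_mat[OF sig_carrier]
      by (simp add: assoc_mult_mat[of _ 2 2 _ 2 _ 2, symmetric])
    finally show ?thesis using that sig_square[OF x] by simp
  qed
  have conj: "conj_by (mat_adjoint U) P $$ (i, k)
     = v i * P $$ (0, 0) * cnj (v k) + v i * P $$ (0, Suc 0) * cnj (w k) + w i * P $$ (Suc 0, 0) * cnj (v k) + w i * P $$ (Suc 0, Suc 0) * cnj (w k)"
    if "P \<in> carrier_mat 2 2" "i < 2" "k < 2" for P i k
    using that unfolding conj_by_entry[OF U' that]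
    by (simp add: numeral_2_eq_2 mat_adjoint_entry[OF U] del: One_nat_def) (simp add: U_def algebra_simps)
  have id: "conj_by (mat_adjoint U) (1\<^sub>m 2) = mat_adjoint U * U"
    using U' mat_adjoint_adjoint[OF U] by (simp add: conj_by_def)
  have conj_eq: "conj_by (mat_adjoint U) P = Q"
    if P: "P \<in> carrier_mat 2 2" and Q: "Q \<in> carrier_mat 2 2" and
     "\<And>i k. i < 2 \<Longrightarrow> k < 2 \<Longrightarrow> v i * P $$ (0, 0) * cnj (v k) + v i * P $$ (0, Suc 0) * cnj (w k)
       + w i * P $$ (Suc 0, 0) * cnj (v k) + w i * P $$ (Suc 0, Suc 0) * cnj (w k) = Q $$ (i, k)"
    for P Q
    using that by (intro mat2_eqI) (simp_all add: conj_by_carrier[OF U'] conj del: One_nat_def)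
  have A: "conj_by (mat_adjoint U) (1\<^sub>m 2) = 1\<^sub>m 2"
    by (rule conj_eq) (simp_all add: v ww add_divide_distrib diff_divide_distrib)
  have B: "conj_by (mat_adjoint U) PX = sig x"
    by (rule conj_eq) (simp_all add: vw wv sig_entry Complex_eq add_divide_distrib diff_divide_distrib del: index_mult_mat)
  have C: "conj_by (mat_adjoint U) PZ = sig z"
    by (rule conj_eq) (simp_all add: v ww sig_entry Complex_eq add_divide_distrib diff_divide_distrib)
  have "U * mat_adjoint U = 1\<^sub>m 2"
    using mat_mult_left_right_inverse[OF U' U] A[unfolded id] by simp
  then show ?thesis using A[unfolded id] B C by (intro bexI[OF _ U]) simp
qed

section \<open>Signed correlators\<close>

text \<open>\<open>\<tau>\<close> gives the exponent of the sign that the outcome attaches to the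
  product observable. With \<open>\<tau> s = s 1\<close> for
  \<open>X \<otimes> \<dots> \<otimes> X\<close> and \<open>\<tau> s = s j\<close> for
  \<open>Z_1 Z_j\<close>, the ideal measurement has correlator 1.\<close>

definition corr :: "nat \<Rightarrow> ((nat \<Rightarrow> nat) \<Rightarrow> complex mat) \<Rightarrow> ((nat \<Rightarrow> nat) \<Rightarrow> nat) \<Rightarrow> (nat \<Rightarrow> complex mat) \<Rightarrow> real" where
  "corr n M \<tau> V = expect n M (\<lambda>s. (- 1) ^ \<tau> s \<cdot>\<^sub>m tensor n V)"

lemma corr_cong: "(\<And>k. k \<in> {1..n} \<Longrightarrow> V k = V' k) \<Longrightarrow> corr n M \<tau> V = corr n M \<tau> V'"
  unfolding corr_def using tensor_cong[of n V V'] by simp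

lemma tensor_slot:
  assumes i: "i \<in> {1..n}" and A: "A \<in> carrier_mat 2 2" "B \<in> carrier_mat 2 2"
    and V: "V i = a \<cdot>\<^sub>m A + b \<cdot>\<^sub>m B"
  shows "tensor n V = a \<cdot>\<^sub>m tensor n (V(i := A)) + b \<cdot>\<^sub>m tensor n (V(i := B))"
proof (rule eq_matI, goal_cases)
  case (1 p q)
  then have pq: "p < 2 ^ n" "q < 2 ^ n" by (auto simp: tensor_def)
  define R where "R = (\<Prod>j\<in>{1..n} - {i}. V j $$ (digit n p j, digit n q j))"
  have "tensor n (V(i := C)) $$ (p, q) = C $$ (digit n p i, digit n q i) * R" for C
    unfolding R_def tensor_entry[OF pq] using i by (subst prod.remove[of _ i]) auto
  note slot = this this[of "V i", simplified]
  have "V i $$ (digit n p i, digit n q i) = a * A $$ (digit n p i, digit n q i) + b * B $$ (digit n p i, digit n q i)"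
    using A V by simp
  then show ?case
    using pq tensor_carrier[of n "V(i := A)"] tensor_carrier[of n "V(i := B)"]
    by (simp add: slot algebra_simps del: fun_upd_apply tensor_carrier)
qed (auto simp: tensor_def)

lemma corr_slot:
  assumes M: "povm n M" and i: "i \<in> {1..n}" and A: "A \<in> carrier_mat 2 2" "B \<in> carrier_mat 2 2"
    and V: "V i = complex_of_real a \<cdot>\<^sub>m A + complex_of_real b \<cdot>\<^sub>m B"
  shows "corr n M \<tau> V = a * corr n M \<tau> (V(i := A)) + b * corr n M \<tau> (V(i := B))"
proof -
  have "corr n M \<tau> V = expect n M (\<lambda>s. complex_of_real a \<cdot>\<^sub>m ((- 1) ^ \<tau> s \<cdot>\<^sub>m tensor n (V(i := A)))
      + complex_of_real b \<cdot>\<^sub>m ((- 1) ^ \<tau> s \<cdot>\<^sub>m tensor n (V(i := B))))"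
    unfolding corr_def tensor_slot[OF i A, of V, OF V]
    by (intro expect_cong eq_matI) (auto simp: tensor_def algebra_simps)
  then show ?thesis
    using M unfolding corr_def by (subst (asm) expect_add) (auto simp: expect_smult)
qed

lemma corr_bloch_linear:
  assumes M: "povm n M" and i: "i \<in> {1..n}"
  shows "corr n M \<tau> (V(i := sig (a *\<^sub>R u + b *\<^sub>R v))) = a * corr n M \<tau> (V(i := sig u)) + b * corr n M \<tau> (V(i := sig v))"
  using corr_slot[OF M i sig_carrier sig_carrier, of "V(i := sig (a *\<^sub>R u + b *\<^sub>R v))" a u b v]
  by (simp add: sig_linear)

lemma expect_msum:
  assumes M: "povm n M" and J: "finite J" and Y: "\<And>s j. s \<in> bitstrings n \<Longrightarrow> j \<in> J \<Longrightarrow> Y s j \<in> carrier_mat (2 ^ n) (2 ^ n)"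
  shows "expect n M (\<lambda>s. msum (2 ^ n) (Y s) J) = (\<Sum>j\<in>J. expect n M (\<lambda>s. Y s j))"
  using J Y
proof (induction J)
  case empty
  have "expect n M (\<lambda>s. msum (2 ^ n) (Y s) {}) = expect n M (\<lambda>s. complex_of_real 0 \<cdot>\<^sub>m 1\<^sub>m (2 ^ n))"
    by (intro expect_cong eq_matI) (auto simp: msum_def)
  then show ?case using expect_smult[OF M, of "\<lambda>s. 1\<^sub>m (2 ^ n)" 0] by simp
next
  case (insert j J)
  have "expect n M (\<lambda>s. msum (2 ^ n) (Y s) (insert j J)) = expect n M (\<lambda>s. Y s j + msum (2 ^ n) (Y s) J)"
  proof (intro expect_cong eq_matI)
    fix s i k assume s: "s \<in> bitstrings n" and ik: "i < dim_row (Y s j + msum (2 ^ n) (Y s) J)" "k < dim_col (Y s j + msum (2 ^ n) (Y s) J)"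
    then show "msum (2 ^ n) (Y s) (insert j J) $$ (i, k) = (Y s j + msum (2 ^ n) (Y s) J) $$ (i, k)"
      using insert.hyps insert.prems[OF s, of j] by (simp add: msum_def)
  qed (auto simp: msum_def)
  also have "\<dots> = expect n M (\<lambda>s. Y s j) + expect n M (\<lambda>s. msum (2 ^ n) (Y s) J)"
    using insert.prems by (intro expect_add[OF M]) auto
  finally show ?case using insert by simp
qed

lemma success_corr:
  assumes M: "povm n M" and n: "2 \<le> n"
  shows "(real n - 1) * 2 * sqrt 2 * success n \<rho> M =
    (real n - 1) * corr n M (\<lambda>s. s 1) (\<lambda>k. if k = 1 then obs \<rho> 1 0 + obs \<rho> 1 1 else obs \<rho> k 0)
    + (\<Sum>j\<in>{2..n}. corr n M (\<lambda>s. s j) (\<lambda>k. if k = 1 then obs \<rho> 1 0 - obs \<rho> 1 1 else if k = j then obs \<rho> j 1 else 1\<^sub>m 2))"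
proof -
  let ?A = "\<lambda>k. if k = 1 then obs \<rho> 1 0 + obs \<rho> 1 1 else obs \<rho> k 0"
  let ?B = "\<lambda>j k. if k = 1 then obs \<rho> 1 0 - obs \<rho> 1 1 else if k = j then obs \<rho> j 1 else 1\<^sub>m 2"
  have "(real n - 1) * 2 * sqrt 2 * success n \<rho> M = expect n M (W n \<rho>)"
    using n by (simp add: success_def expect_def field_simps)
  also have "W n \<rho> = (\<lambda>s. complex_of_real (real n - 1) \<cdot>\<^sub>m ((- 1) ^ s 1 \<cdot>\<^sub>m tensor n ?A)
      + msum (2 ^ n) (\<lambda>j. (- 1) ^ s j \<cdot>\<^sub>m tensor n (?B j)) {2..n})"
    using n unfolding W_def by (intro ext arg_cong2[where f = "(+)"] eq_matI) (auto simp: of_nat_diff tensor_def)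
  also have "expect n M \<dots> = expect n M (\<lambda>s. complex_of_real (real n - 1) \<cdot>\<^sub>m ((- 1) ^ s 1 \<cdot>\<^sub>m tensor n ?A))
      + expect n M (\<lambda>s. msum (2 ^ n) (\<lambda>j. (- 1) ^ s j \<cdot>\<^sub>m tensor n (?B j)) {2..n})"
    by (rule expect_add[OF M]) auto
  also have "expect n M (\<lambda>s. complex_of_real (real n - 1) \<cdot>\<^sub>m ((- 1) ^ s 1 \<cdot>\<^sub>m tensor n ?A)) = (real n - 1) * corr n M (\<lambda>s. s 1) ?A"
    unfolding corr_def by (rule expect_smult[OF M]) simp
  also have "expect n M (\<lambda>s. msum (2 ^ n) (\<lambda>j. (- 1) ^ s j \<cdot>\<^sub>m tensor n (?B j)) {2..n}) = (\<Sum>j\<in>{2..n}. corr n M (\<lambda>s. s j) (?B j))"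
    unfolding corr_def by (rule expect_msum[OF M]) auto
  finally show ?thesis .
qed

lemma corr_conj_by:
  assumes M: "povm n M" and U: "\<And>j. j \<in> {1..n} \<Longrightarrow> U j \<in> carrier_mat 2 2"
    and V: "\<And>j. j \<in> {1..n} \<Longrightarrow> V j \<in> carrier_mat 2 2"
  shows "corr n (\<lambda>s. conj_by (tensor n U) (M s)) \<tau> V = corr n M \<tau> (\<lambda>k. conj_by (mat_adjoint (U k)) (V k))"
proof -
  let ?d = "2 ^ n :: nat"
  have T: "conj_by (mat_adjoint (tensor n U)) (tensor n V) = tensor n (\<lambda>k. conj_by (mat_adjoint (U k)) (V k))"
    using U V by (subst tensor_adjoint, simp, intro conj_by_tensor) auto
  have l: "conj_by (mat_adjoint (tensor n U)) (c \<cdot>\<^sub>m tensor n V) = c \<cdot>\<^sub>m conj_by (mat_adjoint (tensor n U)) (tensor n V)" for c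
    using linear_map_conj_by[OF mat_adjoint_carrier[OF tensor_carrier]] unfolding linear_map_def by simp
  show ?thesis
    unfolding corr_def expect_def
    by (simp add: mtrace_conj_by[OF tensor_carrier povmD(2)[OF M] smult_carrier_mat[OF tensor_carrier]] l T)
qed

section \<open>Reduction to unit Bloch vectors\<close>

text \<open>Positivity tested at \<open>(1, 1)\<close> and \<open>(1, \<i>)\<close> forces the
  off-diagonal entries to be conjugate. The squared Bloch norm is the squared trace minus four times
  the determinant.\<close>

lemma density_bloch:
  assumes "density 2 A"
  shows "\<exists>r. norm r \<le> 1 \<and> A = (1 / 2) \<cdot>\<^sub>m (1\<^sub>m 2 + sig r)"
proof -
  have A: "A \<in> carrier_mat 2 2" and tr: "mtrace A = 1"
    and p: "\<And>v. v \<in> carrier_vec 2 \<Longrightarrow> 0 \<le> (A *\<^sub>v v) \<bullet>c v"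
    using assms by (auto simp: density_def psd_def)
  define a b c d where "a = A $$ (0, 0)" and "b = A $$ (0, Suc 0)" and "c = A $$ (Suc 0, 0)" and "d = A $$ (Suc 0, Suc 0)"
  have q: "0 \<le> a * x * cnj x + b * y * cnj x + c * x * cnj y + d * y * cnj y" for x y
    using p[of "vec 2 (\<lambda>i. if i = 0 then x else y)"] A
    by (simp add: quadratic_form_entry[where d = 2] numeral_2_eq_2 a_def b_def c_def d_def add.assoc)
  have ad: "a + d = 1" using tr A by (simp add: mtrace_def numeral_2_eq_2 a_def d_def)
  have a: "0 \<le> Re a" "Im a = 0" using q[of 1 0] by (auto simp: less_eq_complex_def)
  have d: "0 \<le> Re d" "Im d = 0" using q[of 0 1] by (auto simp: less_eq_complex_def)
  have c: "c = cnj b"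
    using q[of 1 1] q[of 1 \<i>] a d by (auto simp: less_eq_complex_def complex_eq_iff)
  \<comment> \<open>The vectors \<open>(d, - c)\<close> and \<open>(- b, a)\<close> are the columns
    of the adjugate, so the quadratic form there equals \<open>d\<close> and \<open>a\<close> times
    the determinant. Adding both and using trace 1 shows that the determinant is
    nonnegative.\<close>
  have "0 \<le> Re d * (Re a * Re d - (Re b)^2 - (Im b)^2)"
    using q[of d "- c"] a d unfolding c by (auto simp: less_eq_complex_def algebra_simps power2_eq_square)
  moreover have "0 \<le> Re a * (Re a * Re d - (Re b)^2 - (Im b)^2)"
    using q[of "- b" a] a d unfolding c by (auto simp: less_eq_complex_def algebra_simps power2_eq_square)
  moreover have ad': "Re a + Re d = 1" using ad by (simp add: complex_eq_iff)
  ultimately have det: "0 \<le> Re a * Re d - (Re b)^2 - (Im b)^2"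
    using add_nonneg_nonneg by (metis distrib_right mult_1)
  let ?r = "(2 * Re b, - 2 * Im b, Re a - Re d)"
  have "(norm ?r)^2 = (Re a + Re d)^2 - 4 * (Re a * Re d - (Re b)^2 - (Im b)^2)"
    unfolding power2_norm_eq_inner by (simp add: power2_eq_square algebra_simps)
  then have "(norm ?r)^2 \<le> 1" using det ad' by simp
  then have "norm ?r \<le> 1" using power2_le_imp_le[of "norm ?r" 1] by simp
  moreover have "A = (1 / 2) \<cdot>\<^sub>m (1\<^sub>m 2 + sig ?r)"
    using A a d ad'
    by (intro mat2_eqI) (auto simp: sig_dim sig_entry complex_eq_iff c simp flip: a_def b_def c_def d_def)
  ultimately show ?thesis by blast
qed

lemma obs_bloch:
  assumes "density 2 A" "density 2 B"
  shows "\<exists>r. norm r \<le> 1 \<and> A - B = sig r"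
proof -
  obtain r where r: "norm r \<le> 1" "A = (1 / 2) \<cdot>\<^sub>m (1\<^sub>m 2 + sig r)" using density_bloch[OF assms(1)] by blast
  obtain t where t: "norm t \<le> 1" "B = (1 / 2) \<cdot>\<^sub>m (1\<^sub>m 2 + sig t)" using density_bloch[OF assms(2)] by blast
  let ?v = "(1 / 2) *\<^sub>R r + (- 1 / 2) *\<^sub>R t"
  have "norm ?v \<le> norm ((1 / 2) *\<^sub>R r) + norm ((- 1 / 2) *\<^sub>R t)" by (rule norm_triangle_ineq)
  also have "\<dots> \<le> 1" using r t by simp
  finally have "norm ?v \<le> 1" .
  moreover have "A - B = sig ?v"
    unfolding sig_linear r t using sig_carrier[of r] sig_carrier[of t]
    by (intro eq_matI) (auto simp: field_simps simp del: sig_carrier)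
  ultimately show ?thesis by blast
qed

lemma orthogonal_unit:
  fixes x :: bloch
  shows "\<exists>z. norm z = 1 \<and> inner x z = 0"
proof -
  obtain a b c where x: "x = (a, b, c)" by (cases x rule: sig.cases)
  show ?thesis
  proof (cases "a = 0 \<and> b = 0")
    case True
    then show ?thesis
      by (intro exI[of _ "(1, 0, 0)"]) (simp add: x norm_eq_1)
  next
    case False
    define w where "w = (- b, a, 0 :: real)"
    have "norm w \<noteq> 0" "inner x w = 0" using False by (auto simp: w_def x zero_prod_def)
    then show ?thesis
      by (intro exI[of _ "(1 / norm w) *\<^sub>R w"]) simp
  qed
qed

lemma unit_vector_multiple:
  fixes b :: bloch
  shows "\<exists>u. norm u = 1 \<and> b = norm b *\<^sub>R u"
proof (cases "b = 0")
  case True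
  obtain u :: bloch where "norm u = 1" using orthogonal_unit by blast
  then show ?thesis using True by (intro exI[of _ u]) simp
next
  case False
  then show ?thesis by (intro exI[of _ "(1 / norm b) *\<^sub>R b"]) simp
qed

text \<open>A functional homogeneous under scalars of both signs is, within the unit ball, largest
  on each line at one of its two unit vectors.\<close>

lemma unit_improvement:
  fixes b :: bloch
  assumes hom: "\<And>c u. \<phi> (c *\<^sub>R u) = c * (\<phi> u :: real)" and b: "norm b \<le> 1"
  shows "\<exists>u. norm u = 1 \<and> \<phi> b \<le> \<phi> u"
proof -
  obtain u where u: "norm u = 1" "b = norm b *\<^sub>R u"
    using unit_vector_multiple by blast
  show ?thesis
  proof (cases "0 \<le> \<phi> u")
    case True
    have "\<phi> b = norm b * \<phi> u" using u(2) hom by metis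
    also have "\<dots> \<le> \<phi> u" using True b by (simp add: mult_left_le_one_le)
    finally show ?thesis using u(1) by blast
  next
    case False
    have "\<phi> b = norm b * \<phi> u" using u(2) hom by metis
    also have "\<dots> \<le> 0" using False by (simp add: mult_nonneg_nonpos)
    also have "\<dots> \<le> \<phi> ((- 1) *\<^sub>R u)" using False by (simp only: hom)
    finally show ?thesis using u(1) by (intro exI[of _ "(- 1) *\<^sub>R u"]) simp
  qed
qed

text \<open>Normalises both vectors simultaneously. A vanishing one is replaced by a unit vector
  orthogonal to the other, and its equation still holds because the factor is 0.\<close>

lemma orthogonal_frame:
  fixes p q :: bloch
  assumes "inner p q = 0"
  shows "\<exists>x z. norm x = 1 \<and> norm z = 1 \<and> inner x z = 0 \<and> p = norm p *\<^sub>R x \<and> q = norm q *\<^sub>R z"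
proof -
  have *: "\<exists>x z. norm x = 1 \<and> norm z = 1 \<and> inner x z = 0 \<and> p = norm p *\<^sub>R x \<and> q = norm q *\<^sub>R z"
    if "inner p q = 0" "p \<noteq> 0" for p q :: bloch
  proof -
    define x where "x = (1 / norm p) *\<^sub>R p"
    have x: "norm x = 1" "p = norm p *\<^sub>R x" using that by (simp_all add: x_def)
    obtain z where "norm z = 1" "inner x z = 0" "q = norm q *\<^sub>R z"
    proof (cases "q = 0")
      case True
      then show ?thesis using orthogonal_unit[of x] that by auto
    next
      case False
      then show ?thesis using that[of "(1 / norm q) *\<^sub>R q"] \<open>inner p q = 0\<close> by (simp add: x_def)
    qed
    with x show ?thesis by blast
  qed
  show ?thesis
  proof (cases "p = 0")
    case False then show ?thesis using * assms by blast
  next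
    case p: True
    show ?thesis
    proof (cases "q = 0")
      case False then show ?thesis using *[of q p] assms by (metis inner_commute)
    next
      case True
      obtain x :: bloch where x: "norm x = 1" using orthogonal_unit by blast
      obtain z where "norm z = 1" "inner x z = 0" using orthogonal_unit[of x] by blast
      with x p True show ?thesis by (intro exI[of _ x] exI[of _ z]) simp
    qed
  qed
qed

section \<open>Scaling and normalising the observables inside correlators\<close>

lemma tensor_scale:
  assumes "\<And>k. k \<in> {1..n} \<Longrightarrow> V k \<in> carrier_mat 2 2"
  shows "tensor n (\<lambda>k. complex_of_real (\<beta> k) \<cdot>\<^sub>m V k) = complex_of_real (\<Prod>k\<in>{1..n}. \<beta> k) \<cdot>\<^sub>m tensor n V"
proof (rule eq_matI, goal_cases)
  case (1 i k)
  then have ik: "i < 2 ^ n" "k < 2 ^ n" by (auto simp: tensor_def)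
  have "(\<Prod>j\<in>{1..n}. (complex_of_real (\<beta> j) \<cdot>\<^sub>m V j) $$ (digit n i j, digit n k j))
      = (\<Prod>j\<in>{1..n}. complex_of_real (\<beta> j) * V j $$ (digit n i j, digit n k j))"
    by (intro prod.cong refl smult_entry[OF assms]) auto
  then show ?case
    unfolding smult_entry[OF tensor_carrier ik] tensor_entry[OF ik] by (simp add: prod.distrib)
qed (auto simp: tensor_def)

lemma corr_scale:
  assumes M: "povm n M"
  shows "corr n M \<tau> (\<lambda>k. sig (\<beta> k *\<^sub>R y k)) = (\<Prod>k\<in>{1..n}. \<beta> k) * corr n M \<tau> (\<lambda>k. sig (y k))"
proof -
  have "corr n M \<tau> (\<lambda>k. sig (\<beta> k *\<^sub>R y k))
      = expect n M (\<lambda>s. complex_of_real (\<Prod>k\<in>{1..n}. \<beta> k) \<cdot>\<^sub>m ((- 1) ^ \<tau> s \<cdot>\<^sub>m tensor n (\<lambda>k. sig (y k))))"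
    unfolding corr_def sig_scale tensor_scale[OF sig_carrier]
    by (intro expect_cong eq_matI) auto
  also have "\<dots> = (\<Prod>k\<in>{1..n}. \<beta> k) * corr n M \<tau> (\<lambda>k. sig (y k))"
    unfolding corr_def by (rule expect_smult[OF M]) simp
  finally show ?thesis .
qed

lemma corr_first_linear:
  assumes "povm n M" "1 \<le> n"
  shows "corr n M \<tau> (\<lambda>k. if k = 1 then sig (a *\<^sub>R u + b *\<^sub>R v) else V k)
    = a * corr n M \<tau> (\<lambda>k. if k = 1 then sig u else V k) + b * corr n M \<tau> (\<lambda>k. if k = 1 then sig v else V k)"
  using corr_bloch_linear[of n M 1 \<tau> V a u b v] assms by (simp add: fun_upd_def)

lemma corr_second_linear:
  assumes "povm n M" "j \<in> {2..n}"
  shows "corr n M \<tau> (\<lambda>k. if k = 1 then A else if k = j then sig (a *\<^sub>R u + b *\<^sub>R v) else V k)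
    = a * corr n M \<tau> (\<lambda>k. if k = 1 then A else if k = j then sig u else V k)
      + b * corr n M \<tau> (\<lambda>k. if k = 1 then A else if k = j then sig v else V k)"
proof -
  have *: "(\<lambda>k. if k = 1 then A else if k = j then C else V k) = (\<lambda>k. if k = 1 then A else V k)(j := C)" for C
    using assms(2) by (auto simp: fun_eq_iff)
  show ?thesis
    unfolding * using assms by (intro corr_bloch_linear) auto
qed

text \<open>All observables except that of sender 1 are normalised at once: the correlator scales by
  the product of their norms, which lies between 0 and 1. If the normalised correlator is negative,
  one sign change makes it positive.\<close>

lemma corr_unit_improvement:
  assumes M: "povm n M" and n: "2 \<le> n" and b: "\<And>k. k \<in> {2..n} \<Longrightarrow> norm (b k) \<le> 1"
  shows "\<exists>u. (\<forall>k. norm (u k) = 1) \<and>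
    corr n M \<tau> (\<lambda>k. if k = 1 then sig a else sig (b k)) \<le> corr n M \<tau> (\<lambda>k. if k = 1 then sig a else sig (u k))"
proof -
  define F where "F w = corr n M \<tau> (\<lambda>k. if k = 1 then sig a else sig (w k))" for w
  have scale: "F (\<lambda>k. \<beta> k *\<^sub>R y k) = (\<Prod>k\<in>{2..n}. \<beta> k) * F y" for \<beta> y
  proof -
    have "F (\<lambda>k. \<beta> k *\<^sub>R y k) = corr n M \<tau> (\<lambda>k. sig ((if k = 1 then 1 else \<beta> k) *\<^sub>R (if k = 1 then a else y k)))"
      unfolding F_def by (intro corr_cong) auto
    also have "\<dots> = (\<Prod>k\<in>{1..n}. if k = 1 then 1 else \<beta> k) * corr n M \<tau> (\<lambda>k. sig (if k = 1 then a else y k))"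
      by (rule corr_scale[OF M])
    also have "(\<Prod>k\<in>{1..n}. if k = 1 then 1 else \<beta> k) = (\<Prod>k\<in>{2..n}. \<beta> k)"
      by (intro prod.mono_neutral_cong_right) auto
    also have "corr n M \<tau> (\<lambda>k. sig (if k = 1 then a else y k)) = F y"
      unfolding F_def by (intro corr_cong) auto
    finally show ?thesis .
  qed
  have "\<forall>k. \<exists>u. norm u = 1 \<and> b k = norm (b k) *\<^sub>R u"
    using unit_vector_multiple by blast
  then obtain y where y: "\<And>k. norm (y k) = 1" "\<And>k. b k = norm (b k) *\<^sub>R y k"
    using choice[of "\<lambda>k u. norm u = 1 \<and> b k = norm (b k) *\<^sub>R u"] by blast
  have Fb: "F b = (\<Prod>k\<in>{2..n}. norm (b k)) * F y"
    using scale[of "\<lambda>k. norm (b k)" y] y(2) by simp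
  have p: "0 \<le> (\<Prod>k\<in>{2..n}. norm (b k))" "(\<Prod>k\<in>{2..n}. norm (b k)) \<le> 1"
    using b by (auto intro!: prod_nonneg prod_le_1)
  show ?thesis
  proof (cases "0 \<le> F y")
    case True
    then have "F b \<le> F y" unfolding Fb using p by (simp add: mult_left_le_one_le)
    then show ?thesis using y(1) unfolding F_def by blast
  next
    case False
    \<comment> \<open>Sender 2 exists because \<open>2 \<le> n\<close>; reversing its observable
      alone reverses the correlator.\<close>
    let ?u = "\<lambda>k. (if k = 2 then - 1 else 1) *\<^sub>R y k"
    have "F b \<le> 0" unfolding Fb using p False by (simp add: mult_nonneg_nonpos)
    also have "\<dots> \<le> F ?u" unfolding scale using False n by (simp add: prod.delta)
    finally have "F b \<le> F ?u" .
    moreover have "norm (?u k) = 1" for k using y(1) by simp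
    ultimately show ?thesis unfolding F_def by (intro exI[of _ ?u] conjI allI)
  qed
qed

text \<open>The observables of the other senders are normalised while the sum and difference of
  those of sender 1 are held fixed; after that, the two observables of sender 1 are normalised
  separately. The orthogonal directions \<open>x\<close>, \<open>z\<close> with weights
  \<open>ca\<close>, \<open>sa\<close> stand for that sum and difference, both sides being
  halved.\<close>

lemma success_le_unit:
  assumes M: "povm n M" and n: "2 \<le> n" and q: "qubit_states n \<rho>"
  shows "\<exists>x z ca sa u v. norm x = 1 \<and> norm z = 1 \<and> inner x z = 0 \<and> 0 \<le> ca \<and> 0 \<le> sa \<and> ca\<^sup>2 + sa\<^sup>2 = 1 \<and>
    (\<forall>k. norm (u k) = 1) \<and> (\<forall>k. norm (v k) = 1) \<and>
    (real n - 1) * sqrt 2 * success n \<rho> M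
      \<le> (real n - 1) * ca * corr n M (\<lambda>s. s 1) (\<lambda>k. if k = 1 then sig x else sig (u k))
        + (\<Sum>j\<in>{2..n}. sa * corr n M (\<lambda>s. s j) (\<lambda>k. if k = 1 then sig z else if k = j then sig (v j) else 1\<^sub>m 2))"
proof -
  define F where "F a w = corr n M (\<lambda>s. s 1) (\<lambda>k. if k = 1 then sig a else sig (w k))" for a w
  define G where "G j a w = corr n M (\<lambda>s. s j) (\<lambda>k. if k = 1 then sig a else if k = j then sig w else 1\<^sub>m 2)" for j a w
  have n1: "1 \<le> n" using n by simp
  note F_lin = corr_first_linear[OF M n1, of "\<lambda>s. s 1" _ _ _ _ "\<lambda>k. sig (w k)" for w, folded F_def]
  note G_lin = corr_first_linear[OF M n1, of "\<lambda>s. s j" _ _ _ _ "\<lambda>k. if k = j then sig w else 1\<^sub>m 2" for j w, folded G_def]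
  have "\<forall>k\<in>{1..n}. \<forall>x\<in>{0, 1}. \<exists>r. norm r \<le> 1 \<and> obs \<rho> k x = sig r"
    using q obs_bloch unfolding obs_def qubit_states_def by blast
  then obtain b where b: "\<And>k x. k \<in> {1..n} \<Longrightarrow> x \<in> {0, 1} \<Longrightarrow> norm (b k x) \<le> 1 \<and> obs \<rho> k x = sig (b k x)"
    by metis
  let ?a0 = "b 1 0" and ?a1 = "b 1 (1::nat)"
  have a: "obs \<rho> 1 0 = sig ?a0" "obs \<rho> 1 1 = sig ?a1" "norm ?a0 \<le> 1" "norm ?a1 \<le> 1"
    using b[of 1] n by auto
  have plus: "sig ?a0 + sig ?a1 = sig (1 *\<^sub>R ?a0 + 1 *\<^sub>R ?a1)"
    unfolding sig_linear by (rule eq_matI) (auto simp: sig_dim)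
  have minus: "sig ?a0 - sig ?a1 = sig (1 *\<^sub>R ?a0 + (- 1) *\<^sub>R ?a1)"
    unfolding sig_linear by (rule eq_matI) (auto simp: sig_dim)
  let ?p = "1 *\<^sub>R ?a0 + 1 *\<^sub>R ?a1" and ?q = "1 *\<^sub>R ?a0 + (- 1) *\<^sub>R ?a1"
  obtain u where u: "\<And>k. norm (u k) = 1" "F ?p (\<lambda>k. b k 0) \<le> F ?p u"
    using corr_unit_improvement[OF M n, of "\<lambda>k. b k 0" "\<lambda>s. s 1" ?p] b unfolding F_def by auto
  have "\<exists>w. norm w = 1 \<and> (j \<in> {2..n} \<longrightarrow> G j ?q (b j 1) \<le> G j ?q w)" for j
  proof (cases "j \<in> {2..n}")
    case True
    have "G j y (c *\<^sub>R w) = c * G j y w" for c w y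
      using corr_second_linear[OF M True, of "\<lambda>s. s j" "sig y" c w 0 w "\<lambda>_. 1\<^sub>m 2"] by (simp add: G_def cong: if_cong)
    then show ?thesis using unit_improvement[of "G j ?q" "b j 1"] b[of j 1] True by auto
  next
    case False then show ?thesis using orthogonal_unit[of "b j 1"] by blast
  qed
  then obtain v where v: "\<And>k. norm (v k) = 1" "\<And>j. j \<in> {2..n} \<Longrightarrow> G j ?q (b j 1) \<le> G j ?q (v j)"
    by metis
  \<comment> \<open>Reordering by sender 1: the metric is a functional of its first observable plus
    one of its second, so each can be improved on its own. The minus sign in \<open>\<phi>1\<close>
    stems from the difference in the second sum of \<open>W\<close>.\<close>
  define \<phi>0 where "\<phi>0 w = (real n - 1) * F w u + (\<Sum>j\<in>{2..n}. G j w (v j))" for w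
  define \<phi>1 where "\<phi>1 w = (real n - 1) * F w u - (\<Sum>j\<in>{2..n}. G j w (v j))" for w
  have Fc: "F (c *\<^sub>R w) y = c * F w y" for c w y using F_lin[of c w 0 w y] by simp
  have Gc: "G j (c *\<^sub>R w) y = c * G j w y" for c w y j using G_lin[of j c w 0 w y] by simp
  have "\<phi>0 (c *\<^sub>R w) = c * \<phi>0 w" "\<phi>1 (c *\<^sub>R w) = c * \<phi>1 w" for c w
    by (simp_all add: \<phi>0_def \<phi>1_def Fc Gc sum_distrib_left algebra_simps)
  then obtain a0 a1 where a01: "norm a0 = 1" "norm a1 = 1" "\<phi>0 ?a0 \<le> \<phi>0 a0" "\<phi>1 ?a1 \<le> \<phi>1 a1"
    using unit_improvement[of \<phi>0 ?a0] unit_improvement[of \<phi>1 ?a1] a by blast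
  \<comment> \<open>For unit vectors the sum and the difference are orthogonal, with squared lengths
    adding up to 4; halving the lengths gives the cosine \<open>ca\<close> and the sine
    \<open>sa\<close> of one angle.\<close>
  have ip: "inner (a0 + a1) (a0 - a1) = 0"
    using a01 by (simp add: norm_eq_1 inner_add_left inner_add_right inner_diff_left inner_diff_right inner_commute)
  obtain x z where xz: "norm x = 1" "norm z = 1" "inner x z = 0"
      "a0 + a1 = norm (a0 + a1) *\<^sub>R x" "a0 - a1 = norm (a0 - a1) *\<^sub>R z"
    using orthogonal_frame[OF ip] by blast
  define ca where "ca = norm (a0 + a1) / 2"
  define sa where "sa = norm (a0 - a1) / 2"
  have cs: "ca\<^sup>2 + sa\<^sup>2 = 1"
    using a01 unfolding ca_def sa_def power_divide power2_norm_eq_inner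
    by (simp add: norm_eq_1 inner_add_left inner_add_right inner_diff_left inner_diff_right inner_commute field_simps)
  have "(real n - 1) * 2 * sqrt 2 * success n \<rho> M
      = (real n - 1) * corr n M (\<lambda>s. s 1) (\<lambda>k. if k = 1 then obs \<rho> 1 0 + obs \<rho> 1 1 else obs \<rho> k 0)
      + (\<Sum>j\<in>{2..n}. corr n M (\<lambda>s. s j) (\<lambda>k. if k = 1 then obs \<rho> 1 0 - obs \<rho> 1 1 else if k = j then obs \<rho> j 1 else 1\<^sub>m 2))"
    by (rule success_corr[OF M n])
  also have "corr n M (\<lambda>s. s 1) (\<lambda>k. if k = 1 then obs \<rho> 1 0 + obs \<rho> 1 1 else obs \<rho> k 0) = F ?p (\<lambda>k. b k 0)"
    unfolding F_def a plus using b by (intro corr_cong) auto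
  also have "(\<Sum>j\<in>{2..n}. corr n M (\<lambda>s. s j) (\<lambda>k. if k = 1 then obs \<rho> 1 0 - obs \<rho> 1 1 else if k = j then obs \<rho> j 1 else 1\<^sub>m 2))
      = (\<Sum>j\<in>{2..n}. G j ?q (b j 1))"
    unfolding G_def a minus using b by (intro sum.cong refl corr_cong) auto
  also have "(real n - 1) * F ?p (\<lambda>k. b k 0) + (\<Sum>j\<in>{2..n}. G j ?q (b j 1)) \<le> (real n - 1) * F ?p u + (\<Sum>j\<in>{2..n}. G j ?q (v j))"
    using u v n by (intro add_mono mult_left_mono sum_mono) auto
  also have "\<dots> = \<phi>0 ?a0 + \<phi>1 ?a1"
    unfolding F_lin G_lin by (simp add: \<phi>0_def \<phi>1_def sum.distrib sum_subtractf algebra_simps)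
  also have "\<dots> \<le> \<phi>0 a0 + \<phi>1 a1" using a01 by simp
  also have "\<dots> = (real n - 1) * F (1 *\<^sub>R a0 + 1 *\<^sub>R a1) u + (\<Sum>j\<in>{2..n}. G j (1 *\<^sub>R a0 + (- 1) *\<^sub>R a1) (v j))"
    unfolding F_lin G_lin by (simp add: \<phi>0_def \<phi>1_def sum.distrib sum_subtractf algebra_simps)
  also have "1 *\<^sub>R a0 + 1 *\<^sub>R a1 = (2 * ca) *\<^sub>R x" using xz(4) by (simp add: ca_def)
  also have "1 *\<^sub>R a0 + (- 1) *\<^sub>R a1 = (2 * sa) *\<^sub>R z" using xz(5) by (simp add: sa_def)
  finally have "(real n - 1) * 2 * sqrt 2 * success n \<rho> M
      \<le> 2 * ((real n - 1) * ca * F x u + (\<Sum>j\<in>{2..n}. sa * G j z (v j)))"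
    unfolding Fc Gc by (simp add: sum_distrib_left algebra_simps)
  moreover have "(real n - 1) * 2 * sqrt 2 * success n \<rho> M = 2 * ((real n - 1) * sqrt 2 * success n \<rho> M)"
    by simp
  ultimately have "(real n - 1) * sqrt 2 * success n \<rho> M \<le> (real n - 1) * ca * F x u + (\<Sum>j\<in>{2..n}. sa * G j z (v j))"
    by (metis mult_le_cancel_left_pos zero_less_numeral)
  moreover have "0 \<le> ca" "0 \<le> sa" by (simp_all add: ca_def sa_def)
  ultimately show ?thesis
    using xz cs u v unfolding F_def G_def by blast
qed

section \<open>The GHZ basis as a stabilizer basis\<close>

text \<open>The basis states on which every signed \<open>Z_1 Z_j\<close> takes the value 1, that
  is, the support of \<open>ghz n s\<close>. The parity form covers both branches of the
  superposition at once.\<close>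

definition matching :: "nat \<Rightarrow> (nat \<Rightarrow> nat) \<Rightarrow> nat \<Rightarrow> bool" where
  "matching n s i \<longleftrightarrow> (\<forall>j\<in>{2..n}. even (digit n i 1 + digit n i j + s j))"

text \<open>Complementary bit strings, the positions of the entries 1 of
  \<open>X \<otimes> \<dots> \<otimes> X\<close>.\<close>

definition flipped :: "nat \<Rightarrow> nat \<Rightarrow> nat \<Rightarrow> bool" where
  "flipped n i k \<longleftrightarrow> (\<forall>j\<in>{1..n}. digit n i j \<noteq> digit n k j)"

lemma bitstringsD: "s \<in> bitstrings n \<Longrightarrow> j \<in> {1..n} \<Longrightarrow> s j = 0 \<or> s j = 1"
  by (auto simp: bitstrings_def PiE_def Pi_def)

lemma digit_cases: "digit n i j = 0 \<or> digit n i j = 1"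
  using digit_lt[of n i j] by linarith

lemma ket_entry:
  assumes "\<And>j. j \<in> {1..n} \<Longrightarrow> b j < 2" "i < 2 ^ n"
  shows "ket n b $ i = (if \<forall>j\<in>{1..n}. digit n i j = b j then 1 else 0)"
proof -
  have "i = (\<Sum>j\<in>{1..n}. b j * 2 ^ (n - j)) \<longleftrightarrow> (\<forall>j\<in>{1..n}. digit n i j = b j)"
    (is "i = ?S \<longleftrightarrow> _")
  proof
    assume "\<forall>j\<in>{1..n}. digit n i j = b j"
    then show "i = ?S"
      using sum_binary[of n b, OF assms(1)] by (intro digits_inject[OF assms(2)]) auto
  qed (use sum_binary[of n b, OF assms(1)] in auto)
  then show ?thesis using assms(2) by (simp add: ket_def unit_vec_def)
qed

lemma ghz_entry:
  assumes n: "1 \<le> n" and s: "s \<in> bitstrings n" and i: "i < 2 ^ n"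
  shows "ghz n s $ i = complex_of_real (1 / sqrt 2) *
    (if matching n s i then (if digit n i 1 = 0 then 1 else (- 1) ^ s 1) else 0)"
proof -
  have split: "(\<forall>j\<in>{1..n}. P j) \<longleftrightarrow> P 1 \<and> (\<forall>j\<in>{2..n}. P j)" for P
  proof -
    have "{1..n} = insert 1 {2..n}" using n by auto
    then show ?thesis by simp
  qed
  have bit: "s j = 0 \<or> s j = 1" if "j \<in> {2..n}" for j
    using bitstringsD[OF s, of j] that by auto
  have k0: "ket n (s(1 := 0)) $ i = (if digit n i 1 = 0 \<and> matching n s i then 1 else 0)"
  proof -
    have "ket n (s(1 := 0)) $ i = (if \<forall>j\<in>{1..n}. digit n i j = (s(1 := 0)) j then 1 else 0)"
      using bitstringsD[OF s] i by (intro ket_entry) fastforce+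
    also have "(\<forall>j\<in>{1..n}. digit n i j = (s(1 := 0)) j) \<longleftrightarrow> digit n i 1 = 0 \<and> matching n s i"
    proof -
      have "digit n i j = s j \<longleftrightarrow> even (0 + digit n i j + s j)" if "j \<in> {2..n}" for j
        using bit[OF that] digit_cases[of n i j] by auto
      then show ?thesis unfolding split matching_def by auto
    qed
    finally show ?thesis .
  qed
  have k1: "ket n ((\<lambda>j. 1 - s j)(1 := 1)) $ i = (if digit n i 1 = 1 \<and> matching n s i then 1 else 0)"
  proof -
    have "ket n ((\<lambda>j. 1 - s j)(1 := 1)) $ i = (if \<forall>j\<in>{1..n}. digit n i j = ((\<lambda>j. 1 - s j)(1 := 1)) j then 1 else 0)"
      using i by (intro ket_entry) auto
    also have "(\<forall>j\<in>{1..n}. digit n i j = ((\<lambda>j. 1 - s j)(1 := 1)) j) \<longleftrightarrow> digit n i 1 = 1 \<and> matching n s i"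
    proof -
      have "digit n i j = 1 - s j \<longleftrightarrow> even (1 + digit n i j + s j)" if "j \<in> {2..n}" for j
        using bit[OF that] digit_cases[of n i j] by auto
      then show ?thesis unfolding split matching_def by auto
    qed
    finally show ?thesis .
  qed
  have dims: "dim_vec (ket n b) = 2 ^ n" for b by (simp add: ket_def)
  show ?thesis
    using i k0 k1 digit_cases[of n i 1] by (auto simp: ghz_def dims)
qed

lemma tensor_PX_entry:
  assumes "i < 2 ^ n" "k < 2 ^ n"
  shows "tensor n (\<lambda>_. PX) $$ (i, k) = (if flipped n i k then 1 else 0)"
proof -
  have "PX $$ (digit n i j, digit n k j) = (if digit n i j \<noteq> digit n k j then 1 else 0)" for j
    using digit_cases[of n i j] digit_cases[of n k j] by (auto simp: sig_entry complex_eq_iff)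
  then show ?thesis
    unfolding flipped_def tensor_entry[OF assms] by (simp add: prod_indicator)
qed

lemma tensor_PZ_entry:
  assumes ik: "i < 2 ^ n" "k < 2 ^ n" and j: "j \<in> {2..n}"
  shows "tensor n (\<lambda>l. if l = 1 then PZ else if l = j then PZ else 1\<^sub>m 2) $$ (i, k)
    = (if i = k then (- 1) ^ (digit n i 1 + digit n i j) else 0)"
proof (cases "i = k")
  case True
  have "(\<Prod>l\<in>{1..n}. (if l = 1 then PZ else if l = j then PZ else 1\<^sub>m 2) $$ (digit n i l, digit n i l))
      = (\<Prod>l\<in>{1, j}. (- 1) ^ digit n i l)"
    using j
  proof (intro prod.mono_neutral_cong_right ballI)
    fix l assume "l \<in> {1, j}"
    then show "(if l = 1 then PZ else if l = j then PZ else 1\<^sub>m 2) $$ (digit n i l, digit n i l) = (- 1) ^ digit n i l"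
      using digit_cases[of n i l] by (auto simp: sig_entry)
  qed (use digit_lt in auto)
  also have "\<dots> = (- 1) ^ (digit n i 1 + digit n i j)"
    using j by (simp add: power_add)
  finally show ?thesis using True ik by (simp add: tensor_entry)
next
  case False
  then obtain l where l: "l \<in> {1..n}" "digit n i l \<noteq> digit n k l"
    using digits_inject[OF ik] by blast
  have "PZ $$ (a, b) = 0" if "a < 2" "b < 2" "a \<noteq> b" for a b
    using that by (auto simp: less_2_cases_iff sig_entry complex_eq_iff)
  then have "PZ $$ (digit n i l, digit n k l) = 0"
    using l(2) by simp
  then have "(if l = 1 then PZ else if l = j then PZ else 1\<^sub>m 2) $$ (digit n i l, digit n k l) = 0"
    using l(2) by auto
  then have "(\<Prod>l\<in>{1..n}. (if l = 1 then PZ else if l = j then PZ else 1\<^sub>m 2) $$ (digit n i l, digit n k l)) = 0"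
    using l(1) by (intro prod_zero bexI[of _ l]) simp_all
  then show ?thesis using False ik by (simp add: tensor_entry)
qed

lemma matching_flipped:
  assumes "flipped n i k" "1 \<le> n"
  shows "matching n s i = matching n s k"
proof -
  have opp: "even (digit n i j) \<longleftrightarrow> odd (digit n k j)" if "j \<in> {1..n}" for j
    using assms(1) that digit_cases[of n i j] digit_cases[of n k j] unfolding flipped_def by fastforce
  have "even (digit n i 1 + digit n i j + s j) = even (digit n k 1 + digit n k j + s j)"
    if "j \<in> {2..n}" for j
    using that assms(2) opp[of 1] opp[of j] by (simp add: even_add)
  then show ?thesis by (simp add: matching_def)
qed

text \<open>Each bit relative to the first is prescribed by \<open>s\<close>, so two matching
  indices differ either in no bit or in all of them. Hence the support of a GHZ vector is one
  complementary pair.\<close>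

lemma matching_pair:
  assumes ik: "i < 2 ^ n" "k < 2 ^ n" and "matching n s i" "matching n s k" and n: "1 \<le> n"
  shows "i = k \<or> flipped n i k" "digit n i 1 = digit n k 1 \<longleftrightarrow> i = k"
proof -
  have par: "even (digit n i 1 + digit n k 1) \<longleftrightarrow> even (digit n i j + digit n k j)" if "j \<in> {1..n}" for j
  proof (cases "j = 1")
    case False
    then have "j \<in> {2..n}" using that by auto
    then show ?thesis using assms(3,4) unfolding matching_def by (metis even_add)
  qed simp
  have ev: "even (digit n i j + digit n k j) \<longleftrightarrow> digit n i j = digit n k j" for j
    using digit_cases[of n i j] digit_cases[of n k j] by auto
  have *: "digit n i j = digit n k j \<longleftrightarrow> digit n i 1 = digit n k 1" if "j \<in> {1..n}" for j
    using par[OF that] ev by blast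
  show "digit n i 1 = digit n k 1 \<longleftrightarrow> i = k"
    using * digits_inject[OF ik] by blast
  then show "i = k \<or> flipped n i k"
    using * unfolding flipped_def by blast
qed

lemma flipped_commute: "flipped n i k = flipped n k i"
  unfolding flipped_def by metis

lemma not_flipped_self: "1 \<le> n \<Longrightarrow> \<not> flipped n i i"
  by (auto simp: flipped_def)

text \<open>The projector is the product of the diagonal projector onto matching indices and
  \<open>(1 + (-1)^(s 1) X \<otimes> \<dots> \<otimes> X) / 2\<close>; these commute because
  complementing an index preserves \<open>matching\<close>.\<close>

lemma projector_ghz_entry:
  assumes n: "1 \<le> n" and s: "s \<in> bitstrings n" and ik: "i < 2 ^ n" "k < 2 ^ n"
  shows "projector (ghz n s) $$ (i, k) =
    (if matching n s i then ((if i = k then 1 else 0) + (- 1) ^ s 1 * (if flipped n i k then 1 else 0)) / 2 else 0)"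
proof -
  have h: "complex_of_real (sqrt 2) * complex_of_real (sqrt 2) = 2"
    by (simp flip: of_real_mult)
  have sg: "(- 1 :: complex) ^ s 1 * (- 1) ^ s 1 = 1"
    by (simp flip: power_add mult_2)
  have p: "projector (ghz n s) $$ (i, k) = ghz n s $ i * cnj (ghz n s $ k)"
    using ik by (simp add: projector_def)
  have d: "digit n k 1 = 0 \<or> digit n k 1 = 1" "digit n i 1 = 0 \<or> digit n i 1 = 1"
    by (rule digit_cases)+
  consider "matching n s i" "matching n s k" "i = k" | "matching n s i" "matching n s k" "i \<noteq> k" "flipped n i k"
    | "matching n s i" "\<not> matching n s k" | "\<not> matching n s i"
    using matching_pair[OF ik _ _ n] by blast
  then show ?thesis
  proof cases
    case 1
    then show ?thesis
      unfolding p ghz_entry[OF n s ik(1)] ghz_entry[OF n s ik(2)] using not_flipped_self[OF n] h sg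
      by (auto simp: field_simps)
  next
    case 2
    then have "digit n i 1 \<noteq> digit n k 1" using matching_pair[OF ik] n by blast
    then show ?thesis
      unfolding p ghz_entry[OF n s ik(1)] ghz_entry[OF n s ik(2)] using 2 h sg d
      by (auto simp: field_simps)
  next
    case 3
    then have "i \<noteq> k" "\<not> flipped n i k" using matching_flipped[OF _ n] by auto
    then show ?thesis
      unfolding p ghz_entry[OF n s ik(1)] ghz_entry[OF n s ik(2)] using 3 by simp
  next
    case 4
    then show ?thesis unfolding p ghz_entry[OF n s ik(1)] by simp
  qed
qed

text \<open>Take for \<open>Q\<close> the matrix with first column \<open>v\<close> and zeros
  elsewhere.\<close>

lemma projector_square:
  assumes v: "dim_vec v = d"
  shows "\<exists>Q\<in>carrier_mat d d. projector v = Q * mat_adjoint Q"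
proof -
  define Q where "Q = mat d d (\<lambda>(i, k). if k = 0 then v $ i else 0)"
  have Q: "Q \<in> carrier_mat d d" and Q': "mat_adjoint Q \<in> carrier_mat d d" by (simp_all add: Q_def)
  have "projector v = Q * mat_adjoint Q"
  proof (rule eq_matI, goal_cases)
    case (1 i k)
    then have ik: "i < d" "k < d" using Q Q' by auto
    have "(Q * mat_adjoint Q) $$ (i, k) = (\<Sum>l<d. if l = 0 then v $ i * cnj (v $ k) else 0)"
      unfolding mult_entry[OF Q Q' ik]
      by (intro sum.cong refl) (use ik in \<open>simp add: mat_adjoint_entry[OF Q], simp add: Q_def\<close>)
    also have "\<dots> = projector v $$ (i, k)" using ik v by (auto simp: projector_def)
    finally show ?case ..
  qed (use carrier_matD[OF Q] carrier_matD[OF Q'] v in \<open>simp_all add: projector_def\<close>)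
  then show ?thesis using Q by blast
qed

lemma expect_projector_nonneg:
  assumes M: "povm n M"
  shows "0 \<le> expect n M (\<lambda>s. projector (ghz n s))"
proof -
  have "\<forall>s. \<exists>Q. Q \<in> carrier_mat (2 ^ n) (2 ^ n) \<and> projector (ghz n s) = Q * mat_adjoint Q"
    using projector_square[OF ghz_dim] by blast
  then obtain Q where Q: "\<And>s. Q s \<in> carrier_mat (2 ^ n) (2 ^ n)" "\<And>s. projector (ghz n s) = Q s * mat_adjoint (Q s)"
    by metis
  show ?thesis unfolding Q(2) by (rule expect_square[OF M Q(1)])
qed

text \<open>The GHZ projector is the joint spectral projector of the \<open>n\<close> stabilizers, so its failure
  probability is at most the sum of the failure probabilities of the individual stabilizers.\<close>

lemma expect_ghz_union_bound:
  assumes M: "povm n M" and n: "2 \<le> n"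
  shows "real n + 2 * expect n M (\<lambda>s. projector (ghz n s)) \<ge> 2 + corr n M (\<lambda>s. s 1) (\<lambda>_. PX)
    + (\<Sum>j\<in>{2..n}. corr n M (\<lambda>s. s j) (\<lambda>k. if k = 1 then PZ else if k = j then PZ else 1\<^sub>m 2))"
proof -
  let ?d = "2 ^ n :: nat"
  have n1: "1 \<le> n" using n by simp
  define X where "X s = (- 1) ^ s 1 \<cdot>\<^sub>m tensor n (\<lambda>_. PX)" for s :: "nat \<Rightarrow> nat"
  define Z where "Z s j = (- 1) ^ s j \<cdot>\<^sub>m tensor n (\<lambda>k. if k = 1 then PZ else if k = j then PZ else 1\<^sub>m 2)" for s :: "nat \<Rightarrow> nat" and j
  define \<delta> :: "nat \<Rightarrow> nat \<Rightarrow> complex" where "\<delta> i k = (if i = k then 1 else 0)" for i k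
  define f :: "(nat \<Rightarrow> nat) \<Rightarrow> nat \<Rightarrow> nat \<Rightarrow> complex" where "f s i k = (- 1) ^ s 1 * (if flipped n i k then 1 else 0)" for s i k
  \<comment> \<open>\<open>m s i\<close> counts the signed stabilizers \<open>Z_1 Z_j\<close>
    violated by the basis state \<open>i\<close>; their sum is diagonal with entries
    \<open>n - 1 - 2 * m s i\<close>.\<close>
  define m where "m s i = card {j\<in>{2..n}. odd (digit n i 1 + digit n i j + s j)}" for s :: "nat \<Rightarrow> nat" and i
  have X: "X s \<in> carrier_mat ?d ?d" and Z: "Z s j \<in> carrier_mat ?d ?d" for s j
    by (simp_all add: X_def Z_def)
  have Xe: "X s $$ (i, k) = f s i k" if "i < ?d" "k < ?d" for s i k
    using that by (simp add: X_def f_def smult_entry[OF tensor_carrier] tensor_PX_entry)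
  have m0: "m s i = 0 \<longleftrightarrow> matching n s i" for s i
    by (auto simp: m_def matching_def)
  have Zsum: "(\<Sum>j\<in>{2..n}. Z s j $$ (i, k)) = \<delta> i k * (of_nat n - 1 - 2 * of_nat (m s i))" if ik: "i < ?d" "k < ?d" for s i k
  proof -
    have "(\<Sum>j\<in>{2..n}. Z s j $$ (i, k)) = (\<Sum>j\<in>{2..n}. \<delta> i k * (1 - 2 * (if odd (digit n i 1 + digit n i j + s j) then 1 else 0)))"
    proof (intro sum.cong refl)
      fix j assume j: "j \<in> {2..n}"
      have "Z s j $$ (i, k) = (- 1) ^ s j * (if i = k then (- 1) ^ (digit n i 1 + digit n i j) else 0)"
        unfolding Z_def smult_entry[OF tensor_carrier ik] tensor_PZ_entry[OF ik j] ..
      also have "\<dots> = \<delta> i k * (- 1) ^ (digit n i 1 + digit n i j + s j)"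
        by (simp add: \<delta>_def power_add mult_ac)
      also have "(- 1 :: complex) ^ (digit n i 1 + digit n i j + s j) = 1 - 2 * (if odd (digit n i 1 + digit n i j + s j) then 1 else 0)"
        by (simp add: uminus_power_if)
      finally show "Z s j $$ (i, k) = \<delta> i k * (1 - 2 * (if odd (digit n i 1 + digit n i j + s j) then 1 else 0))" .
    qed
    also have "\<dots> = \<delta> i k * (of_nat (card {2..n}) - 2 * of_nat (m s i))"
      unfolding sum_distrib_left[symmetric] sum_subtractf m_def by (simp add: sum.If_cases Int_def)
    finally show ?thesis using n by (simp add: of_nat_diff)
  qed
  \<comment> \<open>The slack of the operator inequality vanishes where \<open>m s i = 0\<close>;
    elsewhere it is \<open>2 * (m s i - 1)\<close> plus \<open>1 - X\<close>, with \<open>X\<close>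
    the signed product of all \<open>PX\<close>. \<open>Q1\<close> is a square root of the first
    summand.\<close>
  define Q1 where "Q1 s = mat ?d ?d (\<lambda>(i, k). if i = k then complex_of_real (sqrt (2 * (real (m s i) - (if m s i = 0 then 0 else 1)))) else 0)" for s
  \<comment> \<open>\<open>1 - X\<close> has square \<open>2 * (1 - X)\<close>, whence the division
    by \<open>sqrt 2\<close>. Cutting down to the indices with \<open>m s i > 0\<close> is harmless
    since \<open>X\<close> preserves this set.\<close>
  define Q2 where "Q2 s = mat ?d ?d (\<lambda>(i, k). if m s i = 0 then 0 else (\<delta> i k - f s i k) / complex_of_real (sqrt 2))" for s
  have Q1: "Q1 s \<in> carrier_mat ?d ?d" and Q1': "mat_adjoint (Q1 s) \<in> carrier_mat ?d ?d"
    and Q2: "Q2 s \<in> carrier_mat ?d ?d" and Q2': "mat_adjoint (Q2 s) \<in> carrier_mat ?d ?d" for s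
    by (simp_all add: Q1_def Q2_def)
  have Q1e: "(Q1 s * mat_adjoint (Q1 s)) $$ (i, k) = \<delta> i k * (2 * (of_nat (m s i) - (if m s i = 0 then 0 else 1)))"
    if ik: "i < ?d" "k < ?d" for s i k
  proof -
    let ?q = "complex_of_real (sqrt (2 * (real (m s i) - (if m s i = 0 then 0 else 1))))"
    have "(Q1 s * mat_adjoint (Q1 s)) $$ (i, k) = (\<Sum>l<?d. if l = i then \<delta> i k * (?q * ?q) else 0)"
      unfolding mult_entry[OF Q1 Q1' ik]
      by (intro sum.cong refl) (use ik in \<open>simp add: mat_adjoint_entry[OF Q1], simp add: Q1_def \<delta>_def\<close>)
    also have "\<dots> = \<delta> i k * (?q * ?q)" using ik by simp
    also have "?q * ?q = complex_of_real (2 * (real (m s i) - (if m s i = 0 then 0 else 1)))"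
      unfolding of_real_mult[symmetric] by (subst real_sqrt_mult_self) (auto simp: Suc_leI)
    finally show ?thesis by (auto split: if_splits)
  qed
  have ff: "(\<Sum>l<?d. f s i l * f s k l) = \<delta> i k" if ik: "i < ?d" "k < ?d" for s i k
  proof -
    have "tensor n (\<lambda>_. PX) * tensor n (\<lambda>_. PX) = 1\<^sub>m ?d"
    proof -
      have "norm (1 :: real, 0 :: real, 0 :: real) = 1" by (simp add: norm_eq_1)
      then show ?thesis by (simp add: tensor_mult sig_square)
    qed
    then have "(\<Sum>l<?d. tensor n (\<lambda>_. PX) $$ (i, l) * tensor n (\<lambda>_. PX) $$ (l, k)) = \<delta> i k"
      using ik by (subst mult_entry[OF tensor_carrier tensor_carrier ik, symmetric]) (simp add: \<delta>_def)
    moreover have "f s i l * f s k l = tensor n (\<lambda>_. PX) $$ (i, l) * tensor n (\<lambda>_. PX) $$ (l, k)" if "l < ?d" for l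
    proof -
      have "(- 1 :: complex) ^ s 1 * (- 1) ^ s 1 = 1" by (simp flip: power_add mult_2)
      moreover have "flipped n k l = flipped n l k" by (rule flipped_commute)
      ultimately show ?thesis using that ik by (simp add: tensor_PX_entry f_def)
    qed
    ultimately show ?thesis by simp
  qed
  have fsym: "f s i k = f s k i" for s i k
    using flipped_commute[of n i k] by (simp add: f_def)
  have freal: "cnj (f s i k) = f s i k" for s i k by (simp add: f_def)
  have Q2e: "(Q2 s * mat_adjoint (Q2 s)) $$ (i, k) = (if m s i = 0 then 0 else \<delta> i k - f s i k)"
    if ik: "i < ?d" "k < ?d" for s i k
  proof -
    have h: "complex_of_real (sqrt 2) * complex_of_real (sqrt 2) = 2"
      by (simp flip: of_real_mult)
    have "(Q2 s * mat_adjoint (Q2 s)) $$ (i, k) = (\<Sum>l<?d. if m s i = 0 \<or> m s k = 0 then 0 else (\<delta> i l - f s i l) * (\<delta> k l - f s k l) / 2)"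
      unfolding mult_entry[OF Q2 Q2' ik]
      by (intro sum.cong refl) (use ik h in \<open>simp add: mat_adjoint_entry[OF Q2], simp add: Q2_def freal \<delta>_def\<close>)
    also have "\<dots> = (if m s i = 0 \<or> m s k = 0 then 0 else (\<Sum>l<?d. (\<delta> i l - f s i l) * (\<delta> k l - f s k l)) / 2)"
      by (simp add: sum_divide_distrib)
    also have "(\<Sum>l<?d. (\<delta> i l - f s i l) * (\<delta> k l - f s k l))
        = (\<Sum>l<?d. (if l = i then \<delta> k i else 0) - (if l = i then f s k i else 0) - (if l = k then f s i k else 0) + f s i l * f s k l)"
      by (intro sum.cong refl) (auto simp: \<delta>_def algebra_simps)
    also have "\<dots> = \<delta> k i - f s k i - f s i k + \<delta> i k"
      using ik by (simp add: sum.distrib sum_subtractf ff)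
    also have "\<dots> = 2 * (\<delta> i k - f s i k)"
      by (simp add: fsym[of s k i] \<delta>_def)
    also have "(if m s i = 0 \<or> m s k = 0 then 0 else 2 * (\<delta> i k - f s i k) / 2) = (if m s i = 0 then 0 else \<delta> i k - f s i k)"
      using matching_flipped[OF _ n1, of i k s] unfolding m0 by (auto simp: \<delta>_def f_def)
    finally show ?thesis .
  qed
  let ?P = "\<lambda>s. projector (ghz n s)"
  have P: "?P s \<in> carrier_mat ?d ?d" for s by (simp add: projector_carrier)
  have R: "complex_of_real (real n) \<cdot>\<^sub>m 1\<^sub>m ?d + complex_of_real 2 \<cdot>\<^sub>m ?P s
      = complex_of_real 2 \<cdot>\<^sub>m 1\<^sub>m ?d + (X s + (msum ?d (Z s) {2..n} + (Q1 s * mat_adjoint (Q1 s) + Q2 s * mat_adjoint (Q2 s))))"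
    if s: "s \<in> bitstrings n" for s
  proof (rule eq_matI, goal_cases)
    case (1 i k)
    have c1: "Q1 s * mat_adjoint (Q1 s) \<in> carrier_mat ?d ?d" and c2: "Q2 s * mat_adjoint (Q2 s) \<in> carrier_mat ?d ?d"
      using mult_carrier_mat[OF Q1 Q1'] mult_carrier_mat[OF Q2 Q2'] by auto
    have ik: "i < ?d" "k < ?d" using 1 mult_carrier_mat[OF Q2 Q2', of s s] by auto
    have lhs: "(complex_of_real (real n) \<cdot>\<^sub>m 1\<^sub>m ?d + complex_of_real 2 \<cdot>\<^sub>m ?P s) $$ (i, k)
        = of_nat n * \<delta> i k + (if m s i = 0 then \<delta> i k + f s i k else 0)"
      using ik P[of s] projector_ghz_entry[OF n1 s ik]
      by (simp add: m0 \<delta>_def f_def)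
    have c4: "msum ?d (Z s) {2..n} \<in> carrier_mat ?d ?d" by simp
    have c5: "Q1 s * mat_adjoint (Q1 s) + Q2 s * mat_adjoint (Q2 s) \<in> carrier_mat ?d ?d"
      using c2 by (rule add_carrier_mat)
    have c6: "msum ?d (Z s) {2..n} + (Q1 s * mat_adjoint (Q1 s) + Q2 s * mat_adjoint (Q2 s)) \<in> carrier_mat ?d ?d"
      using c5 by (rule add_carrier_mat)
    have c7: "X s + (msum ?d (Z s) {2..n} + (Q1 s * mat_adjoint (Q1 s) + Q2 s * mat_adjoint (Q2 s))) \<in> carrier_mat ?d ?d"
      using c6 by (rule add_carrier_mat)
    have c8: "complex_of_real 2 \<cdot>\<^sub>m 1\<^sub>m ?d \<in> carrier_mat ?d ?d" by simp
    have "msum ?d (Z s) {2..n} $$ (i, k) = \<delta> i k * (of_nat n - 1 - 2 * of_nat (m s i))"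
      using ik Zsum[OF ik] by (simp add: msum_def)
    then have rhs: "(complex_of_real 2 \<cdot>\<^sub>m 1\<^sub>m ?d + (X s + (msum ?d (Z s) {2..n} + (Q1 s * mat_adjoint (Q1 s) + Q2 s * mat_adjoint (Q2 s))))) $$ (i, k)
        = 2 * \<delta> i k + (f s i k + (\<delta> i k * (of_nat n - 1 - 2 * of_nat (m s i)) + (\<delta> i k * (2 * (of_nat (m s i) - (if m s i = 0 then 0 else 1))) + (if m s i = 0 then 0 else \<delta> i k - f s i k))))"
      unfolding add_entry[OF c8 c7 ik] add_entry[OF X c6 ik] add_entry[OF c4 c5 ik] add_entry[OF c1 c2 ik] Q1e[OF ik] Q2e[OF ik] Xe[OF ik]
      using ik by (simp add: \<delta>_def)
    show ?case unfolding lhs rhs by (simp add: algebra_simps)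
  next
    case 2 show ?case using P[of s] mult_carrier_mat[OF Q2 Q2', of s s] by auto
  next
    case 3 show ?case using P[of s] mult_carrier_mat[OF Q2 Q2', of s s] by auto
  qed
  have cQ1: "Q1 s * mat_adjoint (Q1 s) \<in> carrier_mat ?d ?d" and cQ2: "Q2 s * mat_adjoint (Q2 s) \<in> carrier_mat ?d ?d" for s
    using mult_carrier_mat[OF Q1 Q1'] mult_carrier_mat[OF Q2 Q2'] by auto
  have one: "expect n M (\<lambda>s. complex_of_real c \<cdot>\<^sub>m 1\<^sub>m ?d) = c" for c
    using expect_smult[OF M, of "\<lambda>_. 1\<^sub>m ?d" c] expect_one[OF M] by simp
  have "real n + 2 * expect n M ?P = expect n M (\<lambda>s. complex_of_real (real n) \<cdot>\<^sub>m 1\<^sub>m ?d + complex_of_real 2 \<cdot>\<^sub>m ?P s)"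
    using P by (subst expect_add[OF M]) (auto simp: one expect_smult[OF M] simp del: of_real_numeral of_real_of_nat_eq)
  also have "\<dots> = expect n M (\<lambda>s. complex_of_real 2 \<cdot>\<^sub>m 1\<^sub>m ?d + (X s + (msum ?d (Z s) {2..n} + (Q1 s * mat_adjoint (Q1 s) + Q2 s * mat_adjoint (Q2 s)))))"
    by (intro expect_cong R)
  also have "\<dots> = 2 + (expect n M X + ((\<Sum>j\<in>{2..n}. expect n M (\<lambda>s. Z s j)) + (expect n M (\<lambda>s. Q1 s * mat_adjoint (Q1 s)) + expect n M (\<lambda>s. Q2 s * mat_adjoint (Q2 s)))))"
    using X Z cQ1 cQ2
    by (simp only: expect_add[OF M] expect_msum[OF M] one smult_carrier_mat one_carrier_mat add_carrier_mat msum_carrier finite_atLeastAtMost)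
  finally show ?thesis
    using expect_square[OF M Q1] expect_square[OF M Q2] unfolding corr_def X_def Z_def by simp
qed

text \<open>For two qubits the projector is exactly the average of the four elements of the
  stabilizer group, so the fidelity is a linear combination of correlators. The product of the two
  generators is kept as \<open>PZ * PX\<close> on each qubit, with sign exponent
  \<open>s 1 + s 2\<close>, which avoids the imaginary unit relating it to the third Pauli
  matrix.\<close>

lemma expect_ghz_2:
  assumes M: "povm 2 M"
  shows "4 * expect 2 M (\<lambda>s. projector (ghz 2 s)) = 1 + corr 2 M (\<lambda>s. s 1) (\<lambda>_. PX)
    + corr 2 M (\<lambda>s. s 2) (\<lambda>_. PZ) + corr 2 M (\<lambda>s. s 1 + s 2) (\<lambda>_. PZ * PX)"
proof -
  let ?d = "2 ^ 2 :: nat"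
  let ?T = "\<lambda>A. tensor 2 (\<lambda>_. A)"
  have Z: "?T PZ $$ (i, k) = (if i = k then (- 1) ^ (digit 2 i 1 + digit 2 i 2) else 0)" if "i < ?d" "k < ?d" for i k
  proof -
    have "?T PZ = tensor 2 (\<lambda>l. if l = 1 then PZ else if l = 2 then PZ else 1\<^sub>m 2)"
      by (rule tensor_cong) auto
    then show ?thesis using tensor_PZ_entry[OF that, of 2] by simp
  qed
  have ZX: "?T (PZ * PX) $$ (i, k) = (- 1) ^ (digit 2 i 1 + digit 2 i 2) * ?T PX $$ (i, k)" if ik: "i < ?d" "k < ?d" for i k
  proof -
    have "?T (PZ * PX) = ?T PZ * ?T PX" by (simp add: tensor_mult)
    then have "?T (PZ * PX) $$ (i, k) = (\<Sum>l<?d. if l = i then (- 1) ^ (digit 2 i 1 + digit 2 i 2) * ?T PX $$ (i, k) else 0)"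
      by (simp only: mult_entry[OF tensor_carrier tensor_carrier ik])
        (intro sum.cong refl, use ik in \<open>simp add: Z\<close>)
    then show ?thesis using ik by simp
  qed
  define Y where "Y s = (1\<^sub>m ?d + ((- 1) ^ s 1 \<cdot>\<^sub>m ?T PX + ((- 1) ^ s 2 \<cdot>\<^sub>m ?T PZ + (- 1) ^ (s 1 + s 2) \<cdot>\<^sub>m ?T (PZ * PX))))" for s :: "nat \<Rightarrow> nat"
  have P: "projector (ghz 2 s) \<in> carrier_mat ?d ?d" for s
    by (intro projector_carrier ghz_dim)
  have eq: "complex_of_real 4 \<cdot>\<^sub>m projector (ghz 2 s) = Y s" if s: "s \<in> bitstrings 2" for s
  proof (rule eq_matI, goal_cases)
    case (1 i k)
    then have ik: "i < ?d" "k < ?d" by (auto simp: Y_def tensor_def)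
    have m: "matching 2 s i \<longleftrightarrow> even (digit 2 i 1 + digit 2 i 2 + s 2)"
      by (simp add: matching_def)
    have pr: "projector (ghz 2 s) $$ (i, k) =
      (if matching 2 s i then ((if i = k then 1 else 0) + (- 1) ^ s 1 * ?T PX $$ (i, k)) / 2 else 0)"
      using projector_ghz_entry[OF _ s ik] tensor_PX_entry[OF ik] by simp
    have sgn: "(- 1 :: complex) ^ (digit 2 i 1 + digit 2 i 2) * (- 1) ^ s 2 = (if matching 2 s i then 1 else - 1)"
      unfolding m power_add[symmetric] by (simp add: uminus_power_if)
    have y: "Y s $$ (i, k) = (if i = k then 1 else 0) + ((- 1) ^ s 1 * ?T PX $$ (i, k)
        + ((- 1) ^ (digit 2 i 1 + digit 2 i 2) * (- 1) ^ s 2 * (if i = k then 1 else 0)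
          + (- 1) ^ (digit 2 i 1 + digit 2 i 2) * (- 1) ^ s 2 * ((- 1) ^ s 1 * ?T PX $$ (i, k))))"
      using ik carrier_matD[OF tensor_carrier]
      by (simp add: Y_def Z[OF ik] ZX[OF ik] power_add mult_ac)
    show ?case
      unfolding y sgn smult_entry[OF P ik] pr by (simp add: field_simps)
  qed (use P[of s] in \<open>auto simp: Y_def tensor_def\<close>)
  have "4 * expect 2 M (\<lambda>s. projector (ghz 2 s)) = expect 2 M (\<lambda>s. complex_of_real 4 \<cdot>\<^sub>m projector (ghz 2 s))"
    using P by (intro expect_smult[OF M, symmetric])
  also have "\<dots> = expect 2 M Y" by (intro expect_cong eq)
  also have "\<dots> = 1 + (corr 2 M (\<lambda>s. s 1) (\<lambda>_. PX) + (corr 2 M (\<lambda>s. s 2) (\<lambda>_. PZ) + corr 2 M (\<lambda>s. s 1 + s 2) (\<lambda>_. PZ * PX)))"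
    unfolding Y_def corr_def
    by (simp only: expect_add[OF M] expect_one[OF M] one_carrier_mat add_carrier_mat smult_carrier_mat tensor_carrier)
  finally show ?thesis by simp
qed

section \<open>Correlation inequalities\<close>

definition involutory :: "complex mat \<Rightarrow> bool" where
  "involutory A \<longleftrightarrow> A \<in> carrier_mat 2 2 \<and> mat_adjoint A = A \<and> A * A = 1\<^sub>m 2"

lemma involutory_sig: "norm v = 1 \<Longrightarrow> involutory (sig v)"
  by (simp add: involutory_def mat_adjoint_sig sig_square)

lemma involutory_one: "involutory (1\<^sub>m 2)"
proof -
  have "mat_adjoint (1\<^sub>m 2 :: complex mat) = 1\<^sub>m 2"
    by (rule mat2_eqI) (simp_all add: mat_adjoint_entry[where d = 2])
  then show ?thesis by (simp add: involutory_def)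
qed

lemma signed_tensor_involutory:
  assumes V: "\<And>k. k \<in> {1..n} \<Longrightarrow> involutory (V k)"
  shows "mat_adjoint ((- 1) ^ a \<cdot>\<^sub>m tensor n V) = (- 1) ^ a \<cdot>\<^sub>m tensor n V"
    and "((- 1) ^ a \<cdot>\<^sub>m tensor n V) * ((- 1) ^ a \<cdot>\<^sub>m tensor n V) = 1\<^sub>m (2 ^ n)"
proof -
  let ?d = "2 ^ n :: nat"
  have h: "mat_adjoint (tensor n V) = tensor n V"
    using V by (subst tensor_adjoint) (auto simp: involutory_def intro!: tensor_cong)
  have c: "c \<cdot>\<^sub>m tensor n V \<in> carrier_mat ?d ?d" for c by simp
  show "mat_adjoint ((- 1) ^ a \<cdot>\<^sub>m tensor n V) = (- 1) ^ a \<cdot>\<^sub>m tensor n V"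
  proof (rule eq_matI, goal_cases)
    case (1 i k)
    then have ik: "i < ?d" "k < ?d" by (auto simp: tensor_def)
    have "cnj (tensor n V $$ (k, i)) = tensor n V $$ (i, k)"
      using mat_adjoint_entry[OF tensor_carrier ik, of V] h by simp
    then show ?case
      unfolding mat_adjoint_entry[OF c ik] smult_entry[OF tensor_carrier ik] smult_entry[OF tensor_carrier ik(2,1)]
      by simp
  qed (auto simp: tensor_def mat_adjoint_def)
  have "tensor n V * tensor n V = tensor n (\<lambda>k. V k * V k)"
    using V by (intro tensor_mult) (auto simp: involutory_def)
  also have "\<dots> = tensor n (\<lambda>k. 1\<^sub>m 2)"
    using V by (intro tensor_cong) (auto simp: involutory_def)
  finally have sq: "tensor n V * tensor n V = 1\<^sub>m ?d" by simp
  have "((- 1) ^ a \<cdot>\<^sub>m tensor n V) * ((- 1) ^ a \<cdot>\<^sub>m tensor n V) = (- 1) ^ a \<cdot>\<^sub>m ((- 1) ^ a \<cdot>\<^sub>m (tensor n V * tensor n V))"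
    by (simp add: mult_smult_assoc_mat[OF tensor_carrier c] mult_smult_distrib[OF tensor_carrier tensor_carrier])
  also have "\<dots> = 1\<^sub>m ?d"
    unfolding sq by (rule eq_matI) (auto simp flip: power_add mult_2)
  finally show "((- 1) ^ a \<cdot>\<^sub>m tensor n V) * ((- 1) ^ a \<cdot>\<^sub>m tensor n V) = 1\<^sub>m ?d" .
qed

lemma corr_le_1:
  assumes M: "povm n M" and V: "\<And>k. k \<in> {1..n} \<Longrightarrow> involutory (V k)"
  shows "corr n M \<tau> V \<le> 1"
proof -
  have "mat_adjoint ((- 1) ^ a \<cdot>\<^sub>m tensor n V) = (- 1) ^ a \<cdot>\<^sub>m tensor n V"
    "((- 1) ^ a \<cdot>\<^sub>m tensor n V) * ((- 1) ^ a \<cdot>\<^sub>m tensor n V) = 1\<^sub>m (2 ^ n)" for a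
    by (rule signed_tensor_involutory, rule V, assumption)+
  then show ?thesis
    unfolding corr_def by (intro expect_involution_le_1[OF M] smult_carrier_mat tensor_carrier)
qed

text \<open>Anticommuting at sender 1 and commuting at all others makes the full products
  anticommute, whatever the outcome-dependent signs are.\<close>

lemma corr_anticommuting:
  assumes M: "povm n M" and n: "1 \<le> n" and c: "c\<^sup>2 + s\<^sup>2 = 1"
    and V: "\<And>k. k \<in> {1..n} \<Longrightarrow> involutory (V k)" and V': "\<And>k. k \<in> {1..n} \<Longrightarrow> involutory (V' k)"
    and ac: "V' 1 * V 1 = (- 1) \<cdot>\<^sub>m (V 1 * V' 1)"
    and com: "\<And>k. k \<in> {2..n} \<Longrightarrow> V' k * V k = V k * V' k"
  shows "c * corr n M \<tau> V + s * corr n M \<tau>' V' \<le> 1"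
proof -
  let ?d = "2 ^ n :: nat"
  have car: "V k \<in> carrier_mat 2 2" "V' k \<in> carrier_mat 2 2" if "k \<in> {1..n}" for k
    using V V' that by (auto simp: involutory_def)
  have prods: "V k * V' k \<in> carrier_mat 2 2" if "k \<in> {1..n}" for k
    using car[OF that] by (rule mult_carrier_mat)
  have "tensor n V' * tensor n V = tensor n (\<lambda>k. V' k * V k)"
    using car by (intro tensor_mult)
  \<comment> \<open>The sign is written as a scalar factor in every slot, so that
    \<open>tensor_scale\<close> collects it as a product over the slots.\<close>
  also have "\<dots> = tensor n (\<lambda>k. complex_of_real (if k = 1 then - 1 else 1) \<cdot>\<^sub>m (V k * V' k))"
  proof (rule tensor_cong)
    fix k assume k: "k \<in> {1..n}"
    show "V' k * V k = complex_of_real (if k = 1 then - 1 else 1) \<cdot>\<^sub>m (V k * V' k)"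
    proof (cases "k = 1")
      case True then show ?thesis using ac by simp
    next
      case False
      have "complex_of_real 1 \<cdot>\<^sub>m A = A" for A by (rule eq_matI) auto
      then show ?thesis using False com[of k] k by auto
    qed
  qed
  also have "\<dots> = complex_of_real (\<Prod>k\<in>{1..n}. if k = 1 then - 1 else 1) \<cdot>\<^sub>m tensor n (\<lambda>k. V k * V' k)"
    using prods by (rule tensor_scale)
  also have "(\<Prod>k\<in>{1..n}. if k = 1 then - 1 else 1 :: real) = - 1"
    using n by (simp add: prod.delta)
  also have "tensor n (\<lambda>k. V k * V' k) = tensor n V * tensor n V'"
    using car by (intro tensor_mult[symmetric])
  finally have T: "tensor n V' * tensor n V = (- 1) \<cdot>\<^sub>m (tensor n V * tensor n V')" by simp
  have car': "c \<cdot>\<^sub>m tensor n W \<in> carrier_mat ?d ?d" for c W by simp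
  have TT: "tensor n V * tensor n V' \<in> carrier_mat ?d ?d"
    by (rule mult_carrier_mat[OF tensor_carrier tensor_carrier])
  have inv: "mat_adjoint ((- 1) ^ a \<cdot>\<^sub>m tensor n V) = (- 1) ^ a \<cdot>\<^sub>m tensor n V"
    "((- 1) ^ a \<cdot>\<^sub>m tensor n V) * ((- 1) ^ a \<cdot>\<^sub>m tensor n V) = 1\<^sub>m ?d" for a
    by (rule signed_tensor_involutory, rule V, assumption)+
  have inv': "mat_adjoint ((- 1) ^ a \<cdot>\<^sub>m tensor n V') = (- 1) ^ a \<cdot>\<^sub>m tensor n V'"
    "((- 1) ^ a \<cdot>\<^sub>m tensor n V') * ((- 1) ^ a \<cdot>\<^sub>m tensor n V') = 1\<^sub>m ?d" for a
    by (rule signed_tensor_involutory, rule V', assumption)+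
  show ?thesis
    unfolding corr_def
  proof (rule expect_anticommuting[OF M c])
    fix b
    have "((- 1) ^ \<tau>' b \<cdot>\<^sub>m tensor n V') * ((- 1) ^ \<tau> b \<cdot>\<^sub>m tensor n V) = (- 1) ^ \<tau>' b \<cdot>\<^sub>m ((- 1) ^ \<tau> b \<cdot>\<^sub>m (tensor n V' * tensor n V))"
      by (simp add: mult_smult_assoc_mat[OF tensor_carrier car'] mult_smult_distrib[OF tensor_carrier tensor_carrier])
    moreover have "((- 1) ^ \<tau> b \<cdot>\<^sub>m tensor n V) * ((- 1) ^ \<tau>' b \<cdot>\<^sub>m tensor n V') = (- 1) ^ \<tau> b \<cdot>\<^sub>m ((- 1) ^ \<tau>' b \<cdot>\<^sub>m (tensor n V * tensor n V'))"
      by (simp add: mult_smult_assoc_mat[OF tensor_carrier car'] mult_smult_distrib[OF tensor_carrier tensor_carrier])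
    ultimately show "((- 1) ^ \<tau>' b \<cdot>\<^sub>m tensor n V') * ((- 1) ^ \<tau> b \<cdot>\<^sub>m tensor n V)
        = (- 1) \<cdot>\<^sub>m (((- 1) ^ \<tau> b \<cdot>\<^sub>m tensor n V) * ((- 1) ^ \<tau>' b \<cdot>\<^sub>m tensor n V'))"
      unfolding T using TT by (intro eq_matI) auto
  qed (rule inv inv' smult_carrier_mat[OF tensor_carrier])+
qed

section \<open>Transport of correlators into the Pauli frame\<close>

lemma conj_by_mult:
  assumes U: "U \<in> carrier_mat d d" and u: "U * mat_adjoint U = 1\<^sub>m d" and A: "A \<in> carrier_mat d d" and B: "B \<in> carrier_mat d d"
  shows "conj_by (mat_adjoint U) (A * B) = conj_by (mat_adjoint U) A * conj_by (mat_adjoint U) B"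
proof -
  have U': "mat_adjoint U \<in> carrier_mat d d" using U by simp
  have UB: "mat_adjoint U * B * U \<in> carrier_mat d d" using U U' B by (intro mult_carrier_mat[where n = d])
  have "mat_adjoint U * A * U * (mat_adjoint U * B * U) = mat_adjoint U * A * (U * mat_adjoint U) * B * U"
    using U U' A B UB by (simp add: assoc_mult_mat[of _ d d _ d _ d] mult_carrier_mat[of _ d d])
  also have "\<dots> = mat_adjoint U * (A * B) * U"
    unfolding u using U U' A B by (simp add: assoc_mult_mat[of _ d d _ d _ d] mult_carrier_mat[of _ d d])
  finally show ?thesis unfolding conj_by_def mat_adjoint_adjoint[OF U] by simp
qed

text \<open>\<open>P\<close> is an operator in the Pauli frame and \<open>V\<close> its counterpart
  for the directions \<open>x\<close>, \<open>z\<close>. A relation suits products whose slots hold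
  different kinds of operators; the last case serves the third stabilizer of two qubits.\<close>

definition pauli_pair :: "bloch \<Rightarrow> bloch \<Rightarrow> complex mat \<Rightarrow> complex mat \<Rightarrow> bool" where
  "pauli_pair x z P V \<longleftrightarrow> P = PX \<and> V = sig x \<or> P = PZ \<and> V = sig z \<or> P = 1\<^sub>m 2 \<and> V = 1\<^sub>m 2
    \<or> P = PZ * PX \<and> V = sig z * sig x"

text \<open>Rotating every qubit by the unitary of \<open>frame_unitary\<close> replaces measurement directions
  \<open>x k\<close>, \<open>z k\<close> by the Pauli directions, so bounds on \<open>M\<close> may be proved in the Pauli frame.\<close>

lemma frame_channel:
  assumes M: "povm n M" and f: "\<forall>k. norm (x k) = 1 \<and> norm (z k) = 1 \<and> inner (x k) (z k) = 0"
  shows "\<exists>L M'. local_channel n L \<and> povm n M' \<and> fidelity_at n M L = expect n M' (\<lambda>s. projector (ghz n s)) \<and>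
    (\<forall>\<tau> P V. (\<forall>k\<in>{1..n}. pauli_pair (x k) (z k) (P k) (V k)) \<longrightarrow> corr n M' \<tau> P = corr n M \<tau> V)"
proof -
  obtain U where U: "\<And>k. U k \<in> carrier_mat 2 2" "\<And>k. U k * mat_adjoint (U k) = 1\<^sub>m 2" "\<And>k. mat_adjoint (U k) * U k = 1\<^sub>m 2"
    "\<And>k. conj_by (mat_adjoint (U k)) PX = sig (x k)" "\<And>k. conj_by (mat_adjoint (U k)) PZ = sig (z k)"
  proof -
    have "\<forall>k. \<exists>U. U \<in> carrier_mat 2 2 \<and> U * mat_adjoint U = 1\<^sub>m 2 \<and> mat_adjoint U * U = 1\<^sub>m 2 \<and>
      conj_by (mat_adjoint U) PX = sig (x k) \<and> conj_by (mat_adjoint U) PZ = sig (z k)"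
      using frame_unitary f by blast
    from choice[OF this] show ?thesis using that by blast
  qed
  let ?M = "\<lambda>s. conj_by (tensor n U) (M s)"
  have one: "conj_by (mat_adjoint (U k)) (1\<^sub>m 2) = 1\<^sub>m 2" for k
    using U(1,3)[of k] by (simp add: conj_by_def mat_adjoint_adjoint[OF U(1)] right_mult_one_mat[OF mat_adjoint_carrier[OF U(1)]])
  have zx: "conj_by (mat_adjoint (U k)) (PZ * PX) = sig (z k) * sig (x k)" for k
    using U(4,5)[of k] by (simp add: conj_by_mult[OF U(1,2)])
  have "local_channel n (\<lambda>k. conj_by (U k))"
    unfolding local_channel_def using channel_conj_by U by blast
  moreover have "povm n ?M"
  proof (rule povm_conj_by[OF M tensor_carrier])
    have "tensor n U * mat_adjoint (tensor n U) = tensor n (\<lambda>k. 1\<^sub>m 2)"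
      using U by (simp add: tensor_adjoint tensor_mult)
    then show "tensor n U * mat_adjoint (tensor n U) = 1\<^sub>m (2 ^ n)" by simp
  qed
  moreover have "fidelity_at n M (\<lambda>k. conj_by (U k)) = expect n ?M (\<lambda>s. projector (ghz n s))"
    using U by (intro fidelity_at_conj_by[OF M])
  moreover have "corr n ?M \<tau> P = corr n M \<tau> V"
    if PV: "\<forall>k\<in>{1..n}. pauli_pair (x k) (z k) (P k) (V k)" for \<tau> P V
  proof -
    have car: "P k \<in> carrier_mat 2 2" if "k \<in> {1..n}" for k
      using PV that mult_carrier_mat[OF sig_carrier sig_carrier] unfolding pauli_pair_def
      by (metis one_carrier_mat sig_carrier)
    have "corr n ?M \<tau> P = corr n M \<tau> (\<lambda>k. conj_by (mat_adjoint (U k)) (P k))"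
      using U(1) car by (rule corr_conj_by[OF M])
    also have "\<dots> = corr n M \<tau> V"
    proof (rule corr_cong)
      fix k assume "k \<in> {1..n}"
      then show "conj_by (mat_adjoint (U k)) (P k) = V k"
        using PV U(4,5)[of k] one[of k] zx[of k] unfolding pauli_pair_def by (elim ballE disjE) auto
    qed
    finally show ?thesis .
  qed
  ultimately show ?thesis by blast
qed

section \<open>Robustness for every number of senders\<close>

text \<open>Here \<open>a\<close>, \<open>b\<close> are the weights \<open>ca\<close>,
  \<open>sa\<close> and \<open>x\<close>, \<open>y\<close> two correlators. Near-optimality forces
  the weights to be nearly equal, so both are bounded away from 0 and the joint deficit
  \<open>a * (1 - x) + b * (1 - y) \<le> sqrt 2 * e\<close> controls each correlator.\<close>

lemma near_optimal_angles:
  fixes a b x y e :: real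
  assumes ab: "0 \<le> a" "0 \<le> b" "a\<^sup>2 + b\<^sup>2 = 1" and xy: "x \<le> 1" "y \<le> 1"
    and le: "sqrt 2 * (1 - e) \<le> a * x + b * y" and e: "e \<le> 1 / 40"
  shows "1 - x \<le> 5 * e" "1 - y \<le> 5 * e" "0 \<le> e"
proof -
  have s2: "sqrt 2 * sqrt 2 = (2::real)" "0 < sqrt (2::real)" by simp_all
  have s3: "sqrt 2 \<le> (3 / 2 :: real)" by (rule real_le_lsqrt) (simp_all add: power2_eq_square)
  have ax: "a * x \<le> a" "b * y \<le> b" using ab xy by (simp_all add: mult_left_le)
  have p: "sqrt 2 * (1 - e) \<le> a + b" using le ax by linarith
  have "(a + b)\<^sup>2 \<le> 2"
    using ab(3) sum_squares_bound[of a b] by (simp add: power2_sum)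
  then have ub: "a + b \<le> sqrt 2" by (rule real_le_rsqrt)
  have "sqrt 2 * (1 - e) \<le> sqrt 2 * 1" using p ub by linarith
  then show e0: "0 \<le> e" using s2(2) by simp
  have "sqrt 2 * (39 / 40) \<le> sqrt 2 * (1 - e)" using e s2 by (intro mult_left_mono) auto
  then have "sqrt 2 * (39 / 40) \<le> a + b" using p by linarith
  then have "(sqrt 2 * (39 / 40))\<^sup>2 \<le> (a + b)\<^sup>2" using s2 by (intro power_mono) auto
  moreover have "(sqrt 2 * (39 / 40))\<^sup>2 = (1521 / 800 :: real)"
    by (simp add: power_mult_distrib power2_eq_square)
  moreover have "(a + b)\<^sup>2 = 1 + 2 * (a * b)" using ab(3) by (simp add: power2_sum)
  \<comment> \<open>From \<open>1 + 2 * (a * b) \<ge> 1521/800\<close> one gets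
    \<open>a * b \<ge> 721/1600\<close>, just above \<open>9/20\<close>.\<close>
  ultimately have ab2: "9 / 20 \<le> a * b" by linarith
  have "a\<^sup>2 \<le> 1\<^sup>2" "b\<^sup>2 \<le> 1\<^sup>2" using ab(3) zero_le_power2[of a] zero_le_power2[of b] by (simp_all, linarith+)
  then have "a \<le> 1" "b \<le> 1" using power2_le_imp_le[of a 1] power2_le_imp_le[of b 1] by simp_all
  then have "a * b \<le> a" "a * b \<le> b" using ab mult_left_le[of b a] mult_left_le[of a b] by (simp_all add: mult.commute)
  then have lb: "9 / 20 \<le> a" "9 / 20 \<le> b" using ab2 by linarith+
  have "a * (1 - x) + b * (1 - y) \<le> sqrt 2 * e"
    using le ub by (simp add: algebra_simps)
  moreover have "sqrt 2 * e \<le> 3 / 2 * e" using e0 s3 by (intro mult_right_mono) auto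
  moreover have "9 / 20 * (1 - x) \<le> a * (1 - x)" "9 / 20 * (1 - y) \<le> b * (1 - y)"
    using lb xy by (intro mult_right_mono; simp)+
  moreover have "0 \<le> a * (1 - x)" "0 \<le> b * (1 - y)" using ab xy by simp_all
  ultimately have "9 / 20 * (1 - x) \<le> 3 / 2 * e" and "9 / 20 * (1 - y) \<le> 3 / 2 * e" by linarith+
  \<comment> \<open>Division by \<open>9/20\<close> gives \<open>10/3 * e\<close>, rounded up to
    \<open>5 * e\<close>.\<close>
  then show "1 - x \<le> 5 * e" and "1 - y \<le> 5 * e" using e0 by (simp_all add: algebra_simps)
qed

text \<open>The variables stand for correlators: \<open>x\<close> for the product of all
  \<open>X\<close>, \<open>h\<close> and \<open>g\<close> for \<open>Z_1 X_j\<close> and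
  \<open>Z_1 Z_j\<close>, and \<open>y = c * h + s * g\<close> for the actual second observable of
  sender \<open>j\<close>. As \<open>x\<close> is near 1, \<open>h\<close> is small, and
  Cauchy-Schwarz in the form \<open>y^2 \<le> h^2 + g^2\<close> leaves
  \<open>g^2 \<ge> x^2 + y^2 - 1\<close>.\<close>

lemma near_optimal_stabilizer:
  fixes x y c s g h e :: real
  assumes x: "x \<le> 1" "1 - x \<le> 5 * e" and y: "y \<le> 1" "1 - y \<le> 5 * e" and e: "0 \<le> e" "e \<le> 1 / 40"
    and cs: "c\<^sup>2 + s\<^sup>2 = 1" "0 \<le> s" and yd: "y = c * h + s * g" and xh: "x\<^sup>2 + h\<^sup>2 \<le> 1" and g: "g \<le> 1"
  shows "1 - 20 * e \<le> g"
proof -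
  have b: "1 - 5 * e \<ge> 7 / 8" using e by simp
  have sq: "(1 - 5 * e)\<^sup>2 \<le> x\<^sup>2" "(1 - 5 * e)\<^sup>2 \<le> y\<^sup>2"
    using x y b by (auto intro!: power_mono)
  have sq': "1 - 10 * e \<le> (1 - 5 * e)\<^sup>2" by (simp add: power2_eq_square algebra_simps)
  have "(h\<^sup>2 + g\<^sup>2) * (c\<^sup>2 + s\<^sup>2) = (c * h + s * g)\<^sup>2 + (c * g - s * h)\<^sup>2"
    by (simp add: power2_eq_square algebra_simps)
  then have "y\<^sup>2 \<le> h\<^sup>2 + g\<^sup>2" using cs yd by simp
  then have g2: "x\<^sup>2 + y\<^sup>2 - 1 \<le> g\<^sup>2" using xh by linarith
  \<comment> \<open>The square does not determine the sign of \<open>g\<close>. A negative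
    \<open>g\<close> would, as \<open>0 \<le> s\<close>, leave \<open>y \<le> \<bar>h\<bar>\<close>
    and so \<open>x^2 + y^2 \<le> 1\<close>, although \<open>x\<close> and \<open>y\<close> are both
    near 1.\<close>
  have "0 \<le> g"
  proof (rule ccontr)
    assume "\<not> 0 \<le> g"
    then have "s * g \<le> 0" using cs by (simp add: mult_nonneg_nonpos)
    then have "y \<le> c * h" using yd by linarith
    also have "\<dots> \<le> \<bar>h\<bar>"
    proof -
      have "c\<^sup>2 \<le> 1" using cs zero_le_power2[of s] by linarith
      then have "\<bar>c\<bar> \<le> 1" by (simp add: abs_square_le_1)
      then have "\<bar>c\<bar> * \<bar>h\<bar> \<le> 1 * \<bar>h\<bar>" by (intro mult_right_mono) auto
      then show ?thesis using abs_ge_self[of "c * h"] by (simp add: abs_mult)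
    qed
    finally have "y\<^sup>2 \<le> \<bar>h\<bar>\<^sup>2" using y b by (intro power_mono) auto
    then show False using xh sq sq' e by simp
  qed
  then have "g\<^sup>2 \<le> g" using g by (simp add: power2_eq_square mult_left_le)
  then show ?thesis using g2 sq sq' by linarith
qed

text \<open>Choosing \<open>(c, s)\<close> parallel to \<open>(x, h)\<close> makes the linear form
  equal to the length \<open>r\<close>. This turns the linear uncertainty relation into a quadratic
  one.\<close>

lemma sum_squares_le_1:
  fixes x h :: real
  assumes "\<And>c s. c\<^sup>2 + s\<^sup>2 = 1 \<Longrightarrow> c * x + s * h \<le> 1"
  shows "x\<^sup>2 + h\<^sup>2 \<le> 1"
proof -
  define r where "r = sqrt (x\<^sup>2 + h\<^sup>2)"
  have r: "r\<^sup>2 = x\<^sup>2 + h\<^sup>2" "0 \<le> r" by (simp_all add: r_def)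
  have "r \<le> 1"
  proof (cases "r = 0")
    case False
    have "(x / r)\<^sup>2 + (h / r)\<^sup>2 = (x\<^sup>2 + h\<^sup>2) / r\<^sup>2"
      by (simp only: power_divide add_divide_distrib)
    also have "\<dots> = r\<^sup>2 / r\<^sup>2" using r(1) by simp
    finally have "(x / r)\<^sup>2 + (h / r)\<^sup>2 = r\<^sup>2 / r\<^sup>2" .
    then have "(x / r)\<^sup>2 + (h / r)\<^sup>2 = 1" using False by simp
    then have "x / r * x + h / r * h \<le> 1" by (rule assms)
    also have "x / r * x + h / r * h = r\<^sup>2 / r"
      unfolding r(1) by (simp add: power2_eq_square add_divide_distrib)
    finally show ?thesis using False by (simp add: power2_eq_square)
  qed simp
  from power_le_one[OF r(2) this, of 2] show ?thesis unfolding r(1) .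
qed

text \<open>The remainder \<open>v - c *\<^sub>R u\<close> is orthogonal to \<open>u\<close>;
  \<open>orthogonal_frame\<close> normalises it and supplies an orthogonal direction if it vanishes.
  The orientation with \<open>0 \<le> s\<close> fixes the sign of the \<open>Z\<close> direction of
  a sender, on which \<open>near_optimal_stabilizer\<close> relies.\<close>

lemma gram_schmidt_unit:
  fixes u v :: bloch
  assumes "norm u = 1" "norm v = 1"
  shows "\<exists>w c s. norm w = 1 \<and> inner u w = 0 \<and> v = c *\<^sub>R u + s *\<^sub>R w \<and> 0 \<le> s \<and> c\<^sup>2 + s\<^sup>2 = (1 :: real)"
proof -
  define c where "c = inner u v"
  have uu: "inner u u = 1" "inner v v = 1" using assms by (simp_all add: norm_eq_1)
  have "inner u (v - c *\<^sub>R u) = 0" by (simp add: inner_diff_right uu c_def)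
  from orthogonal_frame[OF this]
  obtain x w where w: "norm x = 1" "norm w = 1" "inner x w = 0" "u = norm u *\<^sub>R x" "v - c *\<^sub>R u = norm (v - c *\<^sub>R u) *\<^sub>R w"
    by blast
  define s where "s = norm (v - c *\<^sub>R u)"
  have "s\<^sup>2 = 1 - c\<^sup>2"
    unfolding s_def power2_norm_eq_inner
    by (simp add: inner_diff_left inner_diff_right uu inner_commute[of v u] power2_eq_square flip: c_def)
  moreover have "v = c *\<^sub>R u + s *\<^sub>R w" using w(5) unfolding s_def by (metis add.commute diff_add_cancel)
  moreover have "inner u w = 0" using w(3,4) assms by simp
  moreover have "0 \<le> s" by (simp add: s_def)
  ultimately have "norm w = 1 \<and> inner u w = 0 \<and> v = c *\<^sub>R u + s *\<^sub>R w \<and> 0 \<le> s \<and> c\<^sup>2 + s\<^sup>2 = 1"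
    using w(2) by (intro conjI) simp_all
  then show ?thesis by blast
qed

text \<open>The frame of sender 1 is \<open>(x, z)\<close>, that of sender \<open>j\<close> comes
  from its two directions by Gram-Schmidt. For \<open>e = (n - 1) * \<epsilon>\<close> at most
  \<open>1/40\<close>, the product of all \<open>X\<close> loses at most \<open>5 * e\<close> and
  each \<open>Z_1 Z_j\<close> at most \<open>20 * e\<close>, and the union bound gives the claim
  with room to spare.\<close>

lemma robustness:
  assumes M: "povm n M" and n: "2 \<le> n" and q: "qubit_states n \<rho>" and S: "1 - \<epsilon> \<le> success n \<rho> M"
  shows "\<exists>L. local_channel n L \<and> 1 - 40 * (real n - 1)\<^sup>2 * \<epsilon> \<le> fidelity_at n M L"
proof -
  define N where "N = real n - 1"
  have N: "1 \<le> N" using n by (simp add: N_def)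
  have n1: "1 \<le> n" using n by simp
  define e where "e = N * \<epsilon>"
  obtain x z ca sa u v where
    xz: "norm x = 1" "norm z = 1" "inner x z = 0" and cs: "0 \<le> ca" "0 \<le> sa" "ca\<^sup>2 + sa\<^sup>2 = (1::real)"
    and uv: "\<And>k. norm (u k) = 1" "\<And>k. norm (v k) = 1"
    and S': "N * sqrt 2 * success n \<rho> M
      \<le> N * ca * corr n M (\<lambda>s. s 1) (\<lambda>k. if k = 1 then sig x else sig (u k))
        + (\<Sum>j\<in>{2..n}. sa * corr n M (\<lambda>s. s j) (\<lambda>k. if k = 1 then sig z else if k = j then sig (v j) else 1\<^sub>m 2))"
    using success_le_unit[OF M n q] unfolding N_def by blast
  have "\<forall>k. \<exists>w. \<exists>c s. norm w = 1 \<and> inner (u k) w = 0 \<and> v k = c *\<^sub>R u k + s *\<^sub>R w \<and> 0 \<le> s \<and> c\<^sup>2 + s\<^sup>2 = (1 :: real)"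
    using gram_schmidt_unit[OF uv] by blast
  from choice[OF this] obtain w where "\<forall>k. \<exists>c s. norm (w k) = 1 \<and> inner (u k) (w k) = 0 \<and> v k = c *\<^sub>R u k + s *\<^sub>R w k \<and> 0 \<le> s \<and> c\<^sup>2 + s\<^sup>2 = (1 :: real)"
    by blast
  then obtain c s where w: "\<And>k. norm (w k) = 1" "\<And>k. inner (u k) (w k) = 0" "\<And>k. v k = c k *\<^sub>R u k + s k *\<^sub>R w k"
    "\<And>k. 0 \<le> s k" "\<And>k. (c k)\<^sup>2 + (s k)\<^sup>2 = (1 :: real)"
    by metis
  define fx where "fx k = (if k = 1 then x else u k)" for k :: nat
  define fz where "fz k = (if k = 1 then z else w k)" for k :: nat
  have "\<forall>k. norm (fx k) = 1 \<and> norm (fz k) = 1 \<and> inner (fx k) (fz k) = 0"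
    using xz uv w by (simp_all add: fx_def fz_def)
  from frame_channel[OF M this] obtain L M' where L: "local_channel n L" and M': "povm n M'"
    and F: "fidelity_at n M L = expect n M' (\<lambda>s. projector (ghz n s))"
    and tr: "\<And>\<tau> P V. (\<forall>k\<in>{1..n}. pauli_pair (fx k) (fz k) (P k) (V k)) \<Longrightarrow> corr n M' \<tau> P = corr n M \<tau> V"
    by blast
  have "norm (1 :: real, 0 :: real, 0 :: real) = 1" "norm (0 :: real, 0 :: real, 1 :: real) = 1"
    by (simp_all add: norm_eq_1)
  then have invol: "involutory PX" "involutory PZ" by (simp_all add: involutory_sig)
  have ac: "PZ * PX = (- 1) \<cdot>\<^sub>m (PX * PZ)" by (rule sig_anticommute) simp
  define X where "X = corr n M' (\<lambda>s. s 1) (\<lambda>_. PX)"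
  define g where "g j = corr n M' (\<lambda>s. s j) (\<lambda>k. if k = 1 then PZ else if k = j then PZ else 1\<^sub>m 2)" for j
  define h where "h j = corr n M' (\<lambda>s. s j) (\<lambda>k. if k = 1 then PZ else if k = j then PX else 1\<^sub>m 2)" for j
  define G where "G j = corr n M (\<lambda>s. s j) (\<lambda>k. if k = 1 then sig z else if k = j then sig (v j) else 1\<^sub>m 2)" for j
  have X: "X = corr n M (\<lambda>s. s 1) (\<lambda>k. if k = 1 then sig x else sig (u k))"
    unfolding X_def by (rule tr) (simp add: pauli_pair_def fx_def)
  have G: "G j = c j * h j + s j * g j" if j: "j \<in> {2..n}" for j
  proof -
    have "h j = corr n M (\<lambda>s. s j) (\<lambda>k. if k = 1 then sig z else if k = j then sig (u j) else 1\<^sub>m 2)"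
      unfolding h_def by (rule tr) (simp add: pauli_pair_def fx_def fz_def)
    moreover have "g j = corr n M (\<lambda>s. s j) (\<lambda>k. if k = 1 then sig z else if k = j then sig (w j) else 1\<^sub>m 2)"
      unfolding g_def by (rule tr) (simp add: pauli_pair_def fz_def)
    ultimately show ?thesis
      unfolding G_def w(3)[of j] by (simp only: corr_second_linear[OF M j])
  qed
  have X1: "X \<le> 1" unfolding X_def by (intro corr_le_1[OF M'] invol)
  have g1: "g j \<le> 1" for j unfolding g_def by (intro corr_le_1[OF M']) (simp add: invol involutory_one)
  have G1: "G j \<le> 1" for j
    unfolding G_def by (intro corr_le_1[OF M]) (simp add: involutory_one involutory_sig xz uv)
  have Xh: "X\<^sup>2 + (h j)\<^sup>2 \<le> 1" if j: "j \<in> {2..n}" for j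
  proof (rule sum_squares_le_1)
    fix a b :: real assume ab: "a\<^sup>2 + b\<^sup>2 = 1"
    show "a * X + b * h j \<le> 1"
      unfolding X_def h_def
      by (rule corr_anticommuting[OF M' n1 ab])
        (use invol involutory_one ac in \<open>simp_all add: left_mult_one_mat[OF sig_carrier] right_mult_one_mat[OF sig_carrier]\<close>)
  qed
  have F0: "0 \<le> fidelity_at n M L" unfolding F by (rule expect_projector_nonneg[OF M'])
  have sum: "N * sqrt 2 * (1 - \<epsilon>) \<le> (\<Sum>j\<in>{2..n}. ca * X + sa * G j)"
  proof -
    have "N * sqrt 2 * (1 - \<epsilon>) \<le> N * sqrt 2 * success n \<rho> M" using N S by (intro mult_left_mono) auto
    also have "\<dots> \<le> N * ca * X + (\<Sum>j\<in>{2..n}. sa * G j)" using S' unfolding X G_def .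
    also have "\<dots> = (\<Sum>j\<in>{2..n}. ca * X + sa * G j)"
      using n by (simp add: sum.distrib N_def of_nat_diff)
    finally show ?thesis .
  qed
  have le2: "ca * X + sa * G j \<le> sqrt 2" for j
  proof -
    have "(ca + sa)\<^sup>2 \<le> 2" using cs(3) sum_squares_bound[of ca sa] by (simp add: power2_sum)
    then have "ca + sa \<le> sqrt 2" by (rule real_le_rsqrt)
    moreover have "ca * X \<le> ca" "sa * G j \<le> sa" using cs X1 G1[of j] by (simp_all add: mult_left_le)
    ultimately show ?thesis by linarith
  qed
  \<comment> \<open>Since no term exceeds \<open>sqrt 2\<close>, the deficit of one term is at most
    that of the sum; this is where \<open>\<epsilon>\<close> becomes
    \<open>e = N * \<epsilon>\<close>.\<close>
  have each: "sqrt 2 * (1 - e) \<le> ca * X + sa * G j" if j: "j \<in> {2..n}" for j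
  proof -
    have "sqrt 2 - (ca * X + sa * G j) \<le> (\<Sum>j\<in>{2..n}. sqrt 2 - (ca * X + sa * G j))"
      using j le2 by (intro member_le_sum) auto
    also have "\<dots> = N * sqrt 2 - (\<Sum>j\<in>{2..n}. ca * X + sa * G j)"
      using n by (simp add: sum_subtractf N_def of_nat_diff)
    also have "\<dots> \<le> N * sqrt 2 - N * sqrt 2 * (1 - \<epsilon>)" using sum by simp
    also have "\<dots> = sqrt 2 * e" by (simp add: e_def algebra_simps)
    finally show ?thesis by (simp add: algebra_simps)
  qed
  have goal: "1 - 40 * N\<^sup>2 * \<epsilon> \<le> fidelity_at n M L"
  \<comment> \<open>Outside the range of \<open>near_optimal_angles\<close> the claimed bound is
    nonpositive; the factor 40 is the reciprocal of this threshold.\<close>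
  proof (cases "e \<le> 1 / 40")
    case False
    then have "1 / 40 * 1 \<le> e * N" using N by (intro mult_mono) auto
    then have "1 \<le> 40 * N\<^sup>2 * \<epsilon>" by (simp add: e_def power2_eq_square mult_ac)
    then show ?thesis using F0 by linarith
  next
    case e: True
    note ang = near_optimal_angles[OF cs X1 G1 each e]
    have e0: "0 \<le> e" and X5: "1 - X \<le> 5 * e" using ang(1,3)[of 2] n by auto
    have "1 - 20 * e \<le> g j" if j: "j \<in> {2..n}" for j
      using near_optimal_stabilizer[OF X1 X5 G1 ang(2)[OF j] e0 e w(5,4) G[OF j] Xh[OF j] g1] .
    then have "(\<Sum>j\<in>{2..n}. 1 - 20 * e) \<le> (\<Sum>j\<in>{2..n}. g j)" by (intro sum_mono)
    then have gs: "N * (1 - 20 * e) \<le> (\<Sum>j\<in>{2..n}. g j)" using n by (simp add: N_def of_nat_diff)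
    have ub: "2 + X + (\<Sum>j\<in>{2..n}. g j) \<le> real n + 2 * fidelity_at n M L"
      using expect_ghz_union_bound[OF M' n] unfolding X_def g_def F .
    have "e * 1 \<le> e * N" using e0 N by (intro mult_left_mono)
    moreover have "N * (1 - 20 * e) = N - 20 * (e * N)" by (simp add: algebra_simps)
    moreover have "real n = N + 1" by (simp add: N_def)
    \<comment> \<open>The losses \<open>5 * e\<close> and \<open>20 * (e * N)\<close> add up to at
      most \<open>25 * (e * N)\<close> because \<open>1 \<le> N\<close>.\<close>
    ultimately have "2 - 25 * (e * N) \<le> 2 * fidelity_at n M L" using ub gs X5 by linarith
    moreover have "0 \<le> e * N" using e0 N by simp
    ultimately have "1 - 40 * (e * N) \<le> fidelity_at n M L" by linarith
    then show ?thesis by (simp add: e_def power2_eq_square mult_ac)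
  qed
  then show ?thesis using L unfolding N_def by blast
qed

section \<open>The explicit bound for two senders\<close>

text \<open>The product of two vectors in the plane of \<open>f1\<close>, \<open>f2\<close> splits
  into their inner product and their oriented area, the latter multiplying
  \<open>sig f2 * sig f1\<close>. For an orthonormal pair only the orientation survives.\<close>

lemma sig_rotation_mult:
  assumes f: "norm f1 = 1" "norm f2 = 1" "inner f1 f2 = 0"
  shows "sig (a *\<^sub>R f1 + b *\<^sub>R f2) * sig (c *\<^sub>R f1 + d *\<^sub>R f2)
    = complex_of_real (a * c + b * d) \<cdot>\<^sub>m 1\<^sub>m 2 + complex_of_real (b * c - a * d) \<cdot>\<^sub>m (sig f2 * sig f1)"
    (is "?L = ?R")
proof -
  let ?S = "sig f1" and ?T = "sig f2"
  have TS: "?T * ?S \<in> carrier_mat 2 2" by (rule mult_carrier_mat[OF sig_carrier sig_carrier])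
  have ent: "sig (a *\<^sub>R f1 + b *\<^sub>R f2) $$ (i, k) = complex_of_real a * ?S $$ (i, k) + complex_of_real b * ?T $$ (i, k)"
    if "i < 2" "k < 2" for a b i k
    using that by (simp add: sig_linear sig_dim)
  have "?L $$ (i, k) = ?R $$ (i, k)" if ik: "i < 2" "k < 2" for i k
  proof -
    have ik': "(0::nat) < 2" "Suc 0 < (2::nat)" by simp_all
    note m = mult_entry_2[OF sig_carrier sig_carrier ik]
    have SS: "?S $$ (i, 0) * ?S $$ (0, k) + ?S $$ (i, Suc 0) * ?S $$ (Suc 0, k) = (if i = k then 1 else 0)"
      using m[of f1 f1] sig_square[OF f(1)] ik by simp
    have TT: "?T $$ (i, 0) * ?T $$ (0, k) + ?T $$ (i, Suc 0) * ?T $$ (Suc 0, k) = (if i = k then 1 else 0)"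
      using m[of f2 f2] sig_square[OF f(2)] ik by simp
    have ST: "?S $$ (i, 0) * ?T $$ (0, k) + ?S $$ (i, Suc 0) * ?T $$ (Suc 0, k) = - (?T * ?S) $$ (i, k)"
      using m[of f1 f2] sig_anticommute[OF f(3)] smult_entry[OF TS ik, of "- 1"] by simp
    have "?L $$ (i, k) = complex_of_real a * complex_of_real c * (?S $$ (i, 0) * ?S $$ (0, k) + ?S $$ (i, Suc 0) * ?S $$ (Suc 0, k))
        + complex_of_real b * complex_of_real d * (?T $$ (i, 0) * ?T $$ (0, k) + ?T $$ (i, Suc 0) * ?T $$ (Suc 0, k))
        + complex_of_real a * complex_of_real d * (?S $$ (i, 0) * ?T $$ (0, k) + ?S $$ (i, Suc 0) * ?T $$ (Suc 0, k))
        + complex_of_real b * complex_of_real c * (?T * ?S) $$ (i, k)"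
      unfolding m ent[OF ik(1) ik'(1)] ent[OF ik(1) ik'(2)] ent[OF ik'(1) ik(2)] ent[OF ik'(2) ik(2)]
      by (simp add: algebra_simps)
    also have "\<dots> = ?R $$ (i, k)"
      unfolding SS TT ST using ik
      by (simp add: add_entry[OF smult_carrier_mat[OF one_carrier_mat] smult_carrier_mat[OF TS] ik] smult_entry[OF TS ik]
        algebra_simps del: index_mult_mat index_add_mat index_smult_mat(1)) (simp add: algebra_simps)
    finally show ?thesis .
  qed
  moreover have "?L \<in> carrier_mat 2 2" by (rule mult_carrier_mat[OF sig_carrier sig_carrier])
  moreover have "?R \<in> carrier_mat 2 2" by (rule add_carrier_mat[OF smult_carrier_mat[OF TS]])
  ultimately show ?thesis by (intro mat2_eqI) auto
qed

text \<open>A singular value decomposition of the matrix with columns \<open>p\<close>,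
  \<open>q\<close>: \<open>f1\<close>, \<open>f2\<close> are left singular vectors,
  \<open>t1\<close>, \<open>t2\<close> the singular values, and the rotation given by
  \<open>c\<close>, \<open>s\<close> acts on the right.\<close>

lemma principal_axes:
  fixes p q :: bloch
  shows "\<exists>f1 f2 t1 t2 c s. norm f1 = 1 \<and> norm f2 = 1 \<and> inner f1 f2 = 0 \<and> c\<^sup>2 + s\<^sup>2 = (1::real) \<and>
    0 \<le> t2 \<and> t2 \<le> t1 \<and> t1\<^sup>2 + t2\<^sup>2 = (norm p)\<^sup>2 + (norm q)\<^sup>2 \<and>
    p = (t1 * c) *\<^sub>R f1 + (- (t2 * s)) *\<^sub>R f2 \<and> q = (t1 * s) *\<^sub>R f1 + (t2 * c) *\<^sub>R f2"
proof -
  define D where "D = inner p p - inner q q"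
  define E where "E = 2 * inner p q"
  define r where "r = cmod (Complex D E)"
  \<comment> \<open>The Jacobi angle: rotating \<open>p\<close>, \<open>q\<close> by half the
    argument of \<open>D + \<i> E\<close> makes the inner product vanish and turns the difference of
    squared norms into the modulus \<open>r\<close>, whose nonnegativity yields
    \<open>t2 \<le> t1\<close>. The polar form covers \<open>D = E = 0\<close> as well.\<close>
  define \<theta> where "\<theta> = Arg (Complex D E) / 2"
  have r: "0 \<le> r" by (simp add: r_def)
  have "Complex D E = rcis r (2 * \<theta>)" by (simp add: r_def \<theta>_def rcis_cmod_Arg)
  then have D: "D = r * cos (2 * \<theta>)" and E: "E = r * sin (2 * \<theta>)"
    by (metis Re_rcis complex.sel(1), metis Im_rcis complex.sel(2))
  define c where "c = cos \<theta>"
  define s where "s = sin \<theta>"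
  have cs: "c\<^sup>2 + s\<^sup>2 = 1" by (simp add: c_def s_def)
  have c2: "cos (2 * \<theta>) = c * c - s * s" "sin (2 * \<theta>) = 2 * s * c"
    by (simp_all add: c_def s_def cos_double sin_double power2_eq_square)
  define p' where "p' = c *\<^sub>R p + s *\<^sub>R q"
  define q' where "q' = c *\<^sub>R q - s *\<^sub>R p"
  have i1: "inner p' q' = (c * c - s * s) * (E / 2) - c * s * D"
    by (simp add: p'_def q'_def D_def E_def inner_add_left inner_diff_right inner_commute[of q p] algebra_simps)
  have ip: "inner p' q' = 0" unfolding i1 D E c2 by (simp add: algebra_simps)
  have "inner p' p' - inner q' q' = (c * c - s * s) * D + 2 * s * c * E"
    by (simp add: p'_def q'_def D_def E_def inner_add_left inner_add_right inner_diff_left inner_diff_right inner_commute[of q p] algebra_simps)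
  also have "\<dots> = r * ((cos (2 * \<theta>))\<^sup>2 + (sin (2 * \<theta>))\<^sup>2)"
    unfolding D E c2[symmetric] by (simp only: power2_eq_square distrib_left mult_ac)
  finally have "inner q' q' \<le> inner p' p'" using r by simp
  then have le: "norm q' \<le> norm p'" by (simp add: norm_eq_sqrt_inner)
  have "inner p' p' + inner q' q' = (c * c + s * s) * (inner p p + inner q q)"
    by (simp add: p'_def q'_def inner_add_left inner_add_right inner_diff_left inner_diff_right inner_commute[of q p] algebra_simps)
  then have n2: "(norm p')\<^sup>2 + (norm q')\<^sup>2 = (norm p)\<^sup>2 + (norm q)\<^sup>2"
    using cs by (simp add: power2_norm_eq_inner power2_eq_square[of c] power2_eq_square[of s])
  obtain f1 f2 where f: "norm f1 = 1" "norm f2 = 1" "inner f1 f2 = 0" "p' = norm p' *\<^sub>R f1" "q' = norm q' *\<^sub>R f2"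
    using orthogonal_frame[OF ip] by blast
  have "c *\<^sub>R p' - s *\<^sub>R q' = (c\<^sup>2 + s\<^sup>2) *\<^sub>R p" "s *\<^sub>R p' + c *\<^sub>R q' = (c\<^sup>2 + s\<^sup>2) *\<^sub>R q"
    by (simp_all add: p'_def q'_def power2_eq_square scaleR_add_right scaleR_diff_right scaleR_add_left mult.commute)
  then have "p = c *\<^sub>R (norm p' *\<^sub>R f1) - s *\<^sub>R (norm q' *\<^sub>R f2)" "q = s *\<^sub>R (norm p' *\<^sub>R f1) + c *\<^sub>R (norm q' *\<^sub>R f2)"
    unfolding f(4,5)[symmetric] cs by simp_all
  then show ?thesis
    using f(1-3) cs le n2
    by (intro exI[of _ f1] exI[of _ f2] exI[of _ "norm p'"] exI[of _ "norm q'"] exI[of _ c] exI[of _ s])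
      (simp add: mult.commute)
qed

text \<open>Collected by fidelities, the left side is \<open>p1 * A + p2 * B\<close> plus two terms
  with nonpositive coefficients. From \<open>0 \<le> A\<close>, \<open>A \<le> 1\<close> and
  \<open>B \<le> 1 - A\<close> it is at most a convex combination of upper bounds of
  \<open>p1\<close> and \<open>p2\<close>.\<close>

lemma two_frame_mixture_bound:
  fixes t1 t2 p1 p2 p3 p4 m :: real
  defines "r \<equiv> (4 + 5 * sqrt 2) / 16" and "\<mu> \<equiv> - (1 + 2 * sqrt 2) / 4"
  assumes t: "0 \<le> t2" "t2 \<le> t1" "t1\<^sup>2 + t2\<^sup>2 = 4"
    and p: "0 \<le> p1" "0 \<le> p2" "0 \<le> p3" "0 \<le> p4" "p1 + p2 + p3 + p4 = 1" and m: "p1 \<le> m" "p2 \<le> m"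
  shows "r * (t1 * (p1 + p2 - p3 - p4) + t2 * (p1 - p2 + p3 - p4)) + \<mu> \<le> m"
proof -
  define q :: real where "q = sqrt 2"
  have s2: "q * q = 2" "1 < q" by (simp_all add: q_def)
  have s3: "q \<le> 3 / 2" unfolding q_def by (rule real_le_lsqrt) (simp_all add: power2_eq_square)
  have rq: "r = (4 + 5 * q) / 16" and mq: "\<mu> = - (1 + 2 * q) / 4" by (simp_all add: r_def \<mu>_def q_def)
  have r: "0 < r" using s2(2) by (simp add: rq field_simps)
  define A where "A = r * (t1 + t2) + \<mu>"
  define B where "B = r * (t1 - t2) + \<mu>"
  have "(t1 + t2)\<^sup>2 \<le> 8" using t sum_squares_bound[of t1 t2] by (simp add: power2_sum)
  moreover have "(2 * q)\<^sup>2 = 8" using s2(1) by (simp add: power_mult_distrib power2_eq_square)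
  ultimately have ub: "t1 + t2 \<le> 2 * q"
    using s2 by (intro power2_le_imp_le[of "t1 + t2" "2 * q"]) auto
  have "t1\<^sup>2 \<le> 4" using t(3) zero_le_power2[of t2] by linarith
  then have "t1\<^sup>2 \<le> 2\<^sup>2" by simp
  then have t12: "t1 \<le> 2" by (rule power2_le_imp_le) simp
  have "0 \<le> t1 * t2" using t by simp
  moreover have "(t1 + t2)\<^sup>2 = 4 + 2 * (t1 * t2)" using t(3) by (simp add: power2_sum)
  ultimately have "2\<^sup>2 \<le> (t1 + t2)\<^sup>2" by simp
  then have lb: "2 \<le> t1 + t2" using t by (intro power2_le_imp_le[of 2 "t1 + t2"]) auto
  \<comment> \<open>The extreme case is \<open>t1 = t2 = sqrt 2\<close>; the relation
    \<open>r * 2 * sqrt 2 + \<mu> = 1\<close> makes \<open>A = 1\<close> there.\<close>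
  have "r * (t1 + t2) \<le> r * (2 * q)" using r ub by (intro mult_left_mono) auto
  also have "r * (2 * q) = 1 - \<mu>" using s2(1) by (simp add: rq mq field_simps)
  finally have A1: "A \<le> 1" by (simp add: A_def)
  have "r * 2 \<le> r * (t1 + t2)" using r lb by (intro mult_left_mono) auto
  moreover have "0 \<le> r * 2 + \<mu>" using s2(2) by (simp add: rq mq field_simps)
  ultimately have A0: "0 \<le> A" by (simp add: A_def)
  \<comment> \<open>\<open>A + B = 2 * r * t1 + 2 * \<mu>\<close> is largest at
    \<open>t1 = 2\<close>, where it equals \<open>(2 + sqrt 2) / 4 < 1\<close>.\<close>
  have "r * t1 \<le> r * 2" using r t12 by (intro mult_left_mono) auto
  moreover have "4 * r + 2 * \<mu> \<le> 1" using s3 by (simp add: rq mq field_simps)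
  ultimately have AB: "B \<le> 1 - A" by (simp add: A_def B_def algebra_simps)
  have "0 \<le> r * (t1 - t2)" using r t by simp
  moreover have "\<mu> \<le> 0" using s2(2) by (simp add: mq field_simps)
  ultimately have C: "2 * \<mu> - B \<le> 0" by (simp add: B_def)
  have D: "2 * \<mu> - A \<le> 0" using A0 \<open>\<mu> \<le> 0\<close> by simp
  have "r * (t1 * (p1 + p2 - p3 - p4) + t2 * (p1 - p2 + p3 - p4)) + \<mu> * (p1 + p2 + p3 + p4)
      = p1 * A + p2 * B + p3 * (2 * \<mu> - B) + p4 * (2 * \<mu> - A)"
    by (simp add: A_def B_def algebra_simps)
  then have "r * (t1 * (p1 + p2 - p3 - p4) + t2 * (p1 - p2 + p3 - p4)) + \<mu>
      = p1 * A + p2 * B + p3 * (2 * \<mu> - B) + p4 * (2 * \<mu> - A)"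
    using p(5) by simp
  also have "\<dots> \<le> m * A + p2 * (1 - A) + 0 + 0"
    using p m A0 AB C D by (intro add_mono mult_right_mono mult_left_mono mult_nonneg_nonpos) auto
  also have "\<dots> \<le> m * A + m * (1 - A) + 0 + 0"
    using m A1 mult_right_mono[of p2 m "1 - A"] by simp
  also have "\<dots> = m" by (simp add: algebra_simps)
  finally show ?thesis .
qed

text \<open>Twice \<open>sqrt 2\<close> times the metric is at most
  \<open>t1 * k1 + t2 * k2\<close>, with \<open>k1\<close>, \<open>k2\<close> the correlators along
  the principal axes, and the fidelities of the four sign choices are the Fourier transform of
  \<open>1\<close>, \<open>k1\<close>, \<open>k2\<close>, \<open>y\<close> over sign pairs.\<close>

lemma robustness_2:
  assumes M: "povm 2 M" and q: "qubit_states 2 \<rho>" and S: "1 - \<epsilon> \<le> success 2 \<rho> M"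
  shows "\<exists>L. local_channel 2 L \<and> 1 - (4 + 5 * sqrt 2) / (4 * sqrt 2) * \<epsilon> \<le> fidelity_at 2 M L"
proof -
  obtain x z ca sa and u v :: "nat \<Rightarrow> bloch" where
    xz: "norm x = 1" "norm z = 1" "inner x z = 0" and cs: "0 \<le> ca" "0 \<le> sa" "ca\<^sup>2 + sa\<^sup>2 = (1::real)"
    and uv: "\<And>k. norm (u k) = 1" "\<And>k. norm (v k) = 1"
    and S': "(real 2 - 1) * sqrt 2 * success 2 \<rho> M
      \<le> (real 2 - 1) * ca * corr 2 M (\<lambda>s. s 1) (\<lambda>k. if k = 1 then sig x else sig (u k))
        + (\<Sum>j\<in>{2..2}. sa * corr 2 M (\<lambda>s. s j) (\<lambda>k. if k = 1 then sig z else if k = j then sig (v j) else 1\<^sub>m 2))"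
    using success_le_unit[OF M _ q] by blast
  have two: "{1..2} = {1, 2 :: nat}" by auto
  define Tx where "Tx b = corr 2 M (\<lambda>s. s 1) (\<lambda>k. if k = 1 then sig x else if k = 2 then sig b else 1\<^sub>m 2)" for b
  define Tz where "Tz b = corr 2 M (\<lambda>s. s 2) (\<lambda>k. if k = 1 then sig z else if k = 2 then sig b else 1\<^sub>m 2)" for b
  \<comment> \<open>\<open>Y\<close> is the correlator of the third stabilizer, with qubit 1 fixed
    in the frame \<open>x\<close>, \<open>z\<close> and an arbitrary operator on qubit 2.\<close>
  define Y where "Y A = corr 2 M (\<lambda>s. s 1 + s 2) (\<lambda>k. if k = 1 then sig z * sig x else A)" for A
  have lin: "Tx (a *\<^sub>R f + b *\<^sub>R f') = a * Tx f + b * Tx f'" "Tz (a *\<^sub>R f + b *\<^sub>R f') = a * Tz f + b * Tz f'" for a b f f'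
    unfolding Tx_def Tz_def by (simp_all only: corr_second_linear[OF M, of 2] atLeastAtMost_iff order_refl)
  have SS: "sqrt 2 * success 2 \<rho> M \<le> ca * Tx (u 2) + sa * Tz (v 2)"
  proof -
    have "corr 2 M (\<lambda>s. s 1) (\<lambda>k. if k = 1 then sig x else sig (u k)) = Tx (u 2)"
      unfolding Tx_def
    proof (rule corr_cong)
      fix k :: nat assume "k \<in> {1..2}"
      then have "k = 1 \<or> k = 2" unfolding two by simp
      then show "(if k = 1 then sig x else sig (u k)) = (if k = 1 then sig x else if k = 2 then sig (u 2) else 1\<^sub>m 2)"
        by auto
    qed
    moreover have "(\<Sum>j\<in>{2..2}. sa * corr 2 M (\<lambda>s. s j) (\<lambda>k. if k = 1 then sig z else if k = j then sig (v j) else 1\<^sub>m 2)) = sa * Tz (v 2)"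
      unfolding atLeastAtMost_singleton Tz_def by (subst sum.insert) simp_all
    moreover have "(real 2 - 1) = 1" by simp
    ultimately show ?thesis using S' by (simp only: mult_1)
  qed
  \<comment> \<open>The factors 2 make the squared singular values add up to 4, as
    \<open>two_frame_mixture_bound\<close> requires.\<close>
  obtain f1 f2 t1 t2 c s where f: "norm f1 = 1" "norm f2 = 1" "inner f1 f2 = 0" and c: "c\<^sup>2 + s\<^sup>2 = (1::real)"
    and t: "0 \<le> t2" "t2 \<le> t1" "t1\<^sup>2 + t2\<^sup>2 = (norm ((2 * ca) *\<^sub>R u 2))\<^sup>2 + (norm ((2 * sa) *\<^sub>R v 2))\<^sup>2"
    and w: "(2 * ca) *\<^sub>R u 2 = (t1 * c) *\<^sub>R f1 + (- (t2 * s)) *\<^sub>R f2" "(2 * sa) *\<^sub>R v 2 = (t1 * s) *\<^sub>R f1 + (t2 * c) *\<^sub>R f2"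
    using principal_axes[of "(2 * ca) *\<^sub>R u 2" "(2 * sa) *\<^sub>R v 2"] by blast
  have t4: "t1\<^sup>2 + t2\<^sup>2 = 4" using t(3) cs(3) uv by (simp add: power_mult_distrib flip: distrib_left)
  define k1 where "k1 = c * Tx f1 + s * Tz f1"
  define k2 where "k2 = c * Tz f2 - s * Tx f2"
  define y where "y = Y (sig f2 * sig f1)"
  have W: "2 * (sqrt 2 * success 2 \<rho> M) \<le> t1 * k1 + t2 * k2"
  proof -
    have "2 * (ca * Tx (u 2)) = Tx ((2 * ca) *\<^sub>R u 2)" "2 * (sa * Tz (v 2)) = Tz ((2 * sa) *\<^sub>R v 2)"
      using lin(1)[of "2 * ca" "u 2" 0 "u 2"] lin(2)[of "2 * sa" "v 2" 0 "v 2"] by simp_all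
    then have "2 * (sqrt 2 * success 2 \<rho> M) \<le> Tx ((2 * ca) *\<^sub>R u 2) + Tz ((2 * sa) *\<^sub>R v 2)"
      using SS by linarith
    also have "\<dots> = t1 * k1 + t2 * k2"
      unfolding w lin k1_def k2_def by (simp add: algebra_simps)
    finally show ?thesis .
  qed
  have fid: "\<exists>L. local_channel 2 L \<and> 4 * fidelity_at 2 M L = 1 + \<alpha> * k1 + \<beta> * k2 + \<alpha> * \<beta> * y \<and> 0 \<le> fidelity_at 2 M L"
    if ab: "\<alpha>\<^sup>2 = 1" "\<beta>\<^sup>2 = 1" for \<alpha> \<beta> :: real
  proof -
    \<comment> \<open>\<open>e1\<close>, \<open>e2\<close> arise from the decompositions of
      \<open>(2 * ca) *\<^sub>R u 2\<close> and \<open>(2 * sa) *\<^sub>R v 2\<close> by replacing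
      the singular values with signs; for \<open>\<alpha> = \<beta> = 1\<close> this is the
      isometric factor of a polar decomposition.\<close>
    define e1 where "e1 = (\<alpha> * c) *\<^sub>R f1 + (- (\<beta> * s)) *\<^sub>R f2"
    define e2 where "e2 = (\<alpha> * s) *\<^sub>R f1 + (\<beta> * c) *\<^sub>R f2"
    have ff: "inner f1 f1 = 1" "inner f2 f2 = 1" "inner f2 f1 = 0" using f by (simp_all add: norm_eq_1 inner_commute)
    have abm: "\<alpha> * \<alpha> = 1" "\<beta> * \<beta> = 1" "c * c + s * s = 1" using ab c by (simp_all add: power2_eq_square)
    have "inner e1 e1 = (\<alpha> * \<alpha>) * (c * c) + (\<beta> * \<beta>) * (s * s)" "inner e2 e2 = (\<alpha> * \<alpha>) * (s * s) + (\<beta> * \<beta>) * (c * c)"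
      "inner e1 e2 = (\<alpha> * \<alpha>) * (c * s) - (\<beta> * \<beta>) * (c * s)"
      by (simp_all add: e1_def e2_def inner_add_left inner_add_right inner_diff_left inner_diff_right ff f algebra_simps)
    then have e: "norm e1 = 1" "norm e2 = 1" "inner e1 e2 = 0" using abm by (simp_all add: norm_eq_1)
    define fx where "fx k = (if k = 1 then x else e1)" for k :: nat
    define fz where "fz k = (if k = 1 then z else e2)" for k :: nat
    have "\<forall>k. norm (fx k) = 1 \<and> norm (fz k) = 1 \<and> inner (fx k) (fz k) = 0"
      using xz e by (simp_all add: fx_def fz_def)
    from frame_channel[OF M this] obtain L M' where L: "local_channel 2 L" and M': "povm 2 M'"
      and F: "fidelity_at 2 M L = expect 2 M' (\<lambda>s. projector (ghz 2 s))"
      and tr: "\<And>\<tau> P V. (\<forall>k\<in>{1..2}. pauli_pair (fx k) (fz k) (P k) (V k)) \<Longrightarrow> corr 2 M' \<tau> P = corr 2 M \<tau> V"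
      by blast
    have 1: "corr 2 M' (\<lambda>s. s 1) (\<lambda>_. PX) = Tx e1"
      unfolding Tx_def by (rule tr) (simp add: pauli_pair_def two fx_def)
    have 2: "corr 2 M' (\<lambda>s. s 2) (\<lambda>_. PZ) = Tz e2"
      unfolding Tz_def by (rule tr) (simp add: pauli_pair_def two fz_def)
    have 3: "corr 2 M' (\<lambda>s. s 1 + s 2) (\<lambda>_. PZ * PX) = Y (sig e2 * sig e1)"
      unfolding Y_def by (rule tr) (simp add: pauli_pair_def two fx_def fz_def)
    \<comment> \<open>Both pairs span the same plane, so \<open>sig e2 * sig e1\<close> is
      \<open>sig f2 * sig f1\<close> up to the relative orientation
      \<open>\<alpha> * \<beta>\<close>.\<close>
    have "Y (sig e2 * sig e1) = \<alpha> * \<beta> * y"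
    proof -
      let ?A = "sig f2 * sig f1"
      have "\<alpha> * s * (\<alpha> * c) + \<beta> * c * - (\<beta> * s) = (\<alpha> * \<alpha>) * (s * c) - (\<beta> * \<beta>) * (s * c)"
        by (simp add: algebra_simps)
      then have co1: "\<alpha> * s * (\<alpha> * c) + \<beta> * c * - (\<beta> * s) = 0" unfolding abm by simp
      have "\<beta> * c * (\<alpha> * c) - \<alpha> * s * - (\<beta> * s) = \<alpha> * \<beta> * (c * c + s * s)"
        by (simp add: algebra_simps)
      then have co2: "\<beta> * c * (\<alpha> * c) - \<alpha> * s * - (\<beta> * s) = \<alpha> * \<beta>" unfolding abm by simp
      have "sig e2 * sig e1 = complex_of_real 0 \<cdot>\<^sub>m 1\<^sub>m 2 + complex_of_real (\<alpha> * \<beta>) \<cdot>\<^sub>m ?A"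
        unfolding e1_def e2_def sig_rotation_mult[OF f] co1 co2 ..
      then have B: "(if 2 = (1::nat) then sig z * sig x else sig e2 * sig e1)
          = complex_of_real 0 \<cdot>\<^sub>m 1\<^sub>m 2 + complex_of_real (\<alpha> * \<beta>) \<cdot>\<^sub>m ?A" by simp
      let ?V = "\<lambda>k. if k = 1 then sig z * sig x else sig e2 * sig e1"
      have A: "?A \<in> carrier_mat 2 2" by (rule mult_carrier_mat[OF sig_carrier sig_carrier])
      have "Y (sig e2 * sig e1) = 0 * corr 2 M (\<lambda>s. s 1 + s 2) (?V(2 := 1\<^sub>m 2)) + \<alpha> * \<beta> * corr 2 M (\<lambda>s. s 1 + s 2) (?V(2 := ?A))"
        unfolding Y_def by (rule corr_slot[OF M _ one_carrier_mat A]) (simp, rule B)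
      moreover have "corr 2 M (\<lambda>s. s 1 + s 2) (?V(2 := ?A)) = Y ?A"
        unfolding Y_def
      proof (rule corr_cong)
        fix k :: nat assume "k \<in> {1..2}"
        then have "k = 1 \<or> k = 2" unfolding two by simp
        then show "(?V(2 := ?A)) k = (if k = 1 then sig z * sig x else ?A)" by auto
      qed
      ultimately have "Y (sig e2 * sig e1) = \<alpha> * \<beta> * Y ?A" by simp
      then show ?thesis by (simp add: y_def)
    qed
    then have "4 * fidelity_at 2 M L = 1 + Tx e1 + Tz e2 + \<alpha> * \<beta> * y"
      unfolding F expect_ghz_2[OF M'] 1 2 3 by simp
    moreover have "Tx e1 + Tz e2 = \<alpha> * k1 + \<beta> * k2"
      unfolding e1_def e2_def lin k1_def k2_def by (simp add: algebra_simps)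
    ultimately have "4 * fidelity_at 2 M L = 1 + \<alpha> * k1 + \<beta> * k2 + \<alpha> * \<beta> * y" by simp
    moreover have "0 \<le> fidelity_at 2 M L" unfolding F by (rule expect_projector_nonneg[OF M'])
    ultimately show ?thesis using L by blast
  qed
  \<comment> \<open>The sign patterns are the characters of a group of order four, so the fidelities
    add up to 1 and \<open>k1\<close>, \<open>k2\<close> are recovered from them. The frames with
    \<open>\<alpha> = 1\<close> serve as witnesses, \<open>t1\<close> being the larger singular
    value; the other two contribute their nonnegativity.\<close>
  obtain L1 where L1: "local_channel 2 L1" "4 * fidelity_at 2 M L1 = 1 + k1 + k2 + y" "0 \<le> fidelity_at 2 M L1"
    using fid[of 1 1] by auto
  obtain L2 where L2: "local_channel 2 L2" "4 * fidelity_at 2 M L2 = 1 + k1 - k2 - y" "0 \<le> fidelity_at 2 M L2"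
    using fid[of 1 "- 1"] by auto
  obtain L3 where L3: "4 * fidelity_at 2 M L3 = 1 - k1 + k2 - y" "0 \<le> fidelity_at 2 M L3"
    using fid[of "- 1" 1] by auto
  obtain L4 where L4: "4 * fidelity_at 2 M L4 = 1 - k1 - k2 + y" "0 \<le> fidelity_at 2 M L4"
    using fid[of "- 1" "- 1"] by auto
  let ?p1 = "fidelity_at 2 M L1" and ?p2 = "fidelity_at 2 M L2" and ?p3 = "fidelity_at 2 M L3" and ?p4 = "fidelity_at 2 M L4"
  have k: "k1 = ?p1 + ?p2 - ?p3 - ?p4" "k2 = ?p1 - ?p2 + ?p3 - ?p4" "?p1 + ?p2 + ?p3 + ?p4 = 1"
    using L1(2) L2(2) L3(1) L4(1) by linarith+
  have s2: "sqrt 2 * sqrt 2 = (2::real)" by simp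
  have "1 - (4 + 5 * sqrt 2) / (4 * sqrt 2) * \<epsilon> = (4 + 5 * sqrt 2) / 16 * (2 * (sqrt 2 * (1 - \<epsilon>))) + - (1 + 2 * sqrt 2) / 4"
  proof -
    have "(4 + 5 * sqrt 2) / (4 * sqrt 2) = (4 * sqrt 2 + 10) / 8"
      using s2 by (simp add: field_simps)
    then show ?thesis using s2 by (simp add: field_simps)
  qed
  also have "\<dots> \<le> (4 + 5 * sqrt 2) / 16 * (t1 * k1 + t2 * k2) + - (1 + 2 * sqrt 2) / 4"
  proof -
    have "2 * (sqrt 2 * (1 - \<epsilon>)) \<le> 2 * (sqrt 2 * success 2 \<rho> M)" using S by simp
    also have "\<dots> \<le> t1 * k1 + t2 * k2" by (rule W)
    finally show ?thesis by (intro add_right_mono mult_left_mono) auto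
  qed
  also have "\<dots> \<le> max ?p1 ?p2"
    using two_frame_mixture_bound[OF t(1,2) t4 L1(3) L2(3) L3(2) L4(2) k(3), of "max ?p1 ?p2"]
    unfolding k(1,2)[symmetric] by simp
  finally show ?thesis
    unfolding le_max_iff_disj using L1(1) L2(1) by blast
qed

section \<open>Boundedness of the fidelity\<close>

text \<open>Testing at \<open>e_p + y e_q\<close> with \<open>y\<close> among \<open>1\<close>,
  \<open>-1\<close>, \<open>\<i>\<close>, \<open>-\<i>\<close> bounds twice the real and imaginary
  parts of the entry by the sum of the two diagonal entries.\<close>

lemma psd_entry_bound:
  assumes A: "psd d A" and pq: "p < d" "q < d"
  shows "cmod (A $$ (p, q)) \<le> Re (A $$ (p, p)) + Re (A $$ (q, q))"
proof (cases "p = q")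
  case True
  have "0 \<le> A $$ (p, p)" using psd_diag[OF A pq(1)] .
  then have "cmod (A $$ (p, p)) = Re (A $$ (p, p))" "0 \<le> Re (A $$ (p, p))"
    by (auto simp: less_eq_complex_def cmod_eq_Re)
  then show ?thesis using True by simp
next
  case False
  have Ac: "A \<in> carrier_mat d d" using A by (simp add: psd_def)
  have form: "0 \<le> A $$ (p, p) + A $$ (p, q) * y + A $$ (q, p) * cnj y + A $$ (q, q) * (y * cnj y)" for y
  proof -
    let ?v = "vec d (\<lambda>i. if i = p then 1 else if i = q then y else 0)"
    have "0 \<le> (A *\<^sub>v ?v) \<bullet>c ?v" using A by (simp add: psd_def)
    also have "\<dots> = (\<Sum>i<d. \<Sum>k<d. A $$ (i, k) * ?v $ k * cnj (?v $ i))"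
      by (rule quadratic_form_entry[OF Ac]) simp
    also have "\<dots> = (\<Sum>i\<in>{p, q}. \<Sum>k\<in>{p, q}. A $$ (i, k) * ?v $ k * cnj (?v $ i))"
    proof (rule sum.mono_neutral_cong_right)
      show "\<forall>i\<in>{..<d} - {p, q}. (\<Sum>k<d. A $$ (i, k) * ?v $ k * cnj (?v $ i)) = 0" by simp
    next
      fix i assume "i \<in> {p, q}"
      show "(\<Sum>k<d. A $$ (i, k) * ?v $ k * cnj (?v $ i)) = (\<Sum>k\<in>{p, q}. A $$ (i, k) * ?v $ k * cnj (?v $ i))"
        by (rule sum.mono_neutral_right) (use pq in auto)
    qed (use pq in auto)
    also have "\<dots> = A $$ (p, p) + A $$ (p, q) * y + A $$ (q, p) * cnj y + A $$ (q, q) * (y * cnj y)"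
      using pq False by (simp add: algebra_simps)
    finally show ?thesis .
  qed
  define D where "D = Re (A $$ (p, p)) + Re (A $$ (q, q))"
  have "Im (A $$ (p, p)) = 0" "Im (A $$ (q, q)) = 0"
    using psd_diag[OF A pq(1)] psd_diag[OF A pq(2)] by (auto simp: less_eq_complex_def)
  then have "2 * \<bar>Re (A $$ (p, q))\<bar> \<le> D" "2 * \<bar>Im (A $$ (p, q))\<bar> \<le> D"
    using form[of 1] form[of "- 1"] form[of \<i>] form[of "- \<i>"]
    by (auto simp: less_eq_complex_def D_def)
  then have "\<bar>Re (A $$ (p, q))\<bar> + \<bar>Im (A $$ (p, q))\<bar> \<le> D" by linarith
  then show ?thesis using cmod_le[of "A $$ (p, q)"] unfolding D_def by linarith
qed

text \<open>The entries of the images of the matrix units are the entries of the Choi matrix, which is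
  positive semidefinite of trace \<open>2\<close>.\<close>

lemma channel_entry_bound:
  assumes L: "channel 2 L" and ik: "i < 2" "k < 2" and ab: "a < 2" "b < 2"
  shows "cmod (L (mat_unit 2 i k) $$ (a, b)) \<le> 4"
proof -
  \<comment> \<open>The unnormalised maximally entangled vector \<open>|00> + |11>\<close>: block
    \<open>(i, k)\<close> of its projector is the matrix unit \<open>(i, k)\<close>.\<close>
  define v where "v = vec 4 (\<lambda>p. if p = 0 \<or> p = 3 then 1 else 0 :: complex)"
  define X where "X = projector v"
  have Xc: "X \<in> carrier_mat 4 4" unfolding X_def by (rule projector_carrier) (simp add: v_def)
  have Xe: "X $$ (p, q) = (if (p = 0 \<or> p = 3) \<and> (q = 0 \<or> q = 3) then 1 else 0)" if "p < 4" "q < 4" for p q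
    using that by (auto simp: X_def projector_def v_def)
  have "psd (2 * 2) X"
  proof -
    have "0 \<le> (X *\<^sub>v w) \<bullet>c w" if w: "w \<in> carrier_vec 4" for w
    proof -
      have "(X *\<^sub>v w) \<bullet>c w = (\<Sum>p<4. \<Sum>q<4. X $$ (p, q) * w $ q * cnj (w $ p))"
        by (rule quadratic_form_entry[OF Xc w])
      also have "\<dots> = (w $ 0 + w $ 3) * cnj (w $ 0 + w $ 3)"
        by (simp add: Xe lessThan_nat_numeral lessThan_Suc numeral_3_eq_3 algebra_simps)
      also have "\<dots> = complex_of_real ((cmod (w $ 0 + w $ 3))\<^sup>2)"
        by (rule complex_norm_square[symmetric])
      finally show ?thesis by (simp add: less_eq_complex_def)
    qed
    then show ?thesis using Xc by (simp add: psd_def)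
  qed
  then have C: "psd (2 * 2) (ampliation 2 2 L X)"
    using L unfolding channel_def completely_positive_def by blast
  have blk: "block 2 X i k = mat_unit 2 i k" if "i < 2" "k < 2" for i k
  proof (rule eq_matI, goal_cases)
    case (1 a b)
    then have "a < 2" "b < 2" by (auto simp: mat_unit_def)
    then show ?case using that by (auto simp: block_def mat_unit_def Xe less_2_cases_iff)
  qed (auto simp: block_def mat_unit_def)
  have ent: "ampliation 2 2 L X $$ (i * 2 + a, k * 2 + b) = L (mat_unit 2 i k) $$ (a, b)"
    if "i < 2" "k < 2" "a < 2" "b < 2" for i k a b
  proof -
    have "i * 2 + a < 4" "k * 2 + b < 4" "(i * 2 + a) div 2 = i" "(k * 2 + b) div 2 = k"
      "(i * 2 + a) mod 2 = a" "(k * 2 + b) mod 2 = b" using that by auto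
    then show ?thesis using blk[OF that(1,2)] by (simp add: ampliation_def)
  qed
  \<comment> \<open>By trace preservation the diagonal of the image of \<open>mat_unit 2 i i\<close>
    sums to 1, so each of its nonnegative entries is at most 1. The resulting entry bound 2 is
    relaxed to 4.\<close>
  have diag: "Re (L (mat_unit 2 i i) $$ (a, a)) \<le> 1" if "i < 2" "a < 2" for i a
  proof -
    have nonneg: "0 \<le> Re (L (mat_unit 2 i i) $$ (b, b))" if "b < 2" for b
    proof -
      have "i * 2 + b < 2 * 2" using \<open>i < 2\<close> that by simp
      then have "0 \<le> ampliation 2 2 L X $$ (i * 2 + b, i * 2 + b)" by (rule psd_diag[OF C])
      then show ?thesis unfolding ent[OF \<open>i < 2\<close> \<open>i < 2\<close> that that] by (simp add: less_eq_complex_def)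
    qed
    have "L (mat_unit 2 i i) \<in> carrier_mat 2 2" using L by (simp add: channel_def linear_map_def)
    moreover have "mtrace (L (mat_unit 2 i i)) = mtrace (mat_unit 2 i i)" using L by (simp add: channel_def)
    moreover have "mtrace (mat_unit 2 i i) = 1"
      using \<open>i < 2\<close> by (auto simp: mtrace_def mat_unit_def numeral_2_eq_2 less_Suc_eq)
    ultimately have "Re (L (mat_unit 2 i i) $$ (0, 0)) + Re (L (mat_unit 2 i i) $$ (1, 1)) = 1"
      by (simp add: mtrace_def numeral_2_eq_2 complex_eq_iff)
    then show ?thesis using nonneg[of 0] nonneg[of 1] \<open>a < 2\<close> by (auto simp: less_2_cases_iff)
  qed
  have "cmod (ampliation 2 2 L X $$ (i * 2 + a, k * 2 + b))
      \<le> Re (ampliation 2 2 L X $$ (i * 2 + a, i * 2 + a)) + Re (ampliation 2 2 L X $$ (k * 2 + b, k * 2 + b))"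
    using ik ab by (intro psd_entry_bound[OF C]) auto
  then show ?thesis
    unfolding ent[OF ik ab] ent[OF ik(1,1) ab(1,1)] ent[OF ik(2,2) ab(2,2)]
    using diag[OF ik(1) ab(1)] diag[OF ik(2) ab(2)] by linarith
qed

text \<open>\<open>avg_fidelity\<close> is a supremum of reals, which is known to dominate its
  members once the set is bounded above. The crude bound \<open>K\<close> depends on
  \<open>M\<close> but not on the channel; it rests on the bounded entries of every channel factor
  instead of compactness.\<close>

lemma fidelity_at_bounded:
  assumes M: "povm n M"
  shows "bdd_above (fidelity_at n M ` {L. local_channel n L})"
proof -
  let ?d = "2 ^ n :: nat"
  let ?P = "\<lambda>s. projector (ghz n s)"
  define K where "K = 1 / 2 ^ n * (\<Sum>s\<in>bitstrings n. \<Sum>i<?d. \<Sum>k<?d. cmod (M s $$ (i, k)) * (\<Sum>a<?d. \<Sum>b<?d. 4 ^ n * cmod (?P s $$ (a, b))))"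
  have "fidelity_at n M L \<le> K" if L: "local_channel n L" for L
  proof -
    have ch: "channel 2 (L j)" if "j \<in> {1..n}" for j using L that by (simp add: local_channel_def)
    have lin: "linear_map 2 (L j)" if "j \<in> {1..n}" for j using ch[OF that] by (simp add: channel_def)
    define T where "T i k = tensor n (\<lambda>j. L j (mat_unit 2 (digit n i j) (digit n k j)))" for i k
    have T: "tensor_map n L (mat_unit ?d i k) = T i k" if "i < ?d" "k < ?d" for i k
      unfolding T_def tensor_mat_unit[OF that, symmetric] by (rule tensor_map_tensor[OF lin mat_unit_carrier])
    have Tb: "cmod (T i k $$ (a, b)) \<le> 4 ^ n" if "a < ?d" "b < ?d" for i k a b
    proof -
      have "cmod (T i k $$ (a, b)) = (\<Prod>j\<in>{1..n}. cmod (L j (mat_unit 2 (digit n i j) (digit n k j)) $$ (digit n a j, digit n b j)))"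
        using that by (simp add: T_def tensor_entry prod_norm)
      also have "\<dots> \<le> (\<Prod>j\<in>{1..n}. 4)"
        using ch by (intro prod_mono conjI channel_entry_bound) auto
      finally show ?thesis by simp
    qed
    define H where "H s = hs_adjoint ?d (tensor_map n L) (?P s)" for s
    have Hc: "H s \<in> carrier_mat ?d ?d" for s by (simp add: H_def hs_adjoint_def)
    have P: "?P s \<in> carrier_mat ?d ?d" for s by (simp add: projector_carrier)
    have H: "cmod (H s $$ (i, k)) \<le> (\<Sum>a<?d. \<Sum>b<?d. 4 ^ n * cmod (?P s $$ (a, b)))" if ik: "i < ?d" "k < ?d" for s i k
    proof -
      have eq: "H s $$ (i, k) = (\<Sum>a<?d. \<Sum>b<?d. cnj (T i k $$ (a, b)) * ?P s $$ (a, b))"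
        using ik P by (simp add: H_def hs_adjoint_def T mtrace_adjoint_mult[where d = ?d] T_def)
      have "cmod (H s $$ (i, k)) \<le> (\<Sum>a<?d. \<Sum>b<?d. cmod (cnj (T i k $$ (a, b)) * ?P s $$ (a, b)))"
        unfolding eq by (rule order_trans[OF norm_sum], rule sum_mono, rule norm_sum)
      also have "\<dots> \<le> (\<Sum>a<?d. \<Sum>b<?d. 4 ^ n * cmod (?P s $$ (a, b)))"
      proof (intro sum_mono)
        fix a b assume "a \<in> {..<?d}" "b \<in> {..<?d}"
        then have "cmod (T i k $$ (a, b)) \<le> 4 ^ n" by (intro Tb) simp_all
        from mult_right_mono[OF this norm_ge_zero[of "?P s $$ (a, b)"]]
        show "cmod (cnj (T i k $$ (a, b)) * ?P s $$ (a, b)) \<le> 4 ^ n * cmod (?P s $$ (a, b))"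
          by (simp add: norm_mult)
      qed
      finally show ?thesis .
    qed
    have "Re (mtrace (M s * H s)) \<le> (\<Sum>i<?d. \<Sum>k<?d. cmod (M s $$ (i, k)) * (\<Sum>a<?d. \<Sum>b<?d. 4 ^ n * cmod (?P s $$ (a, b))))"
      if s: "s \<in> bitstrings n" for s
    proof -
      have "Re (mtrace (M s * H s)) \<le> cmod (\<Sum>i<?d. \<Sum>k<?d. M s $$ (i, k) * H s $$ (k, i))"
        unfolding mtrace_mult[OF povmD(2)[OF M s] Hc] by (rule complex_Re_le_cmod)
      also have "\<dots> \<le> (\<Sum>i<?d. \<Sum>k<?d. cmod (M s $$ (i, k) * H s $$ (k, i)))"
        by (rule order_trans[OF norm_sum], rule sum_mono, rule norm_sum)
      also have "\<dots> \<le> (\<Sum>i<?d. \<Sum>k<?d. cmod (M s $$ (i, k)) * (\<Sum>a<?d. \<Sum>b<?d. 4 ^ n * cmod (?P s $$ (a, b))))"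
      proof (intro sum_mono)
        fix i k assume "i \<in> {..<?d}" "k \<in> {..<?d}"
        then have "cmod (H s $$ (k, i)) \<le> (\<Sum>a<?d. \<Sum>b<?d. 4 ^ n * cmod (?P s $$ (a, b)))"
          by (intro H) simp_all
        from mult_left_mono[OF this norm_ge_zero[of "M s $$ (i, k)"]]
        show "cmod (M s $$ (i, k) * H s $$ (k, i)) \<le> cmod (M s $$ (i, k)) * (\<Sum>a<?d. \<Sum>b<?d. 4 ^ n * cmod (?P s $$ (a, b)))"
          by (simp only: norm_mult)
      qed
      finally show ?thesis .
    qed
    then show ?thesis
      unfolding fidelity_at_def K_def H_def by (intro mult_left_mono sum_mono) auto
  qed
  then show ?thesis by (intro bdd_aboveI[of _ K]) auto
qed

section \<open>From a witnessing channel to the average fidelity\<close>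

lemma fidelity_le_avg_fidelity:
  assumes "povm n M" "local_channel n L"
  shows "fidelity_at n M L \<le> avg_fidelity n M"
  unfolding avg_fidelity_def using assms fidelity_at_bounded by (intro cSUP_upper) auto

theorem theorem2:
  shows
    "(\<forall>n::nat. 2 \<le> n \<and> n \<le> 7 \<longrightarrow>
       (\<exists>r \<mu> :: real. r * (real n - 1) * 2 * sqrt 2 + \<mu> = 1 \<and>
         (\<forall>\<rho> M. \<forall>\<epsilon>::real. qubit_states n \<rho> \<and> povm n M \<and> success n \<rho> M \<ge> 1 - \<epsilon> \<longrightarrow>
            (\<exists>L. local_channel n L \<and>
               fidelity_at n M L \<ge>
                 (r * (real n - 1) * 2 * sqrt 2 + \<mu>) - r * (real n - 1) * 2 * sqrt 2 * \<epsilon>) \<and>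
            avg_fidelity n M \<ge>
              (r * (real n - 1) * 2 * sqrt 2 + \<mu>) - r * (real n - 1) * 2 * sqrt 2 * \<epsilon>)))
     \<and>
     (\<forall>r \<mu> :: real. r = (4 + 5 * sqrt 2) / 16 \<and> \<mu> = - (1 + 2 * sqrt 2) / 4 \<longrightarrow>
       r * (real 2 - 1) * 2 * sqrt 2 + \<mu> = 1 \<and>
       (\<forall>\<rho> M. \<forall>\<epsilon>::real. qubit_states 2 \<rho> \<and> povm 2 M \<and> success 2 \<rho> M \<ge> 1 - \<epsilon> \<longrightarrow>
          (\<exists>L. local_channel 2 L \<and>
             fidelity_at 2 M L \<ge>
               (r * (real 2 - 1) * 2 * sqrt 2 + \<mu>) - r * (real 2 - 1) * 2 * sqrt 2 * \<epsilon> \<and>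
             fidelity_at 2 M L \<ge> 1 - (4 + 5 * sqrt 2) / (4 * sqrt 2) * \<epsilon>) \<and>
          avg_fidelity 2 M \<ge>
            (r * (real 2 - 1) * 2 * sqrt 2 + \<mu>) - r * (real 2 - 1) * 2 * sqrt 2 * \<epsilon> \<and>
          avg_fidelity 2 M \<ge> 1 - (4 + 5 * sqrt 2) / (4 * sqrt 2) * \<epsilon>))"
proof (intro conjI allI impI; (elim conjE)?)
  fix n :: nat
  assume n: "2 \<le> n"
  \<comment> \<open>\<open>C\<close> is the slope from \<open>robustness\<close>; \<open>r\<close>
    solves \<open>r * (n - 1) * 2 * sqrt 2 = C\<close>, and the choice \<open>\<mu> = 1 - C\<close>
    below restores the normalisation.\<close>
  define C where "C = 40 * (real n - 1)\<^sup>2"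
  define r where "r = C / ((real n - 1) * 2 * sqrt 2)"
  have "(real n - 1) * 2 * sqrt 2 \<noteq> 0" using n by simp
  then have "C / ((real n - 1) * 2 * sqrt 2) * ((real n - 1) * 2 * sqrt 2) = C" by (rule nonzero_eq_divide_eq[THEN iffD1, OF _ refl])
  then have rC: "r * (real n - 1) * 2 * sqrt 2 = C" unfolding r_def by (simp only: mult.assoc)
  show "\<exists>r \<mu> :: real. r * (real n - 1) * 2 * sqrt 2 + \<mu> = 1 \<and>
         (\<forall>\<rho> M. \<forall>\<epsilon>::real. qubit_states n \<rho> \<and> povm n M \<and> success n \<rho> M \<ge> 1 - \<epsilon> \<longrightarrow>
            (\<exists>L. local_channel n L \<and>
               fidelity_at n M L \<ge>
                 (r * (real n - 1) * 2 * sqrt 2 + \<mu>) - r * (real n - 1) * 2 * sqrt 2 * \<epsilon>) \<and>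
            avg_fidelity n M \<ge>
              (r * (real n - 1) * 2 * sqrt 2 + \<mu>) - r * (real n - 1) * 2 * sqrt 2 * \<epsilon>)"
  proof (rule exI[of _ r], rule exI[of _ "1 - C"], intro conjI allI impI; (elim conjE)?)
    fix \<rho> M and \<epsilon> :: real
    assume "qubit_states n \<rho>" and M: "povm n M" and "1 - \<epsilon> \<le> success n \<rho> M"
    then obtain L where L: "local_channel n L" "1 - C * \<epsilon> \<le> fidelity_at n M L"
      using robustness[OF M n] unfolding C_def by blast
    then show "\<exists>L. local_channel n L \<and> fidelity_at n M L \<ge>
        (r * (real n - 1) * 2 * sqrt 2 + (1 - C)) - r * (real n - 1) * 2 * sqrt 2 * \<epsilon>"
      unfolding rC by (intro exI[of _ L]) simp
    show "avg_fidelity n M \<ge> (r * (real n - 1) * 2 * sqrt 2 + (1 - C)) - r * (real n - 1) * 2 * sqrt 2 * \<epsilon>"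
      unfolding rC using fidelity_le_avg_fidelity[OF M L(1)] L(2) by simp
  qed (simp add: rC)
next
  fix r \<mu> :: real
  assume r: "r = (4 + 5 * sqrt 2) / 16" and \<mu>: "\<mu> = - (1 + 2 * sqrt 2) / 4"
  have s2: "sqrt 2 * (sqrt 2 * a) = 2 * a" for a :: real
    by (simp flip: mult.assoc)
  have C: "r * (real 2 - 1) * 2 * sqrt 2 = (4 + 5 * sqrt 2) / (4 * sqrt 2)"
    unfolding r by (simp add: field_simps s2)
  show one: "r * (real 2 - 1) * 2 * sqrt 2 + \<mu> = 1"
    unfolding r \<mu> by (simp add: field_simps s2)
  fix \<rho> M and \<epsilon> :: real
  assume "qubit_states 2 \<rho>" and M: "povm 2 M" and "1 - \<epsilon> \<le> success 2 \<rho> M"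
  then obtain L where L: "local_channel 2 L" "1 - (4 + 5 * sqrt 2) / (4 * sqrt 2) * \<epsilon> \<le> fidelity_at 2 M L"
    using robustness_2[OF M] by blast
  then show "\<exists>L. local_channel 2 L \<and>
      fidelity_at 2 M L \<ge> (r * (real 2 - 1) * 2 * sqrt 2 + \<mu>) - r * (real 2 - 1) * 2 * sqrt 2 * \<epsilon> \<and>
      fidelity_at 2 M L \<ge> 1 - (4 + 5 * sqrt 2) / (4 * sqrt 2) * \<epsilon>"
    unfolding one unfolding C by (intro exI[of _ L]) simp
  show "avg_fidelity 2 M \<ge> 1 - (4 + 5 * sqrt 2) / (4 * sqrt 2) * \<epsilon>"
    using fidelity_le_avg_fidelity[OF M L(1)] L(2) by simp
  then show "avg_fidelity 2 M \<ge> (r * (real 2 - 1) * 2 * sqrt 2 + \<mu>) - r * (real 2 - 1) * 2 * sqrt 2 * \<epsilon>"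
    unfolding one unfolding C .
qed

end
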